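(* The character of the space $\Bbbk[\mathbf{I}]$ of functions on the Iwahori group $\mathbf{I}\subset SL_n[z]$ is equal to the image of $$\frac{(x_1\cdots x_ny_1\cdots y_n;q)_\infty}{\prod_{i\le j}(x_iy_j;q)_\infty\prod_{i>j}(qx_iy_j;q)_\infty}$$ under the map $F\mapsto\overline{F}$ (passing from $\mathfrak{gl}_n$- to $\mathfrak{sl}_n$-weights), i.e. to $$\frac{\sum_{\lambda\in P}X^\lambda Y^\lambda}{(q;q)_\infty^{n-1}}\prod_{1\le i<j\le n}\frac{1}{1-X^{\overline{\varepsilon}_i}Y^{\overline{\varepsilon}_j}}\prod_{1\le i\ne j\le n}\frac{1}{(qX^{\overline{\varepsilon}_i}Y^{\overline{\varepsilon}_j};q)_\infty}\in(\mathbb{Z}[[P\times P]])[[q]].$$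
   Context: $\Bbbk$ is an algebraically closed field of characteristic $0$, $n\ge2$. $(a;q)_\infty=\prod_{k\ge0}(1-aq^k)$. $P=\mathbb{Z}^n/\mathbb{Z}(1,\dots,1)$ is the $\mathfrak{sl}_n$ weight lattice, $\lambda\mapsto\overline\lambda$ the quotient map, $\varepsilon_i$ the standard basis of $\mathbb{Z}^n$; $\mathbb{Z}[[P\times P]]$ is the group of all formal sums $\sum c_{\lambda,\mu}X^\lambda Y^\mu$. Let $\Bbbk[M_n[z]^+]$ be the polynomial ring in variables $u_{ij}^{(k)}$, $1\le i,j\le n$, $k\ge0$ if $i\le j$ and $k\ge1$ if $i>j$; put $u_{ij}(s)=\sum_ku_{ij}^{(k)}s^k$ (with $u_{ij}^{(0)}=0$ for $i>j$), and $\det(u_{ij}(s))-1=\sum_{k\ge0}f^{(k)}s^k$. Then $\Bbbk[\mathbf{I}]=\Bbbk[M_n[z]^+]/\langle f^{(0)},f^{(1)},\dots\rangle$. It is graded by $P\times P\times\mathbb{Z}_{\ge0}$, with $u_{ij}^{(k)}$ of degree $(\overline\varepsilon_i,\overline\varepsilon_j,k)$, and its character is $\sum\dim(\Bbbk[\mathbf{I}]_{\lambda,\mu,k})X^\lambda Y^\mu q^k$. The map $F\mapsto\overline F$: for $F=\sum_k q^k\sum_{\lambda,\mu\in(\mathbb{Z}_{\ge0})^n}c^{(k)}_{\lambda,\mu}x^\lambda y^\mu\in\mathbb{Z}[[x,y]][[q]]$ such that for each $k,\lambda,\mu$ only finitely many pairs $(a,b)\in\mathbb{Z}^2$ have $c^{(k)}_{\lambda+a(1,\dots,1),\mu+b(1,\dots,1)}\ne0$,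 one sets $\overline F=\sum_kq^k\sum_{\lambda,\mu}c^{(k)}_{\lambda,\mu}X^{\overline\lambda}Y^{\overline\mu}$. Fractions are expanded as geometric series. *)

theory Defs
  imports
    "HOL-Analysis.Analysis"
    "HOL-Computational_Algebra.Formal_Power_Series"
    "HOL-Library.Poly_Mapping"
begin

text \<open>
  The index set \<open>{1,\<dots>,n}\<close> is a type \<open>'n :: {finite, linorder}\<close> with \<open>n = CARD('n)\<close>;
  \<open>\<int>\<^sup>n\<close> is \<^typ>\<open>int^'n\<close> with standard basis \<^term>\<open>axis i 1\<close>.
\<close>

type_synonym 'n zvec = "(int, 'n) vec"

section \<open>The weight lattice \<open>P\<close>\<close>

quotient_type (overloaded) 'n wlat = "int^'n::finite" / "\<lambda>a b. \<exists>c. a - b = c *s 1"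
  morphisms rep_wlat wbar
proof (rule equivpI)
  show "reflp (\<lambda>a b :: int^'n. \<exists>c. a - b = c *s 1)"
    by (rule reflpI, rule exI[of _ 0]) (simp add: vec_eq_iff)
  show "symp (\<lambda>a b :: int^'n. \<exists>c. a - b = c *s 1)"
  proof (rule sympI)
    fix a b :: "int^'n" assume "\<exists>c. a - b = c *s 1"
    then obtain c where "a - b = c *s 1" ..
    then have "b - a = (- c) *s 1" by (simp add: vec_eq_iff algebra_simps)
    then show "\<exists>c. b - a = c *s 1" ..
  qed
  show "transp (\<lambda>a b :: int^'n. \<exists>c. a - b = c *s 1)"
  proof (rule transpI)
    fix a b d :: "int^'n" assume "\<exists>c. a - b = c *s 1" "\<exists>c. b - d = c *s 1"
    then obtain c c' where "a - b = c *s 1" "b - d = c' *s 1" by blast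
    then have "a - d = (c + c') *s 1" by (simp add: vec_eq_iff algebra_simps)
    then show "\<exists>c. a - d = c *s 1" ..
  qed
qed

instantiation wlat :: (finite) ab_group_add
begin

lift_definition zero_wlat :: "'a wlat" is 0 .

lift_definition plus_wlat :: "'a wlat \<Rightarrow> 'a wlat \<Rightarrow> 'a wlat" is "(+)"
proof -
  fix a b c d :: "int^'a" assume "\<exists>e. a - b = e *s 1" "\<exists>e. c - d = e *s 1"
  then obtain e e' where "a - b = e *s 1" "c - d = e' *s 1" by blast
  then have "a + c - (b + d) = (e + e') *s 1"
    by (simp add: vec_eq_iff algebra_simps)
  then show "\<exists>e. a + c - (b + d) = e *s 1" ..
qed

lift_definition uminus_wlat :: "'a wlat \<Rightarrow> 'a wlat" is uminus
proof -
  fix a b :: "int^'a" assume "\<exists>e. a - b = e *s 1"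
  then obtain e where "a - b = e *s 1" ..
  then have "- a - (- b) = (- e) *s 1" by (simp add: vec_eq_iff algebra_simps)
  then show "\<exists>e. - a - (- b) = e *s 1" ..
qed

definition minus_wlat :: "'a wlat \<Rightarrow> 'a wlat \<Rightarrow> 'a wlat"
  where "minus_wlat a b = a + - b"

instance
proof
  fix a b c :: "'a wlat"
  have eqI: "\<exists>e. x - y = e *s 1" if "x = y" for x y :: "int^'a"
    using that by (intro exI[of _ 0]) (simp add: vec_eq_iff)
  show "a + b + c = a + (b + c)" by transfer (rule eqI, simp add: algebra_simps)
  show "a + b = b + a" by transfer (rule eqI, simp add: algebra_simps)
  show "0 + a = a" by transfer (rule eqI, simp)
  show "- a + a = 0" by transfer (rule eqI, simp)
  show "a - b = a + - b" by (rule minus_wlat_def)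
qed

end

section \<open>The algebra of functions on the Iwahori group\<close>

text \<open>
  \<open>(i, j, k)\<close> stands for the variable \<open>u\<^sub>i\<^sub>j\<^sup>(\<^sup>k\<^sup>)\<close>; only these variables exist, and
  \<open>mpol_u\<close> below is 0 at the excluded indices \<open>i > j\<close>, \<open>k = 0\<close>.
\<close>

typedef (overloaded) 'n uvar = "{(i :: 'n::linorder, j :: 'n, k :: nat). i \<le> j \<or> 1 \<le> k}"
  by (rule exI[of _ "(undefined, undefined, 1)"]) simp

type_synonym ('n, 'k) mpol = "('n uvar \<Rightarrow>\<^sub>0 nat) \<Rightarrow>\<^sub>0 'k"

definition mpol_u :: "'n::linorder \<Rightarrow> 'n \<Rightarrow> nat \<Rightarrow> ('n, 'k::field) mpol"
  where "mpol_u i j k =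
    (if i \<le> j \<or> 1 \<le> k
     then Poly_Mapping.single (Poly_Mapping.single (Abs_uvar (i, j, k)) 1) 1 else 0)"

definition u_matrix :: "((('n::{finite,linorder}, 'k::field) mpol fps, 'n) vec, 'n) vec"
  where "u_matrix = (\<chi> i j. Abs_fps (\<lambda>k. mpol_u i j k))"

definition det_rel :: "nat \<Rightarrow> ('n::{finite,linorder}, 'k::field) mpol"
  where "det_rel k = fps_nth (det u_matrix - 1) k"

text \<open>The ideal generated by a set is its span in the ring viewed as a module over itself.\<close>

definition ideal_gen :: "'a::comm_ring_1 set \<Rightarrow> 'a set"
  where "ideal_gen S = module.span (*) S"

lemma module_mult: "module ((*) :: 'a::comm_ring_1 \<Rightarrow> 'a \<Rightarrow> 'a)"
  by standard (auto simp: algebra_simps)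

lemma ideal_gen_simps:
  shows ideal_gen_0: "0 \<in> ideal_gen S"
    and ideal_gen_add: "x \<in> ideal_gen S \<Longrightarrow> y \<in> ideal_gen S \<Longrightarrow> x + y \<in> ideal_gen S"
    and ideal_gen_mult: "x \<in> ideal_gen S \<Longrightarrow> r * x \<in> ideal_gen S"
    and ideal_gen_neg: "x \<in> ideal_gen S \<Longrightarrow> - x \<in> ideal_gen S"
  unfolding ideal_gen_def
  by (auto intro: module.span_zero[OF module_mult] module.span_add[OF module_mult]
      module.span_scale[OF module_mult] module.span_neg[OF module_mult])

definition iw_ideal :: "('n::{finite,linorder}, 'k::field) mpol set"
  where "iw_ideal = ideal_gen (range det_rel)"

quotient_type (overloaded) ('n, 'k) iwahori_fun =
  "('n::{finite,linorder}, 'k::field) mpol" / "\<lambda>p r. p - r \<in> iw_ideal"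
  morphisms rep_iw iw_class
proof (rule equivpI)
  show "reflp (\<lambda>p r :: ('n, 'k) mpol. p - r \<in> iw_ideal)"
    by (rule reflpI) (simp add: iw_ideal_def ideal_gen_0)
  show "symp (\<lambda>p r :: ('n, 'k) mpol. p - r \<in> iw_ideal)"
  proof (rule sympI)
    fix p r :: "('n, 'k) mpol" assume "p - r \<in> iw_ideal"
    then have "- (p - r) \<in> iw_ideal" unfolding iw_ideal_def by (rule ideal_gen_neg)
    then show "r - p \<in> iw_ideal" by simp
  qed
  show "transp (\<lambda>p r :: ('n, 'k) mpol. p - r \<in> iw_ideal)"
  proof (rule transpI)
    fix p r t :: "('n, 'k) mpol" assume "p - r \<in> iw_ideal" "r - t \<in> iw_ideal"
    then have "(p - r) + (r - t) \<in> iw_ideal" unfolding iw_ideal_def by (rule ideal_gen_add)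
    then show "p - t \<in> iw_ideal" by simp
  qed
qed

instantiation iwahori_fun :: ("{finite,linorder}", field) comm_ring
begin

lift_definition zero_iwahori_fun :: "('a, 'b) iwahori_fun" is 0 .

lift_definition plus_iwahori_fun ::
  "('a, 'b) iwahori_fun \<Rightarrow> ('a, 'b) iwahori_fun \<Rightarrow> ('a, 'b) iwahori_fun" is "(+)"
proof -
  fix p p' r r' :: "('a, 'b) mpol" assume "p - p' \<in> iw_ideal" "r - r' \<in> iw_ideal"
  then have "(p - p') + (r - r') \<in> iw_ideal" unfolding iw_ideal_def by (rule ideal_gen_add)
  then show "p + r - (p' + r') \<in> iw_ideal" by (simp add: algebra_simps)
qed

lift_definition uminus_iwahori_fun ::
  "('a, 'b) iwahori_fun \<Rightarrow> ('a, 'b) iwahori_fun" is uminus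
proof -
  fix p p' :: "('a, 'b) mpol" assume "p - p' \<in> iw_ideal"
  then have "- (p - p') \<in> iw_ideal" unfolding iw_ideal_def by (rule ideal_gen_neg)
  then show "- p - (- p') \<in> iw_ideal" by (simp add: algebra_simps)
qed

definition minus_iwahori_fun ::
  "('a, 'b) iwahori_fun \<Rightarrow> ('a, 'b) iwahori_fun \<Rightarrow> ('a, 'b) iwahori_fun"
  where "minus_iwahori_fun p r = p + - r"

lift_definition times_iwahori_fun ::
  "('a, 'b) iwahori_fun \<Rightarrow> ('a, 'b) iwahori_fun \<Rightarrow> ('a, 'b) iwahori_fun" is "(*)"
proof -
  fix p p' r r' :: "('a, 'b) mpol" assume "p - p' \<in> iw_ideal" "r - r' \<in> iw_ideal"
  then have "r * (p - p') + p' * (r - r') \<in> iw_ideal"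
    unfolding iw_ideal_def by (intro ideal_gen_add ideal_gen_mult)
  then show "p * r - p' * r' \<in> iw_ideal" by (simp add: algebra_simps)
qed

instance
proof
  fix a b c :: "('a, 'b) iwahori_fun"
  have eqI: "p - r \<in> iw_ideal" if "p = r" for p r :: "('a, 'b) mpol"
    using that by (simp add: iw_ideal_def ideal_gen_0)
  show "a + b + c = a + (b + c)" by transfer (rule eqI, simp add: algebra_simps)
  show "a + b = b + a" by transfer (rule eqI, simp add: algebra_simps)
  show "0 + a = a" by transfer (rule eqI, simp)
  show "- a + a = 0" by transfer (rule eqI, simp)
  show "a - b = a + - b" by (rule minus_iwahori_fun_def)
  show "a * b * c = a * (b * c)" by transfer (rule eqI, simp add: algebra_simps)
  show "a * b = b * a" by transfer (rule eqI, simp add: algebra_simps)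
  show "(a + b) * c = a * c + b * c" by transfer (rule eqI, simp add: algebra_simps)
qed

end

definition iw_scale :: "'k \<Rightarrow> ('n::{finite,linorder}, 'k::field) iwahori_fun \<Rightarrow> ('n, 'k) iwahori_fun"
  where "iw_scale c f = iw_class (Poly_Mapping.single 0 c) * f"

interpretation iw: vector_space
  "iw_scale :: 'k::field \<Rightarrow> ('n::{finite,linorder}, 'k) iwahori_fun \<Rightarrow> ('n, 'k) iwahori_fun"
proof
  fix c d :: 'k and f g :: "('n, 'k) iwahori_fun"
  have hom_add: "iw_class (p + r) = iw_class p + iw_class r"
    and hom_mult: "iw_class (p * r) = iw_class p * iw_class r"
    for p r :: "('n, 'k) mpol"
    by (simp_all add: plus_iwahori_fun.abs_eq times_iwahori_fun.abs_eq)
  have one: "iw_class 1 * h = h" for h :: "('n, 'k) iwahori_fun"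
    by (induction h) (simp flip: hom_mult)
  show "iw_scale c (f + g) = iw_scale c f + iw_scale c g"
    by (simp add: iw_scale_def distrib_left)
  show "iw_scale (c + d) f = iw_scale c f + iw_scale d f"
    by (simp add: iw_scale_def single_add hom_add distrib_right)
  have "Poly_Mapping.single 0 c * Poly_Mapping.single 0 d =
      (Poly_Mapping.single 0 (c * d) :: ('n, 'k) mpol)"
    by (simp add: mult_single)
  then show "iw_scale c (iw_scale d f) = iw_scale (c * d) f"
    by (simp add: iw_scale_def flip: mult.assoc hom_mult)
  show "iw_scale 1 f = f"
    by (simp add: iw_scale_def one)
qed

subsection \<open>Grading and character\<close>

definition mono_degree :: "('n::{finite,linorder} uvar \<Rightarrow>\<^sub>0 nat) \<Rightarrow> 'n wlat \<times> 'n wlat \<times> nat"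
  where "mono_degree m =
    (wbar (\<Sum>v\<in>Poly_Mapping.keys m. case Rep_uvar v of (i, j, k) \<Rightarrow> int (Poly_Mapping.lookup m v) *s axis i 1),
     wbar (\<Sum>v\<in>Poly_Mapping.keys m. case Rep_uvar v of (i, j, k) \<Rightarrow> int (Poly_Mapping.lookup m v) *s axis j 1),
     \<Sum>v\<in>Poly_Mapping.keys m. case Rep_uvar v of (i, j, k) \<Rightarrow> Poly_Mapping.lookup m v * k)"

definition mpol_component ::
    "'n::{finite,linorder} wlat \<times> 'n wlat \<times> nat \<Rightarrow> ('n, 'k::field) mpol set"
  where "mpol_component d = {p. \<forall>m\<in>Poly_Mapping.keys p. mono_degree m = d}"

definition iw_component ::
    "'n::{finite,linorder} wlat \<times> 'n wlat \<times> nat \<Rightarrow> ('n, 'k::field) iwahori_fun set"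
  where "iw_component d = iw_class ` mpol_component d"

text \<open>
  \<^term>\<open>iw.dim\<close> is 0 on infinite-dimensional spaces, so finite-dimensionality of the
  graded components has to be stated separately.
\<close>

definition iw_components_fin_dim :: "'n::{finite,linorder} itself \<Rightarrow> 'k::field itself \<Rightarrow> bool"
  where "iw_components_fin_dim _ _ \<longleftrightarrow>
    (\<forall>d. \<exists>B. finite B \<and> (iw_component d :: ('n, 'k) iwahori_fun set) \<subseteq> iw.span B)"

definition iw_character :: "'k::field itself \<Rightarrow> 'n::{finite,linorder} wlat \<times> 'n wlat \<times> nat \<Rightarrow> int"
  where "iw_character _ d = int (iw.dim (iw_component d :: ('n, 'k) iwahori_fun set))"

section \<open>Formal sums\<close>

text \<open>
  A formal sum of monomials with exponents in a commutative monoid \<open>'g\<close> (written additively)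
  is its coefficient function \<open>'g \<Rightarrow> int\<close>. The exponent of \<open>x\<^sup>\<lambda> y\<^sup>\<mu> q\<^sup>k\<close>, resp. of
  \<open>X\<^sup>\<lambda> Y\<^sup>\<mu> q\<^sup>k\<close>, is \<open>(\<lambda>, \<mu>, k)\<close> in \<^typ>\<open>'n zvec \<times> 'n zvec \<times> nat\<close>, resp.
  in \<^typ>\<open>'n wlat \<times> 'n wlat \<times> nat\<close>.

  Formal sums do not form a ring: products are defined by expanding and collecting terms, which
  makes sense if every exponent arises from finitely many choices of (nonzero) terms of the
  factors. This is the case for all products in the theorem. If it fails for some exponent,
  the definitions below give the coefficient 0 there.
\<close>

definition fs_mult :: "('g::comm_monoid_add \<Rightarrow> int) \<Rightarrow> ('g \<Rightarrow> int) \<Rightarrow> 'g \<Rightarrow> int"  (infixl \<open>\<odot>\<close> 70)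
  where "(F \<odot> G) d = (\<Sum>(a, b) | a + b = d \<and> F a \<noteq> 0 \<and> G b \<noteq> 0. F a * G b)"

text \<open>
  The product of a possibly infinite family, almost all of whose members have constant term 1:
  a term of the expansion is a choice \<open>c\<close> of one term of each factor, the term being the constant
  one for almost all factors.
\<close>

definition fs_prod :: "'j set \<Rightarrow> ('j \<Rightarrow> 'g::comm_monoid_add \<Rightarrow> int) \<Rightarrow> 'g \<Rightarrow> int"
  where "fs_prod J F d =
    (\<Sum>c | Poly_Mapping.keys (c :: 'j \<Rightarrow>\<^sub>0 'g) \<subseteq> J
           \<and> (\<Sum>j\<in>Poly_Mapping.keys c. Poly_Mapping.lookup c j) = d
           \<and> (\<forall>j\<in>J. F j (Poly_Mapping.lookup c j) \<noteq> 0).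
       \<Prod>j | j \<in> J \<and> F j (Poly_Mapping.lookup c j) \<noteq> 1. F j (Poly_Mapping.lookup c j))"

text \<open>\<open>1 - m\<close> and its inverse \<open>\<Sum>r. m\<^sup>r\<close> for a monomial with exponent \<open>m \<noteq> 0\<close>\<close>

definition fs_one_minus :: "'g::comm_monoid_add \<Rightarrow> 'g \<Rightarrow> int"
  where "fs_one_minus m d = of_bool (d = 0) - of_bool (d = m)"

definition fs_geometric :: "'g::comm_monoid_add \<Rightarrow> 'g \<Rightarrow> int"
  where "fs_geometric m d = int (card {r::nat. (\<Sum>_<r. m) = d})"

text \<open>\<open>(a;q)\<^sub>\<infinity>\<close> and \<open>1/(a;q)\<^sub>\<infinity>\<close> for a monomial with exponent \<open>a\<close>; the exponent of \<open>q\<^sup>k\<close> is \<open>(0, 0, k)\<close>\<close>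

definition qpoch :: "'a::comm_monoid_add \<times> 'b::comm_monoid_add \<times> nat \<Rightarrow> 'a \<times> 'b \<times> nat \<Rightarrow> int"
  where "qpoch a = fs_prod (UNIV :: nat set) (\<lambda>k. fs_one_minus (a + (0, 0, k)))"

definition inv_qpoch :: "'a::comm_monoid_add \<times> 'b::comm_monoid_add \<times> nat \<Rightarrow> 'a \<times> 'b \<times> nat \<Rightarrow> int"
  where "inv_qpoch a = fs_prod (UNIV :: nat set) (\<lambda>k. fs_geometric (a + (0, 0, k)))"

definition gl_xyq :: "'n::finite \<Rightarrow> 'n \<Rightarrow> nat \<Rightarrow> 'n zvec \<times> 'n zvec \<times> nat"
  where "gl_xyq i j k = (axis i 1, axis j 1, k)"

definition gl_fraction :: "'n::{finite,linorder} zvec \<times> 'n zvec \<times> nat \<Rightarrow> int"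
  where "gl_fraction =
    qpoch (\<Sum>i\<in>UNIV. axis i 1, \<Sum>i\<in>UNIV. axis i 1, 0)
    \<odot> fs_prod {(i, j). i \<le> j} (\<lambda>(i, j). inv_qpoch (gl_xyq i j 0))
    \<odot> fs_prod {(i, j). i > j} (\<lambda>(i, j). inv_qpoch (gl_xyq i j 1))"

definition sl_xyq :: "'n::finite \<Rightarrow> 'n \<Rightarrow> nat \<Rightarrow> 'n wlat \<times> 'n wlat \<times> nat"
  where "sl_xyq i j k = (wbar (axis i 1), wbar (axis j 1), k)"

definition sl_diag :: "'n::finite wlat \<times> 'n wlat \<times> nat \<Rightarrow> int"
  where "sl_diag = (\<lambda>(\<alpha>, \<beta>, k). of_bool (\<alpha> = \<beta> \<and> k = 0))"

definition sl_fraction :: "'n::{finite,linorder} wlat \<times> 'n wlat \<times> nat \<Rightarrow> int"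
  where "sl_fraction =
    sl_diag
    \<odot> fs_prod {1..<CARD('n)} (\<lambda>_. inv_qpoch (0, 0, 1))
    \<odot> fs_prod {(i, j). i < j} (\<lambda>(i, j). fs_geometric (sl_xyq i j 0))
    \<odot> fs_prod {(i, j). i \<noteq> j} (\<lambda>(i, j). inv_qpoch (sl_xyq i j 1))"

subsection \<open>From \<open>gl\<^sub>n\<close>- to \<open>sl\<^sub>n\<close>-weights\<close>

text \<open>
  \<open>to_sl_defined F\<close> says that \<open>F\<close> lies in \<open>\<int>[[x,y]][[q]]\<close> and in the domain of the map \<open>to_sl\<close>.
\<close>

definition to_sl_defined :: "('n::finite zvec \<times> 'n zvec \<times> nat \<Rightarrow> int) \<Rightarrow> bool"
  where "to_sl_defined F \<longleftrightarrow>
    (\<forall>l m k. F (l, m, k) \<noteq> 0 \<longrightarrow> (\<forall>i. 0 \<le> l $ i \<and> 0 \<le> m $ i)) \<and>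
    (\<forall>l m k. finite {(a, b). F (l + a *s 1, m + b *s 1, k) \<noteq> 0})"

definition to_sl ::
    "('n::finite zvec \<times> 'n zvec \<times> nat \<Rightarrow> int) \<Rightarrow> 'n wlat \<times> 'n wlat \<times> nat \<Rightarrow> int"
  where "to_sl F = (\<lambda>(\<alpha>, \<beta>, k).
    \<Sum>(l, m) | wbar l = \<alpha> \<and> wbar m = \<beta> \<and> F (l, m, k) \<noteq> 0. F (l, m, k))"

end

theory Submission
  imports Defs
begin

text \<open>
  Place \<open>u\<^sub>i\<^sub>j\<^sup>(\<^sup>k\<^sup>)\<close> on the diagonal \<open>s = nk + j - i \<ge> 0\<close> of the \<open>n\<close>-periodic upper triangular
  \<open>\<int> \<times> \<int>\<close>-matrix of an element of the Iwahori group, and give it the weight \<open>s\<^sup>2\<close>. The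
  \<open>n\<close> variables of a monomial of the \<open>N\<close>-th coefficient \<open>d\<^sub>N\<close> of the determinant lie on
  diagonals with sum \<open>nN\<close>, so by convexity the product \<open>m\<^sub>N\<close> of the \<open>N\<close>-th diagonal is the unique
  monomial of \<open>d\<^sub>N\<close> of minimal weight. The \<open>m\<^sub>N\<close> have disjoint supports. Hence the products of
  standard monomials, i.e. those divisible by no \<open>m\<^sub>N\<close>, with monomials in the \<open>d\<^sub>N\<close> are a basis
  of the polynomial ring, and the standard monomials are a basis of the quotient by \<open>d\<^sub>0 - 1\<close> and
  the \<open>d\<^sub>N\<close> with \<open>N > 0\<close>.

  It remains to count standard monomials. As \<open>m\<^sub>N\<close> has degree \<open>x\<^sub>1\<dots>x\<^sub>n y\<^sub>1\<dots>y\<^sub>n q\<^sup>N\<close>,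
  inclusion-exclusion over the \<open>m\<^sub>N\<close> that divide a monomial gives the \<open>gl\<close>-fraction. In
  the \<open>sl\<close>-grading \<open>m\<^sub>N\<close> has degree \<open>q\<^sup>N\<close>, the condition on the diagonal 0 turns
  \<open>\<Prod>\<^sub>i 1/(1 - X\<^sub>i Y\<^sub>i)\<close> into \<open>\<Sum>\<^sub>\<lambda> X\<^sup>\<lambda> Y\<^sup>\<lambda>\<close>, which absorbs every \<open>X\<^sub>i Y\<^sub>i\<close>, and
  the conditions on the other diagonals cancel one of the \<open>n\<close> factors \<open>1/(q;q)\<^sub>\<infinity>\<close>
  of the variables \<open>u\<^sub>i\<^sub>i\<^sup>(\<^sup>k\<^sup>)\<close> with \<open>k > 0\<close>.
\<close>

abbreviation lookup where "lookup \<equiv> Poly_Mapping.lookup"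
abbreviation keys where "keys \<equiv> Poly_Mapping.keys"
abbreviation single where "single \<equiv> Poly_Mapping.single"

section \<open>Weighted counts as formal sums\<close>

definition nsmul :: "nat \<Rightarrow> 'g::comm_monoid_add \<Rightarrow> 'g"
  where "nsmul r x = (\<Sum>_<r. x)"

lemma nsmul_0 [simp]: "nsmul 0 x = 0"
  and nsmul_Suc: "nsmul (Suc r) x = nsmul r x + x"
  by (simp_all add: nsmul_def)

lemma nsmul_1 [simp]: "nsmul (Suc 0) x = x"
  by (simp add: nsmul_def)

lemma nsmul_add: "nsmul (r + s) x = nsmul r x + nsmul s x"
  by (induction s) (simp_all add: nsmul_Suc add.assoc)

lemma nsmul_add_right: "nsmul r (x + y) = nsmul r x + nsmul r y"
  by (simp add: nsmul_def sum.distrib)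

lemma nsmul_nat [simp]: "nsmul r (k::nat) = r * k"
  by (simp add: nsmul_def)

lemma additive_nsmul:
  assumes "f 0 = 0" "\<And>a b. f (a + b) = f a + f b"
  shows "f (nsmul r x) = nsmul r (f x)"
  by (induction r) (simp_all add: nsmul_Suc assms)

lemma additive_sum:
  fixes f :: "'a::comm_monoid_add \<Rightarrow> 'b::comm_monoid_add"
  assumes "f 0 = 0" "\<And>a b. f (a + b) = f a + f b"
  shows "f (sum g A) = (\<Sum>x\<in>A. f (g x))"
  by (induction A rule: infinite_finite_induct) (simp_all add: assms)

text \<open>With \<open>w\<close> valued in weights this is the degree of the monomial
  \<open>e\<close>; with \<open>w\<close> valued in monomials, as for \<open>dmon\<close>, it is the
  image of \<open>e\<close> under a monomial substitution. The target is only a commutative monoid,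
  hence the iterated sums \<open>nsmul\<close>.\<close>

definition pdeg :: "('v \<Rightarrow> 'g::comm_monoid_add) \<Rightarrow> ('v \<Rightarrow>\<^sub>0 nat) \<Rightarrow> 'g"
  where "pdeg w e = (\<Sum>v\<in>keys e. nsmul (lookup e v) (w v))"

lemma pdeg_superset:
  assumes "finite A" "keys e \<subseteq> A"
  shows "pdeg w e = (\<Sum>v\<in>A. nsmul (lookup e v) (w v))"
  unfolding pdeg_def using assms
  by (intro sum.mono_neutral_left) (auto simp: in_keys_iff)

lemma pdeg_0 [simp]: "pdeg w 0 = 0"
  by (simp add: pdeg_def)

lemma pdeg_single [simp]: "pdeg w (single v r) = nsmul r (w v)"
  by (cases "r = 0") (simp_all add: pdeg_def)

lemma pdeg_add: "pdeg w (e + e') = pdeg w e + pdeg w e'"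
proof -
  let ?A = "keys e \<union> keys e'"
  have "pdeg w (e + e') = (\<Sum>v\<in>?A. nsmul (lookup (e + e') v) (w v))"
    by (rule pdeg_superset) (simp_all add: Poly_Mapping.keys_add)
  also have "\<dots> = pdeg w e + pdeg w e'"
    by (simp add: lookup_add nsmul_add sum.distrib
        pdeg_superset[of ?A e] pdeg_superset[of ?A e'])
  finally show ?thesis .
qed

lemma pdeg_sum: "pdeg w (sum f A) = (\<Sum>x\<in>A. pdeg w (f x))"
  by (rule additive_sum) (simp_all add: pdeg_add)

lemma pdeg_cong: "(\<And>v. v \<in> keys e \<Longrightarrow> w v = w' v) \<Longrightarrow> pdeg w e = pdeg w' e"
  by (simp add: pdeg_def)

lemma additive_pdeg:
  fixes f :: "'a::comm_monoid_add \<Rightarrow> 'b::comm_monoid_add"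
  assumes "f 0 = 0" "\<And>a b. f (a + b) = f a + f b"
  shows "f (pdeg w e) = pdeg (\<lambda>v. f (w v)) e"
  unfolding pdeg_def by (simp add: additive_sum[of f] additive_nsmul[of f] assms)

lemma pdeg_nat: "pdeg w e = (\<Sum>v\<in>keys e. lookup e v * w v)" for w :: "'v \<Rightarrow> nat"
  by (simp add: pdeg_def)

lemma lookup_le_pdeg:
  fixes w :: "'v \<Rightarrow> nat"
  assumes "v \<in> keys e"
  shows "lookup e v * w v \<le> pdeg w e"
  unfolding pdeg_nat using assms by (intro member_le_sum) auto

text \<open>As all weights are at least 1, the bound \<open>B\<close> limits both the weights of the
  variables that occur and their exponents. Finitely many variables are left, and the exponents form
  a function from these to \<open>{..B}\<close>.\<close>

lemma finite_pdeg_le: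
  fixes w :: "'v \<Rightarrow> nat"
  assumes pos: "\<And>v. v \<in> V \<Longrightarrow> w v \<ge> 1" and fin: "\<And>B. finite {v\<in>V. w v \<le> B}"
  shows "finite {e. keys e \<subseteq> V \<and> pdeg w e \<le> B}" (is "finite ?X")
proof -
  let ?V = "{v\<in>V. w v \<le> B}"
  have key: "v \<in> ?V \<and> lookup e v \<le> B" if "e \<in> ?X" "v \<in> keys e" for e v
  proof -
    have "v \<in> V" "lookup e v * w v \<le> B" "lookup e v \<ge> 1"
      using that lookup_le_pdeg[OF that(2), of w] by (auto simp: in_keys_iff)
    moreover have "lookup e v \<le> lookup e v * w v" using pos[OF \<open>v \<in> V\<close>] by simp
    moreover have "w v \<le> lookup e v * w v" using \<open>lookup e v \<ge> 1\<close> by simp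
    ultimately have "w v \<le> B" "lookup e v \<le> B"
      using \<open>lookup e v * w v \<le> B\<close> by linarith+
    then show ?thesis using \<open>v \<in> V\<close> by simp
  qed
  let ?f = "\<lambda>e::'v \<Rightarrow>\<^sub>0 nat. restrict (lookup e) ?V"
  have "?f ` ?X \<subseteq> PiE ?V (\<lambda>_. {..B})"
  proof (rule image_subsetI, rule PiE_I)
    fix e v assume "e \<in> ?X" "v \<in> ?V"
    then show "restrict (lookup e) ?V v \<in> {..B}"
      using key[of e v] by (cases "v \<in> keys e") (auto simp: in_keys_iff)
  qed (simp only: restrict_apply if_False)
  moreover have "inj_on ?f ?X"
  proof (rule inj_onI, rule poly_mapping_eqI)
    fix e e' v assume e: "e \<in> ?X" "e' \<in> ?X" "?f e = ?f e'"
    show "lookup e v = lookup e' v"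
    proof (cases "v \<in> ?V")
      case True
      then show ?thesis using fun_cong[OF e(3), of v] by simp
    next
      case False
      then have "v \<notin> keys e" "v \<notin> keys e'" using key[OF e(1), of v] key[OF e(2), of v] by blast+
      then show ?thesis by (simp add: in_keys_iff)
    qed
  qed
  ultimately show ?thesis
    using inj_on_finite[of ?f ?X "PiE ?V (\<lambda>_. {..B})"] fin[of B] by (simp add: finite_PiE)
qed

text \<open>
  An additive functional that is positive and proper on the degrees of the variables makes all
  the counts below finite.
\<close>

definition proper_wt :: "('g::comm_monoid_add \<Rightarrow> int) \<Rightarrow> 'v set \<Rightarrow> ('v \<Rightarrow> 'g) \<Rightarrow> bool"
  where "proper_wt h V w \<longleftrightarrow> (\<forall>a b. h (a + b) = h a + h b) \<and> (\<forall>v\<in>V. h (w v) \<ge> 1)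
    \<and> (\<forall>B. finite {v\<in>V. h (w v) \<le> B})"

lemma proper_wt_subset: "proper_wt h V w \<Longrightarrow> W \<subseteq> V \<Longrightarrow> proper_wt h W w"
proof -
  assume *: "proper_wt h V w" "W \<subseteq> V"
  have "finite {v\<in>W. h (w v) \<le> B}" for B
  proof (rule finite_subset)
    show "{v\<in>W. h (w v) \<le> B} \<subseteq> {v\<in>V. h (w v) \<le> B}" using *(2) by blast
    show "finite {v\<in>V. h (w v) \<le> B}" using *(1) by (simp add: proper_wt_def)
  qed
  then show ?thesis using * by (auto simp: proper_wt_def)
qed

lemma proper_wt_0: "proper_wt h V w \<Longrightarrow> h 0 = 0"
proof -
  assume "proper_wt h V w"
  then have "h (0 + 0) = h 0 + h 0" unfolding proper_wt_def by blast
  then show ?thesis by simp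
qed

text \<open>Turns the integer functional into a weight with values in the natural numbers, to which
  \<open>finite_pdeg_le\<close> applies.\<close>

lemma proper_wt_pdeg:
  assumes "proper_wt h V w" "keys e \<subseteq> V"
  shows "h (pdeg w e) = int (pdeg (\<lambda>v. nat (h (w v))) e)"
proof -
  have "h (pdeg w e) = pdeg (\<lambda>v. h (w v)) e"
    using assms proper_wt_0[OF assms(1)] by (intro additive_pdeg[of h]) (auto simp: proper_wt_def)
  also have "\<dots> = pdeg (\<lambda>v. int (nat (h (w v)))) e"
    using assms by (intro pdeg_cong) (force simp: proper_wt_def)
  also have "\<dots> = int (pdeg (\<lambda>v. nat (h (w v))) e)"
    by (rule additive_pdeg[of int, symmetric]) auto
  finally show ?thesis .
qed

lemma proper_wt_pdeg_nonneg:
  "proper_wt h V w \<Longrightarrow> keys e \<subseteq> V \<Longrightarrow> h (pdeg w e) \<ge> 0"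
  by (simp add: proper_wt_pdeg)

lemma finite_proper_wt_le:
  assumes "proper_wt h V w"
  shows "finite {e. keys e \<subseteq> V \<and> h (pdeg w e) \<le> B}"
proof -
  have "finite {e. keys e \<subseteq> V \<and> pdeg (\<lambda>v. nat (h (w v))) e \<le> nat B}"
  proof (rule finite_pdeg_le)
    fix B
    have "{v \<in> V. nat (h (w v)) \<le> B} \<subseteq> {v \<in> V. h (w v) \<le> int B}" by auto
    moreover have "finite {v \<in> V. h (w v) \<le> int B}" using assms by (simp add: proper_wt_def)
    ultimately show "finite {v \<in> V. nat (h (w v)) \<le> B}" by (rule finite_subset)
  qed (use assms in \<open>force simp: proper_wt_def\<close>)
  then show ?thesis
    by (rule finite_subset[rotated]) (auto simp: proper_wt_pdeg[OF assms])
qed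

lemma finite_pdeg_eq:
  assumes "proper_wt h V w"
  shows "finite {e. keys e \<subseteq> V \<and> pdeg w e = d}"
  by (rule finite_subset[OF _ finite_proper_wt_le[OF assms, of "h d"]]) auto

lemma proper_wt_nsmul:
  assumes "proper_wt h V w"
  shows "h (nsmul r x) = int r * h x"
  using additive_nsmul[of h r x] proper_wt_0[OF assms] assms by (simp add: proper_wt_def nsmul_def)

text \<open>Applying \<open>h\<close>, which is positive on \<open>w v\<close>, excludes torsion;
  hence the geometric series in \<open>w v\<close> has only the coefficients 0 and 1.\<close>

lemma inj_nsmul:
  assumes "proper_wt h V w" "v \<in> V"
  shows "inj (\<lambda>r. nsmul r (w v))"
proof (rule injI)
  fix r s assume "nsmul r (w v) = nsmul s (w v)"
  then have "int r * h (w v) = int s * h (w v)"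
    by (metis assms(1) proper_wt_nsmul)
  moreover have "h (w v) \<ge> 1" using assms by (simp add: proper_wt_def)
  ultimately show "r = s" by simp
qed

section \<open>Signed counts and products of formal sums\<close>

definition wcount :: "'x set \<Rightarrow> ('x \<Rightarrow> 'g) \<Rightarrow> ('x \<Rightarrow> int) \<Rightarrow> 'g \<Rightarrow> int"
  where "wcount A dg sg d = (\<Sum>x | x \<in> A \<and> dg x = d. sg x)"

text \<open>Formal sums are brought into the form \<open>wcount\<close> so that identities can be
  proved by bijections preserving degrees and signs.\<close>

lemma wcount_reindex:
  assumes "bij_betw f A B" "\<And>x. x \<in> A \<Longrightarrow> dg' (f x) = dg x" "\<And>x. x \<in> A \<Longrightarrow> sg' (f x) = sg x"
  shows "wcount A dg sg = wcount B dg' sg'"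
proof
  fix d
  have "bij_betw f {x\<in>A. dg x = d} {y\<in>B. dg' y = d}"
    using assms(1,2) by (auto simp: bij_betw_def inj_on_def)
  from sum.reindex_bij_betw[OF this, of sg']
  have "(\<Sum>y | y \<in> B \<and> dg' y = d. sg' y) = (\<Sum>x | x \<in> A \<and> dg x = d. sg' (f x))" by simp
  also have "\<dots> = (\<Sum>x | x \<in> A \<and> dg x = d. sg x)" by (rule sum.cong) (auto simp: assms(3))
  finally show "wcount A dg sg d = wcount B dg' sg' d" by (simp add: wcount_def)
qed

text \<open>Over a pair of degrees \<open>(a, b)\<close> the fibre of the product is the product of
  the two fibres. Grouping the finite set \<open>?X\<close> by such pairs therefore gives the
  convolution.\<close>

lemma fs_mult_wcount:
  assumes fin: "\<And>d. finite {p \<in> A \<times> B. dg (fst p) + dg' (snd p) = d}"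
  shows "wcount A dg sg \<odot> wcount B dg' sg' =
    wcount (A \<times> B) (\<lambda>p. dg (fst p) + dg' (snd p)) (\<lambda>p. sg (fst p) * sg' (snd p))"
proof
  fix d
  let ?X = "{p \<in> A \<times> B. dg (fst p) + dg' (snd p) = d}"
  let ?f = "\<lambda>p. (dg (fst p), dg' (snd p))"
  let ?F = "wcount A dg sg" and ?G = "wcount B dg' sg'"
  let ?P = "{(a, b). a + b = d \<and> ?F a \<noteq> 0 \<and> ?G b \<noteq> 0}"
  have fibre: "(\<Sum>p | p \<in> ?X \<and> ?f p = (a, b). sg (fst p) * sg' (snd p)) = ?F a * ?G b"
    if "a + b = d" for a b
  proof -
    have "{p. p \<in> ?X \<and> ?f p = (a, b)} = {x\<in>A. dg x = a} \<times> {y\<in>B. dg' y = b}"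
      using that by auto
    then show ?thesis
      by (simp add: wcount_def sum_product sum.cartesian_product split_def)
  qed
  \<comment> \<open>A nonzero coefficient has a nonempty fibre, so the index set of
    \<open>fs_mult\<close> lies in the finite image; the remaining pairs of the image contribute
    0.\<close>
  have sub: "?P \<subseteq> ?f ` ?X"
  proof
    fix p assume "p \<in> ?P"
    then obtain a b where p: "p = (a, b)" "a + b = d" "?F a \<noteq> 0" "?G b \<noteq> 0" by auto
    have "{x\<in>A. dg x = a} \<noteq> {}"
    proof
      assume "{x\<in>A. dg x = a} = {}"
      then have "?F a = 0" unfolding wcount_def by (metis sum.empty)
      with p show False by simp
    qed
    moreover have "{y\<in>B. dg' y = b} \<noteq> {}"
    proof
      assume "{y\<in>B. dg' y = b} = {}"
      then have "?G b = 0" unfolding wcount_def by (metis sum.empty)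
      with p show False by simp
    qed
    ultimately show "p \<in> ?f ` ?X" using p(1,2) by force
  qed
  have "(\<Sum>p\<in>?X. sg (fst p) * sg' (snd p)) =
    (\<Sum>ab\<in>?f ` ?X. \<Sum>p | p \<in> ?X \<and> ?f p = ab. sg (fst p) * sg' (snd p))"
    using sum.group[OF fin[of d] finite_imageI[OF fin[of d], of ?f], of ?f "\<lambda>p. sg (fst p) * sg' (snd p)"]
    by simp
  also have "\<dots> = (\<Sum>(a, b)\<in>?f ` ?X. ?F a * ?G b)"
    by (rule sum.cong[OF refl]) (use fibre in \<open>auto simp: split_def\<close>)
  also have "\<dots> = (\<Sum>(a, b)\<in>?P. ?F a * ?G b)"
    by (rule sum.mono_neutral_right[OF finite_imageI[OF fin] sub]) auto
  finally show "(?F \<odot> ?G) d =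
      wcount (A \<times> B) (\<lambda>p. dg (fst p) + dg' (snd p)) (\<lambda>p. sg (fst p) * sg' (snd p)) d"
    by (simp add: fs_mult_def wcount_def)
qed

text \<open>The coefficients of \<open>\<Prod>\<^sub>v 1/(1 - t\<^sup>w\<^sup>(\<^sup>v\<^sup>))\<close>, the product being over \<open>V\<close>\<close>

definition pcount :: "'v set \<Rightarrow> ('v \<Rightarrow> 'g::comm_monoid_add) \<Rightarrow> 'g \<Rightarrow> int"
  where "pcount V w = wcount {e. keys e \<subseteq> V} (pdeg w) (\<lambda>_. 1)"

lemma pcount_card: "pcount V w d = int (card {e. keys e \<subseteq> V \<and> pdeg w e = d})"
  by (simp add: pcount_def wcount_def)

lift_definition prestrict :: "'v set \<Rightarrow> ('v \<Rightarrow>\<^sub>0 'b::zero) \<Rightarrow> ('v \<Rightarrow>\<^sub>0 'b)"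
  is "\<lambda>V f v. if v \<in> V then f v else 0"
  by (erule finite_subset[rotated]) auto

lemma lookup_prestrict: "lookup (prestrict V e) v = (if v \<in> V then lookup e v else 0)"
  by transfer simp

lemma keys_prestrict: "keys (prestrict V e) = keys e \<inter> V"
  by (auto simp: in_keys_iff lookup_prestrict split: if_splits)

lemma prestrict_partition:
  fixes e :: "'v \<Rightarrow>\<^sub>0 'b::comm_monoid_add"
  assumes "finite J" "keys e \<subseteq> (\<Union>j\<in>J. V j)" "disjoint_family_on V J"
  shows "(\<Sum>j\<in>J. prestrict (V j) e) = e"
proof (rule poly_mapping_eqI)
  fix v
  show "lookup (\<Sum>j\<in>J. prestrict (V j) e) v = lookup e v"
  proof (cases "v \<in> keys e")
    case True
    then obtain j where j: "j \<in> J" "v \<in> V j" using assms(2) by auto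
    have "(\<Sum>i\<in>J. lookup (prestrict (V i) e) v) = (\<Sum>i\<in>J. if i = j then lookup e v else 0)"
      using j assms(3) by (intro sum.cong) (auto simp: lookup_prestrict disjoint_family_on_def)
    then show ?thesis using j assms(1) by (simp add: lookup_sum)
  next
    case False
    then have "lookup e v = 0" by (simp add: in_keys_iff)
    then have "lookup (prestrict (V j) e) v = 0" for j by (simp add: lookup_prestrict)
    then show ?thesis by (simp add: lookup_sum \<open>lookup e v = 0\<close>)
  qed
qed

text \<open>Renaming variables along \<open>f\<close> is a bijection of monomials, with the renaming
  along \<open>inv_into V f\<close> as inverse.\<close>

lemma pcount_reindex:
  fixes f :: "'a \<Rightarrow> 'b"
  assumes f: "bij_betw f V W" and w: "\<And>v. v \<in> V \<Longrightarrow> w' (f v) = w v"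
  shows "pcount V w = pcount W w'"
proof -
  let ?g = "\<lambda>e :: 'a \<Rightarrow>\<^sub>0 nat. \<Sum>v\<in>keys e. single (f v) (lookup e v)"
  let ?h = "\<lambda>e :: 'b \<Rightarrow>\<^sub>0 nat. \<Sum>v\<in>keys e. single (inv_into V f v) (lookup e v)"
  have inj: "inj_on f V" using f by (simp add: bij_betw_def)
  have fW: "f v \<in> W" "inv_into V f (f v) = v" if "v \<in> V" for v
    using that f by (auto simp: bij_betw_def)
  have fV: "inv_into V f x \<in> V" "f (inv_into V f x) = x" if "x \<in> W" for x
    using that f by (auto simp: bij_betw_def inv_into_into f_inv_into_f)
  have look: "lookup (\<Sum>v\<in>keys e. single (g v) (lookup e v)) (g v) = lookup e v"
    if "inj_on g U" "keys e \<subseteq> U" "v \<in> U" for g :: "'x \<Rightarrow> 'y" and U v and e :: "'x \<Rightarrow>\<^sub>0 nat"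
  proof -
    have "(\<Sum>u\<in>keys e. lookup (single (g u) (lookup e u)) (g v)) =
        (\<Sum>u\<in>keys e. if u = v then lookup e v else 0)"
      using that by (intro sum.cong) (auto simp: lookup_single when_def dest: inj_onD)
    then show ?thesis by (simp add: lookup_sum in_keys_iff)
  qed
  have kk: "keys (\<Sum>v\<in>keys e. single (g v) (lookup e v)) \<subseteq> g ` keys e"
    for g :: "'x \<Rightarrow> 'y" and e :: "'x \<Rightarrow>\<^sub>0 nat"
    using keys_sum[of "\<lambda>v. single (g v) (lookup e v)" "keys e"] by (auto split: if_splits)
  have inj': "inj_on (inv_into V f) W" using f by (simp add: bij_betw_def inj_on_inv_into)
  have "bij_betw ?g {e. keys e \<subseteq> V} {e. keys e \<subseteq> W}"
  proof (rule bij_betw_byWitness[where f' = ?h])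
    show "\<forall>e\<in>{e. keys e \<subseteq> V}. ?h (?g e) = e"
    proof (intro ballI poly_mapping_eqI)
      fix e :: "'a \<Rightarrow>\<^sub>0 nat" and v assume e: "e \<in> {e. keys e \<subseteq> V}"
      then have kg: "keys (?g e) \<subseteq> W" using kk[of f e] fW(1) by auto
      show "lookup (?h (?g e)) v = lookup e v"
      proof (cases "v \<in> V")
        case True
        then show ?thesis
          using look[OF inj' kg fW(1)[OF True]] look[OF inj _ True, of e] e fW(2)[OF True] by simp
      next
        case False
        then have "v \<notin> keys (?h (?g e))" using kk[of "inv_into V f" "?g e"] kg fV(1) by blast
        moreover have "v \<notin> keys e" using e False by auto
        ultimately show ?thesis by (simp add: in_keys_iff)
      qed
    qed
    show "\<forall>e\<in>{e. keys e \<subseteq> W}. ?g (?h e) = e"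
    proof (intro ballI poly_mapping_eqI)
      fix e :: "'b \<Rightarrow>\<^sub>0 nat" and x assume e: "e \<in> {e. keys e \<subseteq> W}"
      then have kg: "keys (?h e) \<subseteq> V" using kk[of "inv_into V f" e] fV(1) by auto
      show "lookup (?g (?h e)) x = lookup e x"
      proof (cases "x \<in> W")
        case True
        then show ?thesis
          using look[OF inj kg fV(1)[OF True]] look[OF inj' _ True, of e] e fV(2)[OF True] by simp
      next
        case False
        then have "x \<notin> keys (?g (?h e))" using kk[of f "?h e"] kg fW(1) by blast
        moreover have "x \<notin> keys e" using e False by auto
        ultimately show ?thesis by (simp add: in_keys_iff)
      qed
    qed
    show "?g ` {e. keys e \<subseteq> V} \<subseteq> {e. keys e \<subseteq> W}" using kk[of f] fW(1) by fast
    show "?h ` {e. keys e \<subseteq> W} \<subseteq> {e. keys e \<subseteq> V}" using kk[of "inv_into V f"] fV(1) by fast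
  qed
  then show ?thesis
    unfolding pcount_def
  proof (rule wcount_reindex)
    fix e :: "'a \<Rightarrow>\<^sub>0 nat" assume "e \<in> {e. keys e \<subseteq> V}"
    then show "pdeg w' (?g e) = pdeg w e"
      unfolding pdeg_sum pdeg_def[of w] by (intro sum.cong) (auto simp: w)
  qed simp
qed

lemma fs_mult_pcount:
  assumes "\<And>d. finite {p \<in> A \<times> {e. keys e \<subseteq> V}. dg (fst p) + pdeg w (snd p) = d}"
  shows "wcount A dg sg \<odot> pcount V w =
    wcount (A \<times> {e. keys e \<subseteq> V}) (\<lambda>p. dg (fst p) + pdeg w (snd p)) (\<lambda>p. sg (fst p))"
  unfolding pcount_def by (subst fs_mult_wcount) (use assms in auto)

lemma bij_betw_pair_add:
  assumes "V \<inter> W = {}"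
  shows "bij_betw (\<lambda>p. fst p + snd p) ({e :: 'v \<Rightarrow>\<^sub>0 nat. keys e \<subseteq> V} \<times> {e. keys e \<subseteq> W}) {e. keys e \<subseteq> V \<union> W}"
proof (rule bij_betw_byWitness[where f' = "\<lambda>e. (prestrict V e, prestrict W e)"])
  show "\<forall>p\<in>{e :: 'v \<Rightarrow>\<^sub>0 nat. keys e \<subseteq> V} \<times> {e. keys e \<subseteq> W}.
      (prestrict V (fst p + snd p), prestrict W (fst p + snd p)) = p"
  proof
    fix p :: "('v \<Rightarrow>\<^sub>0 nat) \<times> ('v \<Rightarrow>\<^sub>0 nat)"
    assume p: "p \<in> {e. keys e \<subseteq> V} \<times> {e. keys e \<subseteq> W}"
    have "lookup (fst p) v = 0" if "v \<notin> V" for v using that p by (auto simp: in_keys_iff)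
    moreover have "lookup (snd p) v = 0" if "v \<notin> W" for v using that p by (auto simp: in_keys_iff)
    ultimately show "(prestrict V (fst p + snd p), prestrict W (fst p + snd p)) = p"
      using assms by (intro prod_eqI poly_mapping_eqI) (auto simp: lookup_prestrict lookup_add)
  qed
  show "\<forall>e\<in>{e :: 'v \<Rightarrow>\<^sub>0 nat. keys e \<subseteq> V \<union> W}. fst (prestrict V e, prestrict W e) + snd (prestrict V e, prestrict W e) = e"
  proof (intro ballI poly_mapping_eqI)
    fix e :: "'v \<Rightarrow>\<^sub>0 nat" and v assume "e \<in> {e. keys e \<subseteq> V \<union> W}"
    then have "v \<notin> V \<Longrightarrow> v \<notin> W \<Longrightarrow> lookup e v = 0" by (auto simp: in_keys_iff)
    then show "lookup (fst (prestrict V e, prestrict W e) + snd (prestrict V e, prestrict W e)) v = lookup e v"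
      using assms by (auto simp: lookup_prestrict lookup_add)
  qed
  show "(\<lambda>p. fst p + snd p) ` ({e :: 'v \<Rightarrow>\<^sub>0 nat. keys e \<subseteq> V} \<times> {e. keys e \<subseteq> W}) \<subseteq> {e. keys e \<subseteq> V \<union> W}"
    using keys_add by fastforce
qed (auto simp: keys_prestrict)

section \<open>Infinite products as counts\<close>

lemma fs_prod_geometric:
  assumes wt: "proper_wt h J w"
  shows "fs_prod J (\<lambda>j. fs_geometric (w j)) = pcount J w"
proof
  fix d
  let ?F = "\<lambda>j. fs_geometric (w j)"
  have geo: "?F j a = of_bool (\<exists>r. a = nsmul r (w j))" if "j \<in> J" for j a
  proof (cases "\<exists>r. a = nsmul r (w j)")
    case True
    then obtain r where r: "a = nsmul r (w j)" by blast
    have "{r'. nsmul r' (w j) = a} = {r}"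
      using inj_nsmul[OF wt that] by (auto simp: r inj_def)
    then show ?thesis using True by (simp add: fs_geometric_def nsmul_def)
  next
    case False
    then have "{r'. nsmul r' (w j) = a} = {}" by auto
    then show ?thesis using False by (simp add: fs_geometric_def nsmul_def)
  qed
  let ?C = "{c. keys c \<subseteq> J \<and> (\<Sum>j\<in>keys c. lookup c j) = d \<and> (\<forall>j\<in>J. ?F j (lookup c j) \<noteq> 0)}"
  let ?E = "{e. keys e \<subseteq> J \<and> pdeg w e = d}"
  \<comment> \<open>A term of the expanded product picks a multiple of \<open>w j\<close> for each
    \<open>j\<close>. Recording these multiples as exponents identifies the choices \<open>c\<close>
    with monomials \<open>e\<close>, and by \<open>geo\<close> each choice has coefficient
    1.\<close>
  let ?g = "\<lambda>e. Poly_Mapping.mapp (\<lambda>j r. nsmul r (w j)) e"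
  have nz: "nsmul r (w j) = 0 \<longleftrightarrow> r = 0" if "j \<in> J" for r j
    using inj_nsmul[OF wt that] by (metis injD nsmul_0)
  have look: "lookup (?g e) j = nsmul (lookup e j) (w j)" for e j
    by (cases "lookup e j = 0") (simp_all add: lookup_mapp in_keys_iff)
  have keys_g: "keys (?g e) = keys e" if "keys e \<subseteq> J" for e
  proof (rule set_eqI)
    fix j
    show "j \<in> keys (?g e) \<longleftrightarrow> j \<in> keys e"
    proof (cases "j \<in> J")
      case True
      then show ?thesis by (simp add: in_keys_iff look nz del: lookup_not_eq_zero_eq_in_keys)
    next
      case False
      then have "lookup e j = 0" using that by (auto simp: in_keys_iff)
      then show ?thesis by (simp add: in_keys_iff look)
    qed
  qed
  have "bij_betw ?g ?E ?C"
    unfolding bij_betw_def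
  proof (intro conjI inj_onI poly_mapping_eqI)
    fix e e' j assume e: "e \<in> ?E" "e' \<in> ?E" "?g e = ?g e'"
    show "lookup e j = lookup e' j"
    proof (cases "j \<in> J")
      case True
      have "nsmul (lookup e j) (w j) = nsmul (lookup e' j) (w j)" by (metis e(3) look)
      then show ?thesis using inj_nsmul[OF wt True] by (simp add: inj_def)
    next
      case False
      then show ?thesis using e by (metis (mono_tags, lifting) in_keys_iff mem_Collect_eq subsetD)
    qed
  next
    show "?g ` ?E = ?C"
    proof (intro equalityI subsetI)
      fix c assume "c \<in> ?g ` ?E"
      then obtain e where e: "e \<in> ?E" "c = ?g e" by blast
      have ce: "keys c = keys e" using e keys_g by simp
      have "(\<Sum>j\<in>keys c. lookup c j) = pdeg w e"
        unfolding ce pdeg_def by (simp add: e(2) look)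
      then show "c \<in> ?C" using e ce by (auto simp: geo look)
    next
      fix c assume c: "c \<in> ?C"
      then have "\<forall>j\<in>J. \<exists>r. lookup c j = nsmul r (w j)" by (auto simp: geo)
      then obtain r where r: "\<And>j. j \<in> J \<Longrightarrow> lookup c j = nsmul (r j) (w j)" by metis
      define e where "e = Poly_Mapping.mapp (\<lambda>j _. r j) c"
      have look_e: "lookup e j = (if j \<in> keys c then r j else 0)" for j
        by (simp add: e_def lookup_mapp when_def)
      have ke: "keys e \<subseteq> J" using c by (auto simp: in_keys_iff look_e split: if_splits)
      have ge: "?g e = c"
      proof (rule poly_mapping_eqI)
        fix j show "lookup (?g e) j = lookup c j"
          using c r[of j] by (auto simp: look look_e in_keys_iff)
      qed
      have "pdeg w e = (\<Sum>j\<in>keys c. lookup c j)"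
        unfolding pdeg_def keys_g[OF ke, symmetric] ge by (rule sum.cong) (simp_all add: look flip: ge)
      then show "c \<in> ?g ` ?E" using ke c ge by (intro image_eqI[of _ _ e]) auto
    qed
  qed
  then have card: "card ?E = card ?C" by (rule bij_betw_same_card)
  have "(\<Prod>j | j \<in> J \<and> ?F j (lookup c j) \<noteq> 1. ?F j (lookup c j)) = 1" if "c \<in> ?C" for c
    using that by (intro prod.neutral) (auto simp: geo)
  then show "fs_prod J ?F d = pcount J w d"
    unfolding fs_prod_def pcount_card card by simp
qed

text \<open>The monomials in the union of the blocks \<open>V j\<close> are sorted by the degrees of
  their block parts; those with given block degrees are counted by the product of the block
  counts.\<close>

lemma fs_prod_pcount:
  assumes J: "finite J" "disjoint_family_on V J" and wt: "proper_wt h (\<Union>j\<in>J. V j) w"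
    and F: "\<And>j. j \<in> J \<Longrightarrow> F j = pcount (V j) w"
  shows "fs_prod J F = pcount (\<Union>j\<in>J. V j) w"
proof
  fix d
  let ?X = "{e. keys e \<subseteq> (\<Union>j\<in>J. V j) \<and> pdeg w e = d}"
  let ?C = "{c. keys c \<subseteq> J \<and> (\<Sum>j\<in>keys c. lookup c j) = d \<and> (\<forall>j\<in>J. F j (lookup c j) \<noteq> 0)}"
  let ?fib = "\<lambda>j a. {e. keys e \<subseteq> V j \<and> pdeg w e = a}"
  \<comment> \<open>\<open>f e\<close> is the choice of terms to which \<open>e\<close> contributes:
    the degree of the part of \<open>e\<close> in each block.\<close>
  define f where "f e = (\<Sum>j\<in>J. single j (pdeg w (prestrict (V j) e)))" for e
  have look_f: "lookup (f e) j = (if j \<in> J then pdeg w (prestrict (V j) e) else 0)" for e j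
    by (simp add: f_def lookup_sum lookup_single when_def J)
  have finX: "finite ?X" by (rule finite_pdeg_eq[OF wt])
  have total: "(\<Sum>j\<in>keys c. lookup c j) = (\<Sum>j\<in>J. lookup c j)" if "keys c \<subseteq> J" for c :: "'a \<Rightarrow>\<^sub>0 'c"
    using J that by (intro sum.mono_neutral_left) (auto simp: in_keys_iff)
  have keys_f: "keys (f e) \<subseteq> J" for e
    by (auto simp: in_keys_iff look_f split: if_splits)
  have f_deg: "(\<Sum>j\<in>keys (f e). lookup (f e) j) = pdeg w e" if "keys e \<subseteq> (\<Union>j\<in>J. V j)" for e
    using arg_cong[OF prestrict_partition[OF J(1) that J(2)], of "pdeg w"]
    by (subst total[OF keys_f]) (simp add: look_f pdeg_sum)
  have fibre: "int (card {e\<in>?X. f e = c}) = (\<Prod>j\<in>J. F j (lookup c j))"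
    if c: "keys c \<subseteq> J" "(\<Sum>j\<in>keys c. lookup c j) = d" for c
  proof -
    let ?P = "PiE J (\<lambda>j. ?fib j (lookup c j))"
    have "bij_betw (\<lambda>x. \<Sum>j\<in>J. x j) ?P {e\<in>?X. f e = c}"
    proof (rule bij_betw_byWitness[where f' = "\<lambda>e. restrict (\<lambda>j. prestrict (V j) e) J"])
      have pr: "prestrict (V i) (\<Sum>j\<in>J. x j) = x i" if "x \<in> ?P" "i \<in> J" for x i
      proof (rule poly_mapping_eqI)
        fix v
        have 0: "lookup (x j) v = 0" if "j \<in> J" "v \<notin> V j" for j
          using that \<open>x \<in> ?P\<close> unfolding PiE_iff by (metis (mono_tags, lifting) in_keys_iff mem_Collect_eq subsetD)
        show "lookup (prestrict (V i) (\<Sum>j\<in>J. x j)) v = lookup (x i) v"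
        proof (cases "v \<in> V i")
          case True
          have "v \<notin> V j" if "j \<in> J" "j \<noteq> i" for j
            using True that \<open>i \<in> J\<close> J(2) by (auto simp: disjoint_family_on_def)
          then have "(\<Sum>j\<in>J. lookup (x j) v) = (\<Sum>j\<in>J. if j = i then lookup (x i) v else 0)"
            using 0 by (intro sum.cong) auto
          then show ?thesis using True that J by (simp add: lookup_prestrict lookup_sum)
        qed (use 0 that in \<open>simp add: lookup_prestrict\<close>)
      qed
      show "\<forall>x\<in>?P. restrict (\<lambda>j. prestrict (V j) (\<Sum>j\<in>J. x j)) J = x"
        by (auto simp: pr fun_eq_iff restrict_def PiE_iff extensional_def)
      show "\<forall>e\<in>{e\<in>?X. f e = c}. (\<Sum>j\<in>J. restrict (\<lambda>j. prestrict (V j) e) J j) = e"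
        using prestrict_partition[OF J(1) _ J(2)] by auto
      show "(\<lambda>x. \<Sum>j\<in>J. x j) ` ?P \<subseteq> {e\<in>?X. f e = c}"
      proof (rule image_subsetI)
        fix x assume x: "x \<in> ?P"
        have k: "keys (\<Sum>j\<in>J. x j) \<subseteq> (\<Union>j\<in>J. V j)"
        proof
          fix v assume "v \<in> keys (\<Sum>j\<in>J. x j)"
          then have "(\<Sum>j\<in>J. lookup (x j) v) \<noteq> 0" by (simp add: in_keys_iff lookup_sum)
          then obtain j where "j \<in> J" "lookup (x j) v \<noteq> 0" by (meson sum.neutral)
          moreover have "v \<in> keys (x j)" by (simp add: in_keys_iff calculation)
          ultimately show "v \<in> (\<Union>j\<in>J. V j)" using x by (auto simp: PiE_iff)
        qed
        have fc: "f (\<Sum>j\<in>J. x j) = c"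
        proof (rule poly_mapping_eqI)
          fix j show "lookup (f (\<Sum>j\<in>J. x j)) j = lookup c j"
            using x c(1) by (auto simp: look_f pr[OF x] PiE_iff in_keys_iff)
        qed
        then show "(\<Sum>j\<in>J. x j) \<in> {e\<in>?X. f e = c}" using k f_deg[OF k] c by auto
      qed
      show "(\<lambda>e. restrict (\<lambda>j. prestrict (V j) e) J) ` {e\<in>?X. f e = c} \<subseteq> ?P"
        by (auto simp: keys_prestrict look_f)
    qed
    then have "card {e\<in>?X. f e = c} = card ?P" by (simp add: bij_betw_same_card)
    also have "\<dots> = (\<Prod>j\<in>J. card (?fib j (lookup c j)))" by (rule card_PiE[OF J(1)])
    finally show ?thesis by (simp add: F pcount_card)
  qed
  have sub: "?C \<subseteq> f ` ?X"
  proof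
    fix c assume c: "c \<in> ?C"
    then have "(\<Prod>j\<in>J. F j (lookup c j)) \<noteq> 0" using J(1) by auto
    moreover have ck: "keys c \<subseteq> J" "(\<Sum>j\<in>keys c. lookup c j) = d" using c by auto
    ultimately have "int (card {e\<in>?X. f e = c}) \<noteq> 0" unfolding fibre[OF ck] by simp
    moreover have "int (card {e\<in>?X. f e = c}) = 0" if "{e\<in>?X. f e = c} = {}"
      unfolding that by simp
    ultimately have "{e\<in>?X. f e = c} \<noteq> {}" by blast
    then show "c \<in> f ` ?X" by auto
  qed
  have "pcount (\<Union>j\<in>J. V j) w d = (\<Sum>e\<in>?X. 1)" by (simp add: pcount_card)
  also have "\<dots> = (\<Sum>c\<in>f ` ?X. \<Sum>e | e \<in> ?X \<and> f e = c. 1)"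
    using sum.group[OF finX finite_imageI[OF finX, of f], of f "\<lambda>_. 1 :: int"] by simp
  also have "\<dots> = (\<Sum>c\<in>f ` ?X. \<Prod>j\<in>J. F j (lookup c j))"
    by (rule sum.cong[OF refl]) (use fibre keys_f f_deg in auto)
  also have "\<dots> = (\<Sum>c\<in>?C. \<Prod>j\<in>J. F j (lookup c j))"
  proof (rule sum.mono_neutral_right[OF finite_imageI[OF finX] sub], rule ballI)
    fix c assume "c \<in> f ` ?X - ?C"
    then obtain j where "j \<in> J" "F j (lookup c j) = 0" using keys_f f_deg by auto
    then show "(\<Prod>j\<in>J. F j (lookup c j)) = 0" using J(1) by (meson prod_zero)
  qed
  \<comment> \<open>For finite \<open>J\<close>, leaving out the factors 1, as
    \<open>fs_prod\<close> does, does not change the product.\<close>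
  also have "\<dots> = (\<Sum>c\<in>?C. \<Prod>j | j \<in> J \<and> F j (lookup c j) \<noteq> 1. F j (lookup c j))"
    by (rule sum.cong[OF refl], rule prod.mono_neutral_right) (use J(1) in auto)
  finally show "fs_prod J F d = pcount (\<Union>j\<in>J. V j) w d" by (simp add: fs_prod_def)
qed

text \<open>Each factor of the Pochhammer symbol contributes either 1 or its negative monomial, so a
  term of the expansion is the finite set \<open>S\<close> of indices where the second is chosen.
  The assumption keeps the exponents of the two terms distinct.\<close>

lemma qpoch_wcount:
  fixes a :: "'a::comm_monoid_add \<times> 'b::comm_monoid_add \<times> nat"
  assumes nz: "\<And>k. a + (0, 0, k) \<noteq> 0"
  shows "qpoch a = wcount {S :: nat set. finite S} (\<lambda>S. \<Sum>s\<in>S. a + (0, 0, s)) (\<lambda>S. (-1) ^ card S)"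
proof
  fix d
  let ?F = "\<lambda>k. fs_one_minus (a + (0, 0, k))"
  let ?C = "{c. keys c \<subseteq> (UNIV :: nat set) \<and> (\<Sum>j\<in>keys c. lookup c j) = d \<and> (\<forall>j\<in>UNIV. ?F j (lookup c j) \<noteq> 0)}"
  let ?S = "{S :: nat set. S \<in> {S. finite S} \<and> (\<Sum>s\<in>S. a + (0, 0, s)) = d}"
  define f where "f S = (\<Sum>s\<in>S. single s (a + (0, 0, s)))" for S :: "nat set"
  have look: "lookup (f S) k = (if k \<in> S then a + (0, 0, k) else 0)" if "finite S" for S k
    using that by (simp add: f_def lookup_sum lookup_single when_def)
  have keys: "keys (f S) = S" if "finite S" for S
    using that nz by (auto simp: in_keys_iff look split: if_splits)
  have F0: "?F k 0 = 1" "?F k (a + (0, 0, k)) = -1" for k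
    using nz[of k] by (auto simp: fs_one_minus_def)
  have Fnz: "?F k x \<noteq> 0 \<Longrightarrow> x = 0 \<or> x = a + (0, 0, k)" for k x
    by (auto simp: fs_one_minus_def split: if_splits)
  have "bij_betw f ?S ?C"
  proof (rule bij_betw_byWitness[where f' = keys])
    show "\<forall>c\<in>?C. f (keys c) = c"
    proof (intro ballI poly_mapping_eqI)
      fix c k assume "c \<in> ?C"
      then have "?F k (lookup c k) \<noteq> 0" by blast
      from Fnz[OF this] show "lookup (f (keys c)) k = lookup c k"
        using nz[of k] by (auto simp: look in_keys_iff)
    qed
    show "f ` ?S \<subseteq> ?C"
      using F0 by (auto simp: look keys split: if_splits)
    show "keys ` ?C \<subseteq> ?S"
    proof (rule image_subsetI)
      fix c assume c: "c \<in> ?C"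
      have "lookup c s = a + (0, 0, s)" if "s \<in> keys c" for s
      proof -
        have "?F s (lookup c s) \<noteq> 0" using c by blast
        from Fnz[OF this] show ?thesis using that by (simp add: in_keys_iff)
      qed
      then have "(\<Sum>s\<in>keys c. a + (0, 0, s)) = (\<Sum>s\<in>keys c. lookup c s)" by (intro sum.cong) auto
      then show "keys c \<in> ?S" using c by simp
    qed
  qed (simp add: keys)
  from sum.reindex_bij_betw[OF this, of "\<lambda>c. \<Prod>j | j \<in> UNIV \<and> ?F j (lookup c j) \<noteq> 1. ?F j (lookup c j)"]
  have "qpoch a d = (\<Sum>S\<in>?S. \<Prod>j | j \<in> UNIV \<and> ?F j (lookup (f S) j) \<noteq> 1. ?F j (lookup (f S) j))"
    by (simp add: qpoch_def fs_prod_def)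
  also have "\<dots> = (\<Sum>S\<in>?S. (-1) ^ card S)"
  proof (rule sum.cong[OF refl])
    fix S assume "S \<in> ?S"
    then have fS: "finite S" by simp
    have "{j. j \<in> UNIV \<and> ?F j (lookup (f S) j) \<noteq> 1} = S"
      using F0 by (auto simp: look[OF fS])
    then show "(\<Prod>j | j \<in> UNIV \<and> ?F j (lookup (f S) j) \<noteq> 1. ?F j (lookup (f S) j)) = (-1) ^ card S"
      using F0 by (simp add: look[OF fS])
  qed
  finally show "qpoch a d = wcount {S :: nat set. finite S} (\<lambda>S. \<Sum>s\<in>S. a + (0, 0, s)) (\<lambda>S. (-1) ^ card S) d"
    by (simp add: wcount_def)
qed

text \<open>\<open>f\<close> enumerates variables of degrees \<open>a\<close>, \<open>a q\<close>,
  \<open>a q^2\<close> and so on, one for each factor of the Pochhammer symbol.\<close>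

lemma inv_qpoch_pcount:
  assumes "proper_wt h (f ` UNIV) w" "inj f" "\<And>k. w (f k) = a + (0, 0, k)"
  shows "inv_qpoch a = pcount (range f) w"
proof -
  have "finite {k. h (w (f k)) \<le> B}" for B
  proof -
    have "{k. h (w (f k)) \<le> B} = f -` {v\<in>range f. h (w v) \<le> B}" by auto
    moreover have "finite {v\<in>range f. h (w v) \<le> B}" using assms(1) by (simp add: proper_wt_def)
    ultimately show ?thesis using finite_vimageI[OF _ assms(2)] by metis
  qed
  then have "proper_wt h UNIV (\<lambda>k. w (f k))"
    using assms(1) by (simp add: proper_wt_def)
  then have "inv_qpoch a = pcount UNIV (\<lambda>k. w (f k))"
    unfolding inv_qpoch_def assms(3)[symmetric] by (rule fs_prod_geometric)
  also have "\<dots> = pcount (range f) w"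
    using assms(2) by (intro pcount_reindex[of f]) (simp_all add: bij_betw_def)
  finally show ?thesis .
qed

section \<open>Comparing and cancelling counts\<close>

lemma card_fibre_reindex:
  assumes "bij_betw f A B" "\<And>x. x \<in> A \<Longrightarrow> dg' (f x) = dg x"
  shows "card {x\<in>A. dg x = d} = card {y\<in>B. dg' y = d}"
proof -
  have "wcount A dg (\<lambda>_. 1) = wcount B dg' (\<lambda>_. 1)"
    using assms by (intro wcount_reindex[of f]) auto
  from fun_cong[OF this, of d] show ?thesis by (simp add: wcount_def)
qed

text \<open>A factor that is a power series in \<open>q\<close> with constant term 1 may be
  cancelled. For fixed weights the product is a convolution in the exponent of \<open>q\<close>,
  whose term \<open>j = k\<close> is the count in question, and the lower terms agree by
  induction.\<close>

lemma count_cancel: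
  fixes dA :: "'x \<Rightarrow> 'g::comm_monoid_add \<times> 'h::comm_monoid_add \<times> nat" and dB :: "'y \<Rightarrow> 'g \<times> 'h \<times> nat"
    and dQ :: "'z \<Rightarrow> nat"
  assumes finA: "\<And>d. finite {x\<in>A. dA x = d}" and finB: "\<And>d. finite {x\<in>B. dB x = d}"
    and finQ: "\<And>k. finite {x\<in>Q. dQ x = k}" and Q0: "card {x\<in>Q. dQ x = 0} = 1"
    and eq: "\<And>d. card {p\<in>A \<times> Q. dA (fst p) + (0, 0, dQ (snd p)) = d} =
      card {p\<in>B \<times> Q. dB (fst p) + (0, 0, dQ (snd p)) = d}"
  shows "card {x\<in>A. dA x = d} = card {x\<in>B. dB x = d}"
proof -
  obtain \<alpha> \<beta> k where d: "d = (\<alpha>, \<beta>, k)" by (cases d)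
  have conv: "card {p\<in>X \<times> Q. dX (fst p) + (0, 0, dQ (snd p)) = (\<alpha>, \<beta>, k)} =
      (\<Sum>j\<le>k. card {x\<in>X. dX x = (\<alpha>, \<beta>, j)} * card {z\<in>Q. dQ z = k - j})"
    if "\<And>d. finite {x\<in>X. dX x = d}" for X and dX :: "'w \<Rightarrow> 'g \<times> 'h \<times> nat" and k
  proof -
    have "{p\<in>X \<times> Q. dX (fst p) + (0, 0, dQ (snd p)) = (\<alpha>, \<beta>, k)} =
        (\<Union>j\<le>k. {x\<in>X. dX x = (\<alpha>, \<beta>, j)} \<times> {z\<in>Q. dQ z = k - j})" (is "?L = ?R")
    proof (intro equalityI subsetI)
      fix p assume p: "p \<in> ?L"
      obtain a b j where "dX (fst p) = (a, b, j)" by (cases "dX (fst p)")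
      then show "p \<in> ?R" using p by (intro UN_I[of j]) auto
    qed auto
    then show ?thesis
      using that finQ by (simp add: card_UN_disjoint card_cartesian_product disjoint_iff)
  qed
  have "card {x\<in>A. dA x = (\<alpha>, \<beta>, k)} = card {x\<in>B. dB x = (\<alpha>, \<beta>, k)}" for k
  proof (induction k rule: less_induct)
    case (less k)
    have "(\<Sum>j\<le>k. card {x\<in>A. dA x = (\<alpha>, \<beta>, j)} * card {z\<in>Q. dQ z = k - j}) =
        (\<Sum>j\<le>k. card {x\<in>B. dB x = (\<alpha>, \<beta>, j)} * card {z\<in>Q. dQ z = k - j})"
      using eq[of "(\<alpha>, \<beta>, k)"] conv[OF finA, of k] conv[OF finB, of k] by simp
    moreover have "(\<Sum>j\<le>k. g j) = (\<Sum>j<k. g j) + g k" for g :: "nat \<Rightarrow> nat"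
      by (simp add: lessThan_Suc_atMost[symmetric])
    ultimately show ?case using less Q0 by simp
  qed
  then show ?thesis by (simp add: d)
qed

section \<open>Affine diagonals\<close>

text \<open>Ranks start at 0, so that columns can be computed modulo \<open>n\<close>.\<close>

definition rk :: "'n::{finite,linorder} \<Rightarrow> nat"
  where "rk i = card {j. j < i}"

lemma rk_less_iff [simp]: "rk i < rk j \<longleftrightarrow> i < j"
proof -
  have *: "rk i < rk j" if "i < j" for i j :: 'a
    unfolding rk_def using that by (intro psubset_card_mono) auto
  show ?thesis by (metis * less_asym linorder_neqE)
qed

lemma rk_eq_iff [simp]: "rk i = rk j \<longleftrightarrow> i = j"
  by (metis less_irrefl linorder_neqE rk_less_iff)

lemma rk_le_iff [simp]: "rk i \<le> rk j \<longleftrightarrow> i \<le> j"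
  by (meson linorder_not_less rk_less_iff)

lemma rk_less [simp]: "rk (i :: 'n::{finite,linorder}) < CARD('n)"
  unfolding rk_def by (intro psubset_card_mono) auto

lemma bij_rk: "bij_betw rk (UNIV :: 'n::{finite,linorder} set) {..<CARD('n)}"
proof -
  have "inj (rk :: 'n \<Rightarrow> nat)" by (rule injI) simp
  moreover from this have "range (rk :: 'n \<Rightarrow> nat) = {..<CARD('n)}"
    by (intro card_subset_eq) (auto simp: card_image)
  ultimately show ?thesis by (simp add: bij_betw_def)
qed

definition unrk :: "nat \<Rightarrow> 'n::{finite,linorder}"
  where "unrk = inv rk"

lemma rk_unrk [simp]: "r < CARD('n) \<Longrightarrow> rk (unrk r :: 'n::{finite,linorder}) = r"
  using bij_rk unfolding unrk_def bij_betw_def by (metis f_inv_into_f lessThan_iff)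

lemma unrk_rk [simp]: "unrk (rk i) = i"
  unfolding unrk_def by (rule inv_f_f) (simp add: inj_def)

section \<open>Coordinates on the affine diagonals\<close>

definition vrow :: "'n::linorder uvar \<Rightarrow> 'n" where "vrow v = fst (Rep_uvar v)"
definition vcol :: "'n::linorder uvar \<Rightarrow> 'n" where "vcol v = fst (snd (Rep_uvar v))"
definition vlev :: "'n::linorder uvar \<Rightarrow> nat" where "vlev v = snd (snd (Rep_uvar v))"

lemma Rep_uvar_eq: "Rep_uvar v = (vrow v, vcol v, vlev v)"
  by (simp add: vrow_def vcol_def vlev_def)

lemma uvar_cases: "vrow v \<le> vcol v \<or> 1 \<le> vlev v"
  using Rep_uvar[of v] by (simp add: Rep_uvar_eq)

lemma uvar_eqI: "vrow v = vrow u \<Longrightarrow> vcol v = vcol u \<Longrightarrow> vlev v = vlev u \<Longrightarrow> v = u"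
  by (metis Rep_uvar_eq Rep_uvar_inject)

lemma Abs_uvar_simps [simp]:
  assumes "i \<le> j \<or> 1 \<le> k"
  shows "vrow (Abs_uvar (i, j, k)) = i" "vcol (Abs_uvar (i, j, k)) = j" "vlev (Abs_uvar (i, j, k)) = k"
  using assms by (simp_all add: vrow_def vcol_def vlev_def Abs_uvar_inverse)

text \<open>The subtraction of natural numbers does not truncate (\<open>rk_row_le\<close>): a
  variable whose column precedes its row has level at least 1, and \<open>CARD('n)\<close> exceeds
  every rank.\<close>

definition vdiag :: "'n::{finite,linorder} uvar \<Rightarrow> nat"
  where "vdiag v = CARD('n) * vlev v + rk (vcol v) - rk (vrow v)"

lemma rk_row_le: "rk (vrow v) \<le> CARD('n) * vlev v + rk (vcol v)" for v :: "'n::{finite,linorder} uvar"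
proof (cases "vlev v = 0")
  case True
  then show ?thesis using uvar_cases[of v] by simp
next
  case False
  then have "CARD('n) * 1 \<le> CARD('n) * vlev v" by (intro mult_le_mono2) simp
  then show ?thesis using rk_less[of "vrow v"] by linarith
qed

lemma rk_row_plus_vdiag: "rk (vrow v) + vdiag v = CARD('n) * vlev v + rk (vcol v)"
  for v :: "'n::{finite,linorder} uvar"
  using rk_row_le[of v] by (simp add: vdiag_def)

text \<open>The entry of the periodic matrix in row \<open>i\<close> and on the diagonal
  \<open>s\<close> has column \<open>i + s\<close>. The residue of this modulo \<open>n\<close> is
  the column of the variable and the quotient its level, so rows and diagonals are coordinates on
  the variables.\<close>

definition dvar :: "'n::{finite,linorder} \<Rightarrow> nat \<Rightarrow> 'n uvar"
  where "dvar i s = Abs_uvar (i, unrk ((rk i + s) mod CARD('n)), (rk i + s) div CARD('n))"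

lemma dvar_simps [simp]:
  fixes i :: "'n::{finite,linorder}"
  shows "vrow (dvar i s) = i" "vcol (dvar i s) = unrk ((rk i + s) mod CARD('n))"
    "vlev (dvar i s) = (rk i + s) div CARD('n)" "vdiag (dvar i s) = s"
proof -
  \<comment> \<open>The level is 0 only if \<open>rk i + s\<close> does not wrap around, and then
    the column is not before the row; so the triple is a variable.\<close>
  have "i \<le> unrk ((rk i + s) mod CARD('n)) \<or> 1 \<le> (rk i + s) div CARD('n)"
  proof (cases "rk i + s < CARD('n)")
    case True
    then have "rk i \<le> rk (unrk ((rk i + s) mod CARD('n)) :: 'n)" by simp
    then show ?thesis unfolding rk_le_iff by blast
  next
    case False
    then show ?thesis by (simp add: Suc_le_eq div_greater_zero_iff)
  qed
  from Abs_uvar_simps[OF this]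
  show *: "vrow (dvar i s) = i" "vcol (dvar i s) = unrk ((rk i + s) mod CARD('n))"
    "vlev (dvar i s) = (rk i + s) div CARD('n)"
    by (simp_all add: dvar_def)
  show "vdiag (dvar i s) = s" by (simp add: vdiag_def *)
qed

lemma dvar_vrow_vdiag [simp]: "dvar (vrow v) (vdiag v) = v" for v :: "'n::{finite,linorder} uvar"
proof (rule uvar_eqI)
  show "vcol (dvar (vrow v) (vdiag v)) = vcol v"
    by (simp add: rk_row_plus_vdiag)
  show "vlev (dvar (vrow v) (vdiag v)) = vlev v"
    by (simp add: rk_row_plus_vdiag)
qed simp

lemma dvar_eq_iff [simp]: "dvar i s = dvar j t \<longleftrightarrow> i = j \<and> s = t"
  by (metis dvar_simps(1,4))

lemma dvar_unique: "vdiag v = s \<Longrightarrow> v = dvar (vrow v) s"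
  by auto

lemma finite_vdiag_le: "finite {v :: 'n::{finite,linorder} uvar. vdiag v \<le> B}"
proof (rule finite_subset)
  show "{v :: 'n uvar. vdiag v \<le> B} \<subseteq> (\<lambda>(i, s). dvar i s) ` (UNIV \<times> {..B})"
    by (auto intro!: image_eqI[of v _ "(vrow v, vdiag v)" for v])
qed simp

lemma finite_vlev_le: "finite {v :: 'n::{finite,linorder} uvar. vlev v \<le> B}"
proof (rule finite_subset)
  show "{v :: 'n uvar. vlev v \<le> B} \<subseteq> Abs_uvar ` (UNIV \<times> UNIV \<times> {..B})"
    by (auto intro!: image_eqI[of v _ "Rep_uvar v" for v] simp: Rep_uvar_inverse) (simp add: Rep_uvar_eq)
qed simp

subsection \<open>Degrees\<close>

definition glw :: "'n::{finite,linorder} uvar \<Rightarrow> 'n zvec \<times> 'n zvec \<times> nat"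
  where "glw v = gl_xyq (vrow v) (vcol v) (vlev v)"

definition slw :: "'n::{finite,linorder} uvar \<Rightarrow> 'n wlat \<times> 'n wlat \<times> nat"
  where "slw v = sl_xyq (vrow v) (vcol v) (vlev v)"

definition sl_of_gl :: "'n::finite zvec \<times> 'n zvec \<times> nat \<Rightarrow> 'n wlat \<times> 'n wlat \<times> nat"
  where "sl_of_gl = (\<lambda>(l, m, k). (wbar l, wbar m, k))"

lemma wbar_0 [simp]: "wbar 0 = 0"
  by (simp add: zero_wlat_def)

lemma wbar_add: "wbar (a + b) = wbar a + wbar b"
  by (simp add: plus_wlat.abs_eq)

lemma wbar_sum: "wbar (sum f A) = (\<Sum>x\<in>A. wbar (f x))"
  by (rule additive_sum) (simp_all add: wbar_add)

lemma wbar_eq_iff: "wbar a = wbar b \<longleftrightarrow> (\<exists>c. a - b = c *s 1)"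
  by (rule wlat.abs_eq_iff)

lemma wbar_surj: "\<exists>a. wbar a = \<alpha>"
  by (induction \<alpha>) auto

lemma sl_of_gl_0: "sl_of_gl 0 = 0"
  by (simp add: sl_of_gl_def zero_prod_def)

lemma sl_of_gl_add: "sl_of_gl (a + b) = sl_of_gl a + sl_of_gl b"
  by (auto simp: sl_of_gl_def wbar_add split: prod.splits)

lemma sl_of_gl_pdeg: "sl_of_gl (pdeg glw m) = pdeg slw m"
  for m :: "'n::{finite,linorder} uvar \<Rightarrow>\<^sub>0 nat"
proof -
  have "(\<lambda>v :: 'n uvar. sl_of_gl (glw v)) = slw"
    by (auto simp: slw_def glw_def gl_xyq_def sl_xyq_def sl_of_gl_def)
  then show ?thesis
    using additive_pdeg[of sl_of_gl glw m, OF sl_of_gl_0 sl_of_gl_add] by (simp only:)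
qed

lemma nsmul_vec: "nsmul r (x :: 'n::finite zvec) = int r *s x"
  by (induction r) (simp_all add: nsmul_Suc vec_eq_iff algebra_simps)

lemma pdeg_glw: "pdeg glw m =
  (\<Sum>v\<in>keys m. int (lookup m v) *s axis (vrow v) 1,
   \<Sum>v\<in>keys m. int (lookup m v) *s axis (vcol v) 1,
   \<Sum>v\<in>keys m. lookup m v * vlev v)"
proof -
  have "nsmul r (a, b, c) = (nsmul r a, nsmul r b, nsmul r c)"
    for r and a b :: "'a zvec" and c :: nat
    by (induction r) (simp_all add: nsmul_Suc zero_prod_def)
  then show ?thesis
    by (simp add: pdeg_def glw_def gl_xyq_def sum_prod nsmul_vec)
qed

lemma mono_degree_pdeg: "mono_degree m = pdeg slw m"
  by (simp add: sl_of_gl_pdeg[symmetric] pdeg_glw mono_degree_def sl_of_gl_def Rep_uvar_eq)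

section \<open>The monomials of the diagonals\<close>

definition dmon :: "nat \<Rightarrow> 'n::{finite,linorder} uvar \<Rightarrow>\<^sub>0 nat"
  where "dmon s = (\<Sum>i\<in>UNIV. single (dvar i s) 1)"

lemma lookup_dmon: "lookup (dmon s) v = of_bool (vdiag v = s)"
proof -
  have "lookup (dmon s) v = (\<Sum>i\<in>UNIV. of_bool (dvar i s = v))"
    by (simp add: dmon_def lookup_sum lookup_single when_def of_bool_def One_nat_def cong: if_cong)
  also have "dvar i s = v \<longleftrightarrow> i = vrow v \<and> vdiag v = s" for i
    by (metis dvar_simps(1,4) dvar_vrow_vdiag)
  then have "(\<Sum>i\<in>UNIV. of_bool (dvar i s = v)) =
      (\<Sum>i\<in>UNIV. if i = vrow v then of_bool (vdiag v = s) else 0 :: nat)"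
    by (intro sum.cong) auto
  finally show ?thesis by simp
qed

text \<open>If two shifted rows agree, then \<open>n\<close> divides the difference of their ranks,
  which is smaller than \<open>n\<close>.\<close>

lemma bij_shift: "bij (\<lambda>i :: 'n::{finite,linorder}. unrk ((rk i + s) mod CARD('n)) :: 'n)" (is "bij ?f")
proof -
  have "inj ?f"
  proof (rule injI)
    fix i j assume "?f i = ?f j"
    then have "rk (?f i) = rk (?f j)" by (simp only:)
    then have "(rk i + s) mod CARD('n) = (rk j + s) mod CARD('n)" by simp
    \<comment> \<open>With truncated subtraction this is trivial for \<open>a > b\<close>, so it
      applies to the two ranks in either order.\<close>
    moreover have "CARD('n) dvd b - a" if "(a + s) mod CARD('n) = (b + s) mod CARD('n)" for a b
    proof (cases "a \<le> b")
      case True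
      then have "CARD('n) dvd (b + s) - (a + s)"
        using mod_eq_dvd_iff_nat[of "a + s" "b + s" "CARD('n)"] that by auto
      then show ?thesis by simp
    qed simp
    ultimately have "CARD('n) dvd rk i - rk j" "CARD('n) dvd rk j - rk i" by metis+
    moreover have "rk i - rk j < CARD('n)" "rk j - rk i < CARD('n)"
      using rk_less[of i] rk_less[of j] by linarith+
    ultimately have "rk i - rk j = 0" "rk j - rk i = 0" by (metis nat_dvd_not_less neq0_conv)+
    then have "rk i = rk j" by linarith
    then show "i = j" by simp
  qed
  then show ?thesis by (simp add: bij_def finite_UNIV_inj_surj)
qed

lemma pdeg_glw_dmon: "pdeg glw (dmon s :: 'n::{finite,linorder} uvar \<Rightarrow>\<^sub>0 nat) =
  (\<Sum>i\<in>UNIV. axis i 1, \<Sum>i\<in>UNIV. axis i 1, s)"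
proof -
  let ?f = "\<lambda>i :: 'n. unrk ((rk i + s) mod CARD('n)) :: 'n"
  \<comment> \<open>Division with remainder in every row. The columns are a permutation of the rows,
    so after summation the ranks cancel and \<open>n\<close> times the sum of the levels is
    \<open>n * s\<close>.\<close>
  have "(\<Sum>i :: 'n\<in>UNIV. rk i + s) = (\<Sum>i :: 'n\<in>UNIV. CARD('n) * ((rk i + s) div CARD('n)) + rk (?f i))"
    by (rule sum.cong) simp_all
  also have "\<dots> = CARD('n) * (\<Sum>i :: 'n\<in>UNIV. (rk i + s) div CARD('n)) + (\<Sum>i :: 'n\<in>UNIV. rk (?f i))"
    by (simp add: sum.distrib sum_distrib_left del: rk_unrk)
  also have "(\<Sum>i :: 'n\<in>UNIV. rk (?f i)) = (\<Sum>i :: 'n\<in>UNIV. rk i)"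
    by (rule sum.reindex_bij_betw[OF bij_shift])
  finally have lev: "(\<Sum>i :: 'n\<in>UNIV. (rk i + s) div CARD('n)) = s"
    by (simp add: sum.distrib)
  have col: "(\<Sum>i\<in>UNIV. axis (?f i) 1) = (\<Sum>i\<in>UNIV. axis i (1::int))"
    by (rule sum.reindex_bij_betw[OF bij_shift])
  have "pdeg glw (dmon s :: 'n uvar \<Rightarrow>\<^sub>0 nat) = (\<Sum>i\<in>UNIV. glw (dvar i s))"
    by (simp add: dmon_def pdeg_sum)
  also have "\<dots> = (\<Sum>i\<in>UNIV. axis i 1, \<Sum>i\<in>UNIV. axis (?f i) 1, \<Sum>i :: 'n\<in>UNIV. (rk i + s) div CARD('n))"
    by (simp add: glw_def gl_xyq_def sum_prod)
  finally show ?thesis by (simp only: lev col)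
qed

lemma sum_axis: "(\<Sum>i\<in>UNIV. axis i 1) = (1 :: 'n::finite zvec)"
  by (simp add: vec_eq_iff axis_def if_distrib cong: if_cong)

lemma pdeg_slw_dmon: "pdeg slw (dmon s) = (0, 0, s)"
proof -
  have "wbar (1 :: 'n::finite zvec) = 0"
    unfolding wbar_0[symmetric] wbar_eq_iff by (rule exI[of _ 1]) simp
  then show ?thesis by (simp add: sl_of_gl_pdeg[symmetric] pdeg_glw_dmon sl_of_gl_def sum_axis)
qed

subsection \<open>Standard monomials\<close>

text \<open>The value at \<open>s\<close> is the multiplicity of \<open>dmon s\<close> in the
  monomial, i.e. its highest power that divides it. As the monomials \<open>dmon s\<close> have
  disjoint supports, these powers can be split off for all \<open>s\<close> independently.\<close>

lift_definition dmult :: "('n::{finite,linorder} uvar \<Rightarrow>\<^sub>0 nat) \<Rightarrow> nat \<Rightarrow>\<^sub>0 nat"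
  is "\<lambda>m s. Min (range (\<lambda>i. m (dvar i s)))"
proof -
  fix m :: "'n uvar \<Rightarrow> nat" assume m: "finite {v. m v \<noteq> 0}"
  \<comment> \<open>A diagonal with positive minimum meets the support of \<open>m\<close> in every
    row, in particular in an arbitrary one.\<close>
  have "{s. Min (range (\<lambda>i. m (dvar i s))) \<noteq> 0} \<subseteq> vdiag ` {v. m v \<noteq> 0}"
  proof
    fix s assume "s \<in> {s. Min (range (\<lambda>i. m (dvar i s))) \<noteq> 0}"
    then have "m (dvar (undefined :: 'n) s) \<noteq> 0"
      by (metis (mono_tags, lifting) Min_le bot_nat_0.extremum_unique finite finite_imageI mem_Collect_eq rangeI)
    then show "s \<in> vdiag ` {v. m v \<noteq> 0}" by (intro image_eqI[of _ _ "dvar undefined s"]) auto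
  qed
  then show "finite {s. Min (range (\<lambda>i. m (dvar i s))) \<noteq> 0}"
    using m by (meson finite_imageI finite_subset)
qed

lemma dmult_le: "lookup (dmult m) s \<le> lookup m (dvar i s)"
  by transfer auto

lemma dmult_attained: "\<exists>i. lookup (dmult m) s = lookup m (dvar i s)"
proof transfer
  fix m :: "'a uvar \<Rightarrow> nat" and s
  have "Min (range (\<lambda>i. m (dvar i s))) \<in> range (\<lambda>i. m (dvar i s))"
    by (rule Min_in) auto
  then show "\<exists>i. Min (range (\<lambda>i. m (dvar i s))) = m (dvar i s)" by blast
qed

lemma dmult_eqI: "(\<And>i. r \<le> lookup m (dvar i s)) \<Longrightarrow> r = lookup m (dvar i s) \<Longrightarrow> lookup (dmult m) s = r"
  by (metis dmult_attained dmult_le le_antisym)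

definition std :: "('n::{finite,linorder} uvar \<Rightarrow>\<^sub>0 nat) \<Rightarrow> bool"
  where "std m \<longleftrightarrow> dmult m = 0"

text \<open>By \<open>dmult_le\<close> the subtraction does not truncate, so this is division by the
  diagonal monomials.\<close>

definition stdpart :: "('n::{finite,linorder} uvar \<Rightarrow>\<^sub>0 nat) \<Rightarrow> 'n uvar \<Rightarrow>\<^sub>0 nat"
  where "stdpart m = m - pdeg dmon (dmult m)"

lemma lookup_nsmul: "lookup (nsmul r e) v = r * lookup e v" for e :: "'v \<Rightarrow>\<^sub>0 nat"
  by (induction r) (simp_all add: nsmul_Suc lookup_add)

lemma lookup_pdeg_dmon: "lookup (pdeg dmon a) v = lookup a (vdiag v)"
proof -
  have "lookup (pdeg dmon a) v = (\<Sum>s\<in>keys a. if s = vdiag v then lookup a s else 0)"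
    unfolding pdeg_def lookup_sum by (rule sum.cong) (auto simp: lookup_nsmul lookup_dmon)
  then show ?thesis by (simp add: in_keys_iff)
qed

lemma stdpart_decomp: "stdpart m + pdeg dmon (dmult m) = m"
proof (rule poly_mapping_eqI)
  fix v
  show "lookup (stdpart m + pdeg dmon (dmult m)) v = lookup m v"
    using dmult_le[of m "vdiag v" "vrow v"]
    by (simp add: stdpart_def lookup_add lookup_minus lookup_pdeg_dmon)
qed

text \<open>\<open>pdeg dmon a\<close> is constant along each diagonal, so it raises every minimum
  by the entry of \<open>a\<close>.\<close>

lemma dmult_add_pdeg_dmon: "dmult (m + pdeg dmon a) = dmult m + a"
proof (rule poly_mapping_eqI)
  fix s
  obtain i where "lookup (dmult m) s = lookup m (dvar i s)" using dmult_attained by blast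
  then show "lookup (dmult (m + pdeg dmon a)) s = lookup (dmult m + a) s"
    using dmult_le[of m s] by (intro dmult_eqI[of _ _ _ i]) (simp_all add: lookup_add lookup_pdeg_dmon)
qed

lemma stdpart_add_pdeg_dmon: "stdpart (m + pdeg dmon a) = stdpart m"
  by (rule poly_mapping_eqI)
    (simp add: stdpart_def dmult_add_pdeg_dmon lookup_minus lookup_add lookup_pdeg_dmon)

lemma std_stdpart [simp]: "std (stdpart m)"
  using dmult_add_pdeg_dmon[of "stdpart m" "dmult m"] by (simp add: stdpart_decomp std_def)

lemma stdpart_std: "std m \<Longrightarrow> stdpart m = m"
  by (simp add: std_def stdpart_def)

section \<open>The characters as counts\<close>

text \<open>\<open>h\<close> bounds the second component because it is nonnegative on the first;
  each second component then leaves finitely many first ones. The summand \<open>a\<close> cannot be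
  moved to the other side in a monoid, and carrying it gives the conclusion the form of the premise
  \<open>fin\<close>, so that the lemma can be iterated.\<close>

lemma finite_pairs:
  assumes wt: "proper_wt h V w" and nonneg: "\<And>x. x \<in> A \<Longrightarrow> h (dg x) \<ge> 0"
    and fin: "\<And>a. finite {x\<in>A. dg x + a = d}"
  shows "finite {p \<in> A \<times> {e. keys e \<subseteq> V}. dg (fst p) + pdeg w (snd p) + a = d}"
proof (rule finite_subset)
  let ?E = "{e. keys e \<subseteq> V \<and> h (pdeg w e) \<le> h d - h a}"
  show "{p \<in> A \<times> {e. keys e \<subseteq> V}. dg (fst p) + pdeg w (snd p) + a = d} \<subseteq>
      (\<Union>e\<in>?E. {x\<in>A. dg x + (pdeg w e + a) = d} \<times> {e})"
  proof
    fix p assume p: "p \<in> {p \<in> A \<times> {e. keys e \<subseteq> V}. dg (fst p) + pdeg w (snd p) + a = d}"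
    then have "h d = h (dg (fst p)) + h (pdeg w (snd p)) + h a" using wt by (auto simp: proper_wt_def)
    moreover have "h (dg (fst p)) \<ge> 0" using p by (intro nonneg) auto
    ultimately have "h (pdeg w (snd p)) \<le> h d - h a" by linarith
    then show "p \<in> (\<Union>e\<in>?E. {x\<in>A. dg x + (pdeg w e + a) = d} \<times> {e})"
      using p by (intro UN_I[of "snd p"]) (auto simp: add.assoc)
  qed
  show "finite (\<Union>e\<in>?E. {x\<in>A. dg x + (pdeg w e + a) = d} \<times> {e})"
    using finite_proper_wt_le[OF wt, of "h d - h a"] fin by blast
qed

text \<open>This absorbs the factors of a fraction one after another into the set of variables,
  while the first component, which carries the signs, is left alone.\<close>

lemma wcount_mult_pcount:
  fixes w :: "'v \<Rightarrow> 'g::comm_monoid_add"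
  assumes wt: "proper_wt h (V \<union> W) w" and disj: "V \<inter> W = {}"
    and nonneg: "\<And>x. x \<in> A \<Longrightarrow> h (dg x) \<ge> 0" and fin: "\<And>a d. finite {x\<in>A. dg x + a = d}"
  shows "wcount (A \<times> {e. keys e \<subseteq> V}) (\<lambda>p. dg (fst p) + pdeg w (snd p)) (\<lambda>p. sg (fst p)) \<odot> pcount W w =
    wcount (A \<times> {e. keys e \<subseteq> V \<union> W}) (\<lambda>p. dg (fst p) + pdeg w (snd p)) (\<lambda>p. sg (fst p))"
    (is "wcount ?A ?dg ?sg \<odot> _ = wcount ?B _ _")
proof -
  have wtV: "proper_wt h V w" and wtW: "proper_wt h W w"
    using proper_wt_subset[OF wt] by auto
  have "finite {q \<in> ?A \<times> {e. keys e \<subseteq> W}. ?dg (fst q) + pdeg w (snd q) + 0 = d}" for d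
  proof (rule finite_pairs[OF wtW])
    fix q assume "q \<in> ?A"
    then have "h (dg (fst q)) \<ge> 0" "h (pdeg w (snd q)) \<ge> 0"
      using nonneg proper_wt_pdeg_nonneg[OF wtV] by auto
    then show "h (?dg q) \<ge> 0" using wt by (simp add: proper_wt_def)
  next
    fix a show "finite {x\<in>?A. ?dg x + a = d}" by (rule finite_pairs[OF wtV nonneg fin])
  qed
  then have "wcount ?A ?dg ?sg \<odot> pcount W w =
      wcount (?A \<times> {e. keys e \<subseteq> W}) (\<lambda>q. ?dg (fst q) + pdeg w (snd q)) (\<lambda>q. ?sg (fst q))"
    by (intro fs_mult_pcount) simp
  also have "\<dots> = wcount ?B ?dg ?sg"
  proof (rule wcount_reindex[where f = "\<lambda>q. (fst (fst q), snd (fst q) + snd q)"])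
    have inj: "inj_on (\<lambda>p. fst p + snd p) ({e :: 'v \<Rightarrow>\<^sub>0 nat. keys e \<subseteq> V} \<times> {e. keys e \<subseteq> W})"
      and im: "(\<lambda>p. fst p + snd p) ` ({e :: 'v \<Rightarrow>\<^sub>0 nat. keys e \<subseteq> V} \<times> {e. keys e \<subseteq> W}) = {e. keys e \<subseteq> V \<union> W}"
      using bij_betw_pair_add[OF disj] by (auto simp: bij_betw_def)
    show "bij_betw (\<lambda>q. (fst (fst q), snd (fst q) + snd q)) (?A \<times> {e. keys e \<subseteq> W}) ?B"
      unfolding bij_betw_def
    proof
      show "inj_on (\<lambda>q. (fst (fst q), snd (fst q) + snd q)) (?A \<times> {e. keys e \<subseteq> W})"
        using inj unfolding inj_on_def by fastforce
      show "(\<lambda>q. (fst (fst q), snd (fst q) + snd q)) ` (?A \<times> {e. keys e \<subseteq> W}) = ?B"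
      proof (intro equalityI subsetI)
        fix y assume "y \<in> ?B"
        then obtain x e where y: "y = (x, e)" "x \<in> A" "e \<in> {e. keys e \<subseteq> V \<union> W}" by auto
        then obtain e1 e2 where "keys e1 \<subseteq> V" "keys e2 \<subseteq> W" "e = e1 + e2"
          unfolding im[symmetric] by auto
        then show "y \<in> (\<lambda>q. (fst (fst q), snd (fst q) + snd q)) ` (?A \<times> {e. keys e \<subseteq> W})"
          using y by (intro image_eqI[of _ _ "((x, e1), e2)"]) auto
      qed (use im in force)
    qed
  qed (auto simp: pdeg_add add.assoc)
  finally show ?thesis .
qed

lemma wcount_mult_pcount_first:
  assumes wt: "proper_wt h V w"
    and nonneg: "\<And>x. x \<in> A \<Longrightarrow> h (dg x) \<ge> 0" and fin: "\<And>a d. finite {x\<in>A. dg x + a = d}"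
  shows "wcount A dg sg \<odot> pcount V w =
    wcount (A \<times> {e. keys e \<subseteq> V}) (\<lambda>p. dg (fst p) + pdeg w (snd p)) (\<lambda>p. sg (fst p))"
proof (rule fs_mult_pcount)
  fix d
  have "finite {p \<in> A \<times> {e. keys e \<subseteq> V}. dg (fst p) + pdeg w (snd p) + 0 = d}"
    by (rule finite_pairs[OF wt nonneg fin])
  then show "finite {p \<in> A \<times> {e. keys e \<subseteq> V}. dg (fst p) + pdeg w (snd p) = d}" by simp
qed

text \<open>\<open>f\<close> is the identity or \<open>Suc\<close>, according to whether the
  Pochhammer symbol of the position \<open>(i, j)\<close> starts with level 0 or level 1.\<close>

lemma range_Abs_uvar:
  assumes "\<And>k. i \<le> j \<or> 1 \<le> f k" and "range f = {k. P k}"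
  shows "range (\<lambda>k. Abs_uvar (i, j, f k)) = {v. vrow v = i \<and> vcol v = j \<and> P (vlev v)}"
proof (intro equalityI subsetI)
  fix v assume "v \<in> {v. vrow v = i \<and> vcol v = j \<and> P (vlev v)}"
  then have v: "vrow v = i" "vcol v = j" "vlev v \<in> range f" using assms(2) by auto
  then obtain k where "vlev v = f k" by blast
  with v have "v = Abs_uvar (i, j, f k)" by (metis Rep_uvar_eq Rep_uvar_inverse)
  then show "v \<in> range (\<lambda>k. Abs_uvar (i, j, f k))" by blast
qed (use assms in auto)

lemma inj_Abs_uvar:
  assumes "\<And>k. i \<le> j \<or> 1 \<le> f k" "inj f"
  shows "inj (\<lambda>k. Abs_uvar (i, j, f k))"
proof (rule injI)
  fix k l assume "Abs_uvar (i, j, f k) = Abs_uvar (i, j, f l)"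
  then have "vlev (Abs_uvar (i, j, f k)) = vlev (Abs_uvar (i, j, f l))" by simp
  then have "f k = f l" by (simp only: Abs_uvar_simps(3)[OF assms(1)])
  then show "k = l" using assms(2) by (simp add: inj_eq)
qed

lemma range_Suc_eq: "range Suc = {k. 1 \<le> k}"
  by (auto simp: Suc_le_eq gr0_conv_Suc)

subsection \<open>The \<open>gl\<close>-character\<close>

text \<open>The total degree in \<open>x\<close> plus the degree in \<open>q\<close>. Each variable
  has degree 1 in \<open>x\<close>, so this is positive on variables, and it bounds the
  level.\<close>

definition glh :: "'n::finite zvec \<times> 'n zvec \<times> nat \<Rightarrow> int"
  where "glh = (\<lambda>(l, m, k). (\<Sum>i\<in>UNIV. l $ i) + int k)"

lemma glh_add: "glh (a + b) = glh a + glh b"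
  by (simp add: glh_def sum.distrib split: prod.splits)

lemma glh_glw: "glh (glw v) = 1 + int (vlev v)"
  by (simp add: glh_def glw_def gl_xyq_def axis_def)

lemma proper_wt_glw: "proper_wt glh V glw"
proof (rule proper_wt_subset)
  have "{v :: 'a uvar. 1 + int (vlev v) \<le> B} \<subseteq> {v. vlev v \<le> nat B}" for B by auto
  then show "proper_wt glh (UNIV :: 'a uvar set) glw"
    by (auto simp: proper_wt_def glh_add glh_glw intro: finite_subset[OF _ finite_vlev_le])
qed simp

lemma fs_prod_gl_upper:
  "fs_prod {(i :: 'n::{finite,linorder}, j). i \<le> j} (\<lambda>(i, j). inv_qpoch (gl_xyq i j 0)) =
    pcount {v. vrow v \<le> vcol v} glw"
proof -
  let ?V = "\<lambda>(i :: 'n, j). {v. vrow v = i \<and> vcol v = j}"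
  have "fs_prod {(i :: 'n, j). i \<le> j} (\<lambda>(i, j). inv_qpoch (gl_xyq i j 0)) =
      pcount (\<Union>p\<in>{(i, j). i \<le> j}. ?V p) glw"
  proof (rule fs_prod_pcount[OF _ _ proper_wt_glw])
    fix p :: "'n \<times> 'n" assume "p \<in> {(i, j). i \<le> j}"
    then obtain i j where p: "p = (i, j)" "i \<le> j" by auto
    have "range (\<lambda>k. Abs_uvar (i, j, k)) = ?V p"
      using range_Abs_uvar[of i j "\<lambda>k. k" "\<lambda>_. True"] p by simp
    moreover have "inv_qpoch (gl_xyq i j 0) = pcount (range (\<lambda>k. Abs_uvar (i, j, k))) glw"
      using p(2) by (intro inv_qpoch_pcount[OF proper_wt_glw] inj_Abs_uvar)
        (auto simp: glw_def gl_xyq_def)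
    ultimately show "(case p of (i, j) \<Rightarrow> inv_qpoch (gl_xyq i j 0)) = pcount (?V p) glw"
      using p by simp
  qed (auto simp: disjoint_family_on_def)
  also have "(\<Union>p\<in>{(i, j). i \<le> j}. ?V p) = {v. vrow v \<le> vcol v}" by auto
  finally show ?thesis .
qed

lemma fs_prod_gl_lower:
  "fs_prod {(i :: 'n::{finite,linorder}, j). i > j} (\<lambda>(i, j). inv_qpoch (gl_xyq i j 1)) =
    pcount {v. vrow v > vcol v} glw"
proof -
  let ?V = "\<lambda>(i :: 'n, j). {v. vrow v = i \<and> vcol v = j \<and> 1 \<le> vlev v}"
  have "fs_prod {(i :: 'n, j). i > j} (\<lambda>(i, j). inv_qpoch (gl_xyq i j 1)) =
      pcount (\<Union>p\<in>{(i, j). i > j}. ?V p) glw"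
  proof (rule fs_prod_pcount[OF _ _ proper_wt_glw])
    fix p :: "'n \<times> 'n" assume "p \<in> {(i, j). i > j}"
    then obtain i j where p: "p = (i, j)" "i > j" by auto
    have "range (\<lambda>k. Abs_uvar (i, j, Suc k)) = ?V p"
      using range_Abs_uvar[of i j Suc "\<lambda>k. 1 \<le> k"] p range_Suc_eq by simp
    moreover have "inv_qpoch (gl_xyq i j 1) = pcount (range (\<lambda>k. Abs_uvar (i, j, Suc k))) glw"
      by (intro inv_qpoch_pcount[OF proper_wt_glw] inj_Abs_uvar)
        (auto simp: glw_def gl_xyq_def)
    ultimately show "(case p of (i, j) \<Rightarrow> inv_qpoch (gl_xyq i j 1)) = pcount (?V p) glw"
      using p by simp
  qed (auto simp: disjoint_family_on_def)
  also have "(\<Union>p\<in>{(i, j). i > j}. ?V p) = {v :: 'n uvar. vrow v > vcol v}"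
  proof -
    have "1 \<le> vlev v" if "vrow v > vcol v" for v :: "'n uvar"
      using uvar_cases[of v] that by auto
    then show ?thesis by auto
  qed
  finally show ?thesis .
qed

text \<open>The expansion of the product of \<open>-1 + 1\<close> over \<open>T\<close>.\<close>

lemma sum_Pow_alternating:
  assumes "finite T"
  shows "(\<Sum>S\<in>Pow T. (-1) ^ card S) = (of_bool (T = {}) :: int)"
  using prod_add[OF assms, of "\<lambda>_. -1 :: int" "\<lambda>_. 1"] assms
  by (cases "T = {}") (simp_all add: zero_power card_gt_0_iff)

text \<open>The Pochhammer symbol in the numerator chooses a set \<open>S\<close> of diagonals with
  sign \<open>(-1) ^ card S\<close>, the denominators choose a monomial, and the pair is sent to the
  product of this monomial with the \<open>dmon s\<close> for \<open>s\<close> in \<open>S\<close>.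
  Over a fixed product \<open>M\<close> the sets \<open>S\<close> are all subsets of
  \<open>keys (dmult M)\<close>, so the signs cancel unless \<open>M\<close> is standard.\<close>

lemma gl_fraction_count:
  "gl_fraction = wcount {m :: 'n::{finite,linorder} uvar \<Rightarrow>\<^sub>0 nat. std m} (pdeg glw) (\<lambda>_. 1)"
proof -
  let ?X = "(\<Sum>i\<in>UNIV. axis i 1, \<Sum>i\<in>UNIV. axis i 1, 0) :: 'n zvec \<times> 'n zvec \<times> nat"
  let ?A = "{S :: nat set. finite S}" and ?dg = "\<lambda>S. \<Sum>s\<in>S. ?X + (0, 0, s)"
  let ?sg = "\<lambda>S :: nat set. (-1) ^ card S :: int"
  have dg: "?dg S = pdeg glw (\<Sum>s\<in>S. dmon s)" for S
    by (simp add: pdeg_sum pdeg_glw_dmon)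
  let ?f = "\<lambda>p :: nat set \<times> ('n uvar \<Rightarrow>\<^sub>0 nat). (\<Sum>s\<in>fst p. dmon s) + snd p"
  have ne: "?X + (0, 0, k) \<noteq> 0" for k
    by (auto simp: zero_prod_def sum_axis)
  have nonneg: "glh (?dg S) \<ge> 0" for S
    unfolding dg by (rule proper_wt_pdeg_nonneg[OF proper_wt_glw[of UNIV]]) simp
  have fin: "finite {S\<in>?A. ?dg S + a = d}" for a d
  proof (rule finite_subset)
    show "{S\<in>?A. ?dg S + a = d} \<subseteq> Pow {..snd (snd d)}"
    proof
      fix S assume "S \<in> {S\<in>?A. ?dg S + a = d}"
      then have S: "finite S" "snd (snd d) = (\<Sum>s\<in>S. s) + snd (snd a)"
        by (auto simp: sum_prod)
      have "s \<le> snd (snd d)" if "s \<in> S" for s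
        using member_le_sum[of s S "\<lambda>s. s"] that S by simp
      then show "S \<in> Pow {..snd (snd d)}" by auto
    qed
  qed simp
  have split: "{v :: 'n uvar. vrow v \<le> vcol v} \<union> {v. vrow v > vcol v} = UNIV" by auto
  have "gl_fraction = wcount ?A ?dg ?sg \<odot> pcount {v :: 'n uvar. vrow v \<le> vcol v} glw
      \<odot> pcount {v. vrow v > vcol v} glw"
    unfolding gl_fraction_def fs_prod_gl_upper fs_prod_gl_lower qpoch_wcount[OF ne] ..
  also have "\<dots> = wcount (?A \<times> UNIV) (\<lambda>p. ?dg (fst p) + pdeg glw (snd p)) (\<lambda>p. ?sg (fst p))"
    unfolding wcount_mult_pcount_first[OF proper_wt_glw nonneg fin]
    by (subst wcount_mult_pcount[OF proper_wt_glw _ nonneg fin]) (auto simp: split)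
  also have "\<dots> = wcount (?A \<times> UNIV) (\<lambda>p. pdeg glw (?f p)) (\<lambda>p. ?sg (fst p))"
    unfolding pdeg_add dg ..
  also have "\<dots> = wcount {m :: 'n uvar \<Rightarrow>\<^sub>0 nat. std m} (pdeg glw) (\<lambda>_. 1)"
  proof
    fix d
    let ?Y = "{p \<in> ?A \<times> UNIV. pdeg glw (?f p) = d}"
    let ?M = "{M :: 'n uvar \<Rightarrow>\<^sub>0 nat. pdeg glw M = d}"
    have finM: "finite ?M" using finite_pdeg_eq[OF proper_wt_glw[of UNIV], of d] by simp
    have finY: "finite ?Y"
      using finite_pairs[OF proper_wt_glw[of UNIV] nonneg fin, where d = d and a = 0]
      unfolding dg pdeg_add by simp
    have "(\<Sum>p\<in>?Y. ?sg (fst p)) = (\<Sum>M\<in>?M. \<Sum>p | p \<in> ?Y \<and> ?f p = M. ?sg (fst p))"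
      by (rule sum.group[OF finY finM, symmetric]) auto
    also have "\<dots> = (\<Sum>M\<in>?M. of_bool (std M))"
    proof (rule sum.cong[OF refl])
      fix M assume M: "M \<in> ?M"
      let ?T = "keys (dmult M)"
      have look: "lookup (\<Sum>s\<in>S. dmon s) v = of_bool (vdiag v \<in> S)" if "finite S" for S and v :: "'n uvar"
        using that by (simp add: lookup_sum lookup_dmon)
      \<comment> \<open>The monomials of the diagonals in \<open>?T\<close> have disjoint supports
        and each divides \<open>M\<close>, so the product over any subset divides \<open>M\<close>
        too; the cofactor is then determined.\<close>
      have "bij_betw (\<lambda>S. (S, M - (\<Sum>s\<in>S. dmon s))) (Pow ?T) {p. p \<in> ?Y \<and> ?f p = M}"
      proof (rule bij_betw_byWitness[where f' = fst])
        have "(\<Sum>s\<in>S. dmon s) + (M - (\<Sum>s\<in>S. dmon s)) = M" "finite S" if "S \<in> Pow ?T" for S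
        proof -
          show S: "finite S" using that finite_keys[of "dmult M"] by (auto intro: finite_subset)
          show "(\<Sum>s\<in>S. dmon s) + (M - (\<Sum>s\<in>S. dmon s)) = M"
          proof (rule poly_mapping_eqI)
            fix v
            have "lookup M v \<ge> 1" if "vdiag v \<in> S"
              using dmult_le[of M "vdiag v" "vrow v"] that \<open>S \<in> Pow ?T\<close>
              by (auto simp: in_keys_iff)
            then show "lookup ((\<Sum>s\<in>S. dmon s) + (M - (\<Sum>s\<in>S. dmon s))) v = lookup M v"
              using S by (simp add: lookup_add lookup_minus look)
          qed
        qed
        then show "(\<lambda>S. (S, M - (\<Sum>s\<in>S. dmon s))) ` Pow ?T \<subseteq> {p. p \<in> ?Y \<and> ?f p = M}"
          using M by auto
        show "\<forall>p\<in>{p. p \<in> ?Y \<and> ?f p = M}. (fst p, M - (\<Sum>s\<in>fst p. dmon s)) = p" by auto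
        show "fst ` {p. p \<in> ?Y \<and> ?f p = M} \<subseteq> Pow ?T"
        proof (rule image_subsetI, rule PowI, rule subsetI)
          fix p s assume p: "p \<in> {p. p \<in> ?Y \<and> ?f p = M}" "s \<in> fst p"
          then have "M = ?f p" "finite (fst p)" by auto
          then have "1 \<le> lookup M (dvar i s)" for i
            using p(2) by (simp only: lookup_add look) simp
          moreover obtain i where "lookup (dmult M) s = lookup M (dvar i s)"
            using dmult_attained by blast
          ultimately have "1 \<le> lookup (dmult M) s" by metis
          then show "s \<in> ?T" by (simp add: in_keys_iff)
        qed
      qed simp
      from sum.reindex_bij_betw[OF this, of "\<lambda>p. ?sg (fst p)"]
      have "(\<Sum>p | p \<in> ?Y \<and> ?f p = M. ?sg (fst p)) = (\<Sum>S\<in>Pow ?T. ?sg S)" by simp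
      then show "(\<Sum>p | p \<in> ?Y \<and> ?f p = M. ?sg (fst p)) = of_bool (std M)"
        by (simp add: sum_Pow_alternating std_def)
    qed
    also have "\<dots> = wcount {m :: 'n uvar \<Rightarrow>\<^sub>0 nat. std m} (pdeg glw) (\<lambda>_. 1) d"
      unfolding wcount_def of_bool_def using finM
      by (subst sum.inter_filter[symmetric]) (simp_all add: conj_commute)
    finally show "wcount (?A \<times> UNIV) (\<lambda>p. pdeg glw (?f p)) (\<lambda>p. ?sg (fst p)) d =
        wcount {m :: 'n uvar \<Rightarrow>\<^sub>0 nat. std m} (pdeg glw) (\<lambda>_. 1) d"
      by (simp add: wcount_def)
  qed
  finally show ?thesis .
qed

subsection \<open>The \<open>sl\<close>-character\<close>

text \<open>Up to the factor \<open>n\<close> this is the pairing of a weight with the vector of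
  ranks, made invariant under adding \<open>(1,...,1)\<close> by subtracting the mean rank times the
  coordinate sum. The factor keeps it integral.\<close>

lift_definition wlat_ht :: "'n::{finite,linorder} wlat \<Rightarrow> int"
  is "\<lambda>a. int CARD('n) * (\<Sum>i\<in>UNIV. int (rk i) * a $ i) - (\<Sum>i::'n\<in>UNIV. int (rk i)) * (\<Sum>i\<in>UNIV. a $ i)"
proof -
  fix a b :: "(int, 'n) vec" assume "\<exists>c. a - b = c *s 1"
  then obtain c where "a - b = c *s 1" ..
  then have "a $ i = b $ i + c" for i by (simp add: vec_eq_iff algebra_simps)
  then show "int CARD('n) * (\<Sum>i\<in>UNIV. int (rk i) * a $ i) - (\<Sum>i::'n\<in>UNIV. int (rk i)) * (\<Sum>i\<in>UNIV. a $ i) =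
      int CARD('n) * (\<Sum>i\<in>UNIV. int (rk i) * b $ i) - (\<Sum>i::'n\<in>UNIV. int (rk i)) * (\<Sum>i\<in>UNIV. b $ i)"
    by (simp add: sum.distrib algebra_simps flip: sum_distrib_left sum_distrib_right)
qed

lemma wlat_ht_add: "wlat_ht (\<alpha> + \<beta>) = wlat_ht \<alpha> + wlat_ht \<beta>"
  by transfer (simp add: sum.distrib algebra_simps)

lemma wlat_ht_axis: "wlat_ht (wbar (axis i 1)) = int CARD('n) * int (rk i) - (\<Sum>i::'n\<in>UNIV. int (rk i))"
  for i :: "'n::{finite,linorder}"
  by (simp add: wlat_ht.abs_eq axis_def if_distrib cong: if_cong)

text \<open>Chosen to be \<open>n\<close> times the diagonal on every variable
  (\<open>slh_slw\<close>). It is thus proper on the variables of positive diagonals and vanishes on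
  diagonal 0, which is treated separately.\<close>

definition slh :: "'n::{finite,linorder} wlat \<times> 'n wlat \<times> nat \<Rightarrow> int"
  where "slh = (\<lambda>(\<alpha>, \<beta>, k). wlat_ht \<beta> - wlat_ht \<alpha> + int CARD('n) * int CARD('n) * int k)"

lemma slh_add: "slh (a + b) = slh a + slh b"
  by (simp add: slh_def wlat_ht_add algebra_simps split: prod.splits)

lemma slh_slw: "slh (slw v) = int CARD('n) * int (vdiag v)" for v :: "'n::{finite,linorder} uvar"
proof -
  have "int (vdiag v) = int CARD('n) * int (vlev v) + int (rk (vcol v)) - int (rk (vrow v))"
    using arg_cong[OF rk_row_plus_vdiag[of v], of int] by simp
  moreover have "slh (slw v) =
      int CARD('n) * (int CARD('n) * int (vlev v) + int (rk (vcol v)) - int (rk (vrow v)))"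
    by (simp add: slh_def slw_def sl_xyq_def wlat_ht_axis algebra_simps)
  ultimately show ?thesis by simp
qed

lemma vdiag_eq_0_iff: "vdiag v = 0 \<longleftrightarrow> vrow v = vcol v \<and> vlev v = 0"
proof
  assume "vdiag v = 0"
  then have "rk (vrow v) = CARD('a) * vlev v + rk (vcol v)"
    using rk_row_plus_vdiag[of v] by simp
  moreover from this have "vlev v = 0"
    using rk_less[of "vrow v"] by (cases "vlev v") auto
  ultimately show "vrow v = vcol v \<and> vlev v = 0" by simp
qed (simp add: vdiag_def)

lemma vdiag_pos_iff: "0 < vdiag v \<longleftrightarrow> vrow v \<noteq> vcol v \<or> 0 < vlev v"
  using vdiag_eq_0_iff[of v] by (cases "vdiag v = 0") auto

text \<open>
  Up to the twist by the diagonal \<open>\<gamma> \<mapsto> (\<gamma>, \<gamma>)\<close>, the variable \<open>u\<^sub>i\<^sub>i\<^sup>(\<^sup>k\<^sup>)\<close> has degree \<open>q\<^sup>k\<close>.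
\<close>

definition tw :: "'n::{finite,linorder} uvar \<Rightarrow> 'n wlat \<times> 'n wlat \<times> nat"
  where "tw v = (if vrow v = vcol v then (0, 0, vlev v) else slw v)"

definition twist :: "'n::{finite,linorder} uvar \<Rightarrow> 'n wlat"
  where "twist v = (if vrow v = vcol v then wbar (axis (vrow v) 1) else 0)"

definition diagw :: "'n::finite wlat \<Rightarrow> 'n wlat \<times> 'n wlat \<times> nat"
  where "diagw \<gamma> = (\<gamma>, \<gamma>, 0)"

lemma diagw_0 [simp]: "diagw 0 = 0" and diagw_add: "diagw (\<alpha> + \<beta>) = diagw \<alpha> + diagw \<beta>"
  by (simp_all add: diagw_def zero_prod_def)

lemma slh_diagw [simp]: "slh (diagw \<gamma>) = 0"
  by (simp add: slh_def diagw_def)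

lemma slw_eq_tw: "slw v = diagw (twist v) + tw v"
  by (simp add: slw_def sl_xyq_def tw_def twist_def diagw_def)

lemma pdeg_slw_eq: "pdeg slw m = diagw (pdeg twist m) + pdeg tw m"
proof -
  have "diagw (pdeg twist m) = pdeg (\<lambda>v. diagw (twist v)) m"
    by (rule additive_pdeg) (simp_all add: diagw_add)
  then show ?thesis
    by (simp add: pdeg_def slw_eq_tw nsmul_add_right sum.distrib)
qed

lemma slh_tw: "slh (tw v) = int CARD('n) * int (vdiag v)" for v :: "'n::{finite,linorder} uvar"
  using slh_slw[of v] by (simp add: slw_eq_tw slh_add)

lemma proper_wt_tw:
  assumes "V \<subseteq> {v. 1 \<le> vdiag v}"
  shows "proper_wt slh V (tw :: 'n::{finite,linorder} uvar \<Rightarrow> _)"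
proof (rule proper_wt_subset[OF _ assms])
  have le: "int (vdiag v) \<le> int CARD('n) * int (vdiag v)" for v :: "'n uvar"
    by (metis mult_le_mono1 nat_mult_1 of_nat_le_iff of_nat_mult One_nat_def Suc_leI zero_less_card_finite)
  have "finite {v :: 'n uvar. slh (tw v) \<le> B}" for B
  proof (rule finite_subset[OF _ finite_vdiag_le])
    show "{v :: 'n uvar. slh (tw v) \<le> B} \<subseteq> {v. vdiag v \<le> nat B}"
    proof
      fix v assume "v \<in> {v :: 'n uvar. slh (tw v) \<le> B}"
      then show "v \<in> {v. vdiag v \<le> nat B}" using le[of v] by (simp add: slh_tw)
    qed
  qed
  moreover have "1 \<le> slh (tw v)" if "1 \<le> vdiag v" for v :: "'n uvar"
    using le[of v] that unfolding slh_tw by linarith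
  ultimately show "proper_wt slh {v :: 'n uvar. 1 \<le> vdiag v} tw"
    by (simp add: proper_wt_def slh_add)
qed

text \<open>\<open>slh\<close> vanishes on diagonal weights and gives no finiteness here, but the
  first coordinate of the degree determines \<gamma>.\<close>

lemma finite_diagw: "finite {\<gamma> \<in> UNIV. diagw \<gamma> + a = d}"
proof (rule finite_subset)
  show "{\<gamma> \<in> UNIV. diagw \<gamma> + a = d} \<subseteq> {fst d - fst a}"
    by (auto simp: diagw_def)
qed simp

lemma sl_diag_wcount: "sl_diag = wcount UNIV diagw (\<lambda>_. 1)"
proof (rule ext, clarify)
  fix \<alpha> \<beta> :: "'a wlat" and k
  have "{\<gamma>. diagw \<gamma> = (\<alpha>, \<beta>, k)} = (if \<alpha> = \<beta> \<and> k = 0 then {\<alpha>} else {})"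
    by (auto simp: diagw_def)
  then show "sl_diag (\<alpha>, \<beta>, k) = wcount UNIV diagw (\<lambda>_. 1) (\<alpha>, \<beta>, k)"
    by (simp add: sl_diag_def wcount_def)
qed

lemma fs_prod_sl_finite:
  "fs_prod {(i :: 'n::{finite,linorder}, j). i < j} (\<lambda>(i, j). fs_geometric (sl_xyq i j 0)) =
    pcount {v. vrow v < vcol v \<and> vlev v = 0} tw" (is "fs_prod ?J _ = pcount ?V tw")
proof -
  let ?f = "\<lambda>(i :: 'n, j). Abs_uvar (i, j, 0)"
  let ?w = "\<lambda>(i :: 'n, j). sl_xyq i j 0"
  have w: "tw (?f p) = ?w p" if "p \<in> ?J" for p
    using that by (auto simp: tw_def slw_def)
  have bij: "bij_betw ?f ?J ?V"
  proof (rule bij_betw_byWitness[where f' = "\<lambda>v. (vrow v, vcol v)"])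
    show "\<forall>v\<in>?V. ?f (vrow v, vcol v) = v"
      by (auto intro!: uvar_eqI)
  qed auto
  have "proper_wt slh ?J ?w"
    unfolding proper_wt_def
  proof (intro conjI allI ballI slh_add)
    fix p assume p: "p \<in> ?J"
    then have "?f p \<in> ?V" using bij by (auto simp: bij_betw_def)
    then have "1 \<le> vdiag (?f p)"
      using vdiag_eq_0_iff[of "?f p"] by (auto simp: Suc_le_eq)
    then show "1 \<le> slh (?w p)"
      using proper_wt_tw[of "{?f p}"] by (simp add: proper_wt_def flip: w[OF p])
  qed simp
  from fs_prod_geometric[OF this]
  have "fs_prod ?J (\<lambda>(i, j). fs_geometric (sl_xyq i j 0)) = pcount ?J ?w"
    by (simp add: split_def)
  also have "\<dots> = pcount ?V tw" by (intro pcount_reindex[where f = ?f] bij w)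
  finally show ?thesis .
qed

lemma fs_prod_sl_offdiag:
  "fs_prod {(i :: 'n::{finite,linorder}, j). i \<noteq> j} (\<lambda>(i, j). inv_qpoch (sl_xyq i j 1)) =
    pcount {v. vrow v \<noteq> vcol v \<and> 1 \<le> vlev v} tw"
proof -
  let ?V = "\<lambda>(i :: 'n, j). {v. vrow v = i \<and> vcol v = j \<and> 1 \<le> vlev v}"
  have pos: "{v :: 'n uvar. 1 \<le> vlev v} \<subseteq> {v. 1 \<le> vdiag v}"
    by (auto simp: Suc_le_eq vdiag_pos_iff)
  have "fs_prod {(i :: 'n, j). i \<noteq> j} (\<lambda>(i, j). inv_qpoch (sl_xyq i j 1)) =
      pcount (\<Union>p\<in>{(i, j). i \<noteq> j}. ?V p) tw"
  proof (rule fs_prod_pcount[where h = slh])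
    fix p :: "'n \<times> 'n" assume "p \<in> {(i, j). i \<noteq> j}"
    then obtain i j where p: "p = (i, j)" "i \<noteq> j" by auto
    have r: "range (\<lambda>k. Abs_uvar (i, j, Suc k)) = ?V p"
      using range_Abs_uvar[of i j Suc "\<lambda>k. 1 \<le> k"] p range_Suc_eq by simp
    have "inv_qpoch (sl_xyq i j 1) = pcount (range (\<lambda>k. Abs_uvar (i, j, Suc k))) tw"
      using p(2) pos by (intro inv_qpoch_pcount[where h = slh] proper_wt_tw inj_Abs_uvar)
        (auto simp: tw_def slw_def sl_xyq_def vdiag_pos_iff Suc_le_eq)
    then show "(case p of (i, j) \<Rightarrow> inv_qpoch (sl_xyq i j 1)) = pcount (?V p) tw"
      using p unfolding r by simp
  qed (use pos in \<open>auto simp: disjoint_family_on_def intro!: proper_wt_tw\<close>)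
  also have "(\<Union>p\<in>{(i, j). i \<noteq> j}. ?V p) = {v. vrow v \<noteq> vcol v \<and> 1 \<le> vlev v}" by auto
  finally show ?thesis .
qed

text \<open>The \<open>n - 1\<close> equal factors are assigned to the diagonal positions of rank 1
  to \<open>n - 1\<close>. In the twisted degree \<open>tw\<close> the variables there have degree
  \<open>q^k\<close>, whatever the position.\<close>

lemma fs_prod_sl_torus:
  "fs_prod {1..<CARD('n)} (\<lambda>_. inv_qpoch (0, 0, 1)) =
    pcount {v :: 'n::{finite,linorder} uvar. vrow v = vcol v \<and> 1 \<le> rk (vrow v) \<and> 1 \<le> vlev v} tw"
proof -
  let ?V = "\<lambda>c. {v :: 'n uvar. vrow v = unrk c \<and> vcol v = unrk c \<and> 1 \<le> vlev v}"
  have pos: "{v :: 'n uvar. 1 \<le> vlev v} \<subseteq> {v. 1 \<le> vdiag v}"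
    by (auto simp: Suc_le_eq vdiag_pos_iff)
  have "fs_prod {1..<CARD('n)} (\<lambda>_. inv_qpoch (0, 0, 1)) = pcount (\<Union>c\<in>{1..<CARD('n)}. ?V c) tw"
  proof (rule fs_prod_pcount[where h = slh])
    show "disjoint_family_on ?V {1..<CARD('n)}"
    unfolding disjoint_family_on_def
    proof (intro ballI impI)
      fix c d assume "c \<in> {1..<CARD('n)}" "d \<in> {1..<CARD('n)}" "c \<noteq> d"
      then have "(unrk c :: 'n) \<noteq> unrk d"
        by (metis atLeastLessThan_iff rk_unrk)
      then show "?V c \<inter> ?V d = {}" by auto
    qed
    fix c assume c: "c \<in> {1..<CARD('n)}"
    let ?i = "unrk c :: 'n"
    have r: "range (\<lambda>k. Abs_uvar (?i, ?i, Suc k)) = ?V c"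
      using range_Abs_uvar[of ?i ?i Suc "\<lambda>k. 1 \<le> k"] range_Suc_eq by simp
    have "inv_qpoch (0, 0, 1) = pcount (range (\<lambda>k. Abs_uvar (?i, ?i, Suc k))) tw"
      using pos by (intro inv_qpoch_pcount[where h = slh] proper_wt_tw inj_Abs_uvar)
        (auto simp: tw_def vdiag_pos_iff Suc_le_eq)
    then show "inv_qpoch (0, 0, 1) = pcount (?V c) tw"
      unfolding r .
  qed (use pos in \<open>auto intro!: proper_wt_tw\<close>)
  also have "(\<Union>c\<in>{1..<CARD('n)}. ?V c) = {v. vrow v = vcol v \<and> 1 \<le> rk (vrow v) \<and> 1 \<le> vlev v}"
  proof (intro equalityI subsetI)
    fix v assume "v \<in> {v :: 'n uvar. vrow v = vcol v \<and> 1 \<le> rk (vrow v) \<and> 1 \<le> vlev v}"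
    then show "v \<in> (\<Union>c\<in>{1..<CARD('n)}. ?V c)"
      by (intro UN_I[of "rk (vrow v)"]) auto
  qed auto
  finally show ?thesis .
qed

text \<open>Diagonal 0 is left out because \<open>sl_diag\<close> accounts for it, and the diagonal
  position of rank 0 because \<open>sl_fraction\<close> has only \<open>n - 1\<close> torus
  factors.\<close>

definition sl_vars :: "'n::{finite,linorder} uvar set"
  where "sl_vars = {v. 1 \<le> vdiag v \<and> \<not> (vrow v = vcol v \<and> rk (vrow v) = 0)}"

lemma sl_fraction_count:
  "sl_fraction = wcount (UNIV \<times> {e. keys e \<subseteq> (sl_vars :: 'n::{finite,linorder} uvar set)})
    (\<lambda>p. diagw (fst p) + pdeg tw (snd p)) (\<lambda>_. 1)"
proof -
  let ?V1 = "{v :: 'n uvar. vrow v = vcol v \<and> 1 \<le> rk (vrow v) \<and> 1 \<le> vlev v}"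
  let ?V2 = "{v :: 'n uvar. vrow v < vcol v \<and> vlev v = 0}"
  let ?V3 = "{v :: 'n uvar. vrow v \<noteq> vcol v \<and> 1 \<le> vlev v}"
  have un: "?V1 \<union> ?V2 \<union> ?V3 = sl_vars"
  proof -
    have *: "vrow v < vcol v \<longleftrightarrow> vrow v \<noteq> vcol v" if "vlev v = 0" for v :: "'n uvar"
      using uvar_cases[of v] that by auto
    show ?thesis
      by (rule set_eqI) (use * in \<open>auto simp: sl_vars_def vdiag_pos_iff Suc_le_eq\<close>)
  qed
  have sub: "sl_vars \<subseteq> {v :: 'n uvar. 1 \<le> vdiag v}" by (auto simp: sl_vars_def)
  have "sl_fraction = sl_diag \<odot> pcount ?V1 tw \<odot> pcount ?V2 tw \<odot> pcount ?V3 tw"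
    unfolding sl_fraction_def fs_prod_sl_torus fs_prod_sl_finite fs_prod_sl_offdiag ..
  also have "sl_diag \<odot> pcount ?V1 tw =
      wcount (UNIV \<times> {e. keys e \<subseteq> ?V1}) (\<lambda>p. diagw (fst p) + pdeg tw (snd p)) (\<lambda>p. 1)"
    unfolding sl_diag_wcount
    by (rule wcount_mult_pcount_first[where h = slh])
      (use un sub in \<open>auto intro!: proper_wt_tw simp: finite_diagw[simplified]\<close>)
  also have "\<dots> \<odot> pcount ?V2 tw =
      wcount (UNIV \<times> {e. keys e \<subseteq> ?V1 \<union> ?V2}) (\<lambda>p. diagw (fst p) + pdeg tw (snd p)) (\<lambda>p. 1)"
    by (rule wcount_mult_pcount[where h = slh])
      (use un sub in \<open>auto intro!: proper_wt_tw simp: finite_diagw[simplified]\<close>)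
  also have "\<dots> \<odot> pcount ?V3 tw =
      wcount (UNIV \<times> {e. keys e \<subseteq> ?V1 \<union> ?V2 \<union> ?V3}) (\<lambda>p. diagw (fst p) + pdeg tw (snd p)) (\<lambda>p. 1)"
    by (rule wcount_mult_pcount[where h = slh])
      (use un sub in \<open>auto intro!: proper_wt_tw simp: finite_diagw[simplified]\<close>)
  finally show ?thesis unfolding un .
qed


text \<open>
  In the \<open>sl\<close>-degree the exponents of the \<open>u\<^sub>i\<^sub>i\<^sup>(\<^sup>0\<^sup>)\<close> matter only through a weight, which determines
  them if their minimum is 0.
\<close>

definition sl_split :: "('n::{finite,linorder} uvar \<Rightarrow>\<^sub>0 nat) \<Rightarrow> 'n wlat \<times> ('n uvar \<Rightarrow>\<^sub>0 nat)"
  where "sl_split m = (pdeg twist m, prestrict {v. 1 \<le> vdiag v} m)"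

lemma prestrict_compl:
  "prestrict V m + prestrict (- V) m = (m :: 'v \<Rightarrow>\<^sub>0 nat)"
  by (rule poly_mapping_eqI) (simp add: lookup_prestrict lookup_add)

lemma pdeg_sl_split: "diagw (fst (sl_split m)) + pdeg tw (snd (sl_split m)) = pdeg slw m"
proof -
  let ?P = "{v :: 'a uvar. 1 \<le> vdiag v}"
  have "pdeg tw (prestrict (- ?P) m) = pdeg (\<lambda>_. 0) (prestrict (- ?P) m)"
  proof (rule pdeg_cong)
    fix v assume "v \<in> keys (prestrict (- ?P) m)"
    then have "vdiag v = 0" by (simp add: keys_prestrict Suc_le_eq)
    then show "tw v = 0" by (simp add: vdiag_eq_0_iff tw_def zero_prod_def)
  qed
  also have "\<dots> = 0" by (simp add: pdeg_def nsmul_def)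
  finally have "pdeg tw m = pdeg tw (prestrict ?P m)"
    using arg_cong[OF prestrict_compl[of ?P m], of "pdeg tw"] by (simp add: pdeg_add)
  then show ?thesis by (simp add: sl_split_def pdeg_slw_eq)
qed

lemma pdeg_twist_torus:
  "pdeg twist (prestrict (- {v. 1 \<le> vdiag v}) m) = wbar (\<chi> i. int (lookup m (dvar i 0)))"
proof -
  let ?m = "prestrict (- {v. 1 \<le> vdiag v}) m"
  have "keys ?m \<subseteq> range (\<lambda>i. dvar i 0)"
  proof
    fix v assume "v \<in> keys ?m"
    then have "vdiag v = 0" by (simp add: keys_prestrict Suc_le_eq)
    then show "v \<in> range (\<lambda>i. dvar i 0)" using dvar_unique by blast
  qed
  then have "pdeg twist ?m = (\<Sum>v\<in>range (\<lambda>i. dvar i 0). nsmul (lookup ?m v) (twist v))"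
    by (intro pdeg_superset) auto
  also have "\<dots> = (\<Sum>i\<in>UNIV. nsmul (lookup m (dvar i 0)) (wbar (axis i 1)))"
    by (subst sum.reindex) (auto simp: inj_def lookup_prestrict twist_def)
  also have "\<dots> = (\<Sum>i\<in>UNIV. wbar (int (lookup m (dvar i 0)) *s axis i 1))"
    by (simp add: nsmul_vec[symmetric] additive_nsmul[of wbar] wbar_add)
  also have "\<dots> = wbar (\<Sum>i\<in>UNIV. int (lookup m (dvar i 0)) *s axis i 1)"
    by (rule wbar_sum[symmetric])
  also have "(\<Sum>i\<in>UNIV. int (lookup m (dvar i 0)) *s axis i 1) = (\<chi> i. int (lookup m (dvar i 0)))"
    by (simp add: vec_eq_iff axis_def if_distrib cong: if_cong)
  finally show ?thesis .
qed

lemma pdeg_twist_split: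
  "pdeg twist m = pdeg twist (prestrict {v. 1 \<le> vdiag v} m) + wbar (\<chi> i. int (lookup m (dvar i 0)))"
  using arg_cong[OF prestrict_compl[of "{v. 1 \<le> vdiag v}" m], of "pdeg twist"]
  unfolding pdeg_add pdeg_twist_torus by (rule sym)

text \<open>The exponents on diagonal 0 are known as an integer vector modulo
  \<open>(1,...,1)\<close>, and each class has exactly one representative with minimum 0.\<close>

lemma bij_sl_split:
  "bij_betw sl_split {m :: 'n::{finite,linorder} uvar \<Rightarrow>\<^sub>0 nat. lookup (dmult m) 0 = 0}
    (UNIV \<times> {e. keys e \<subseteq> {v. 1 \<le> vdiag v}})" (is "bij_betw _ ?M ?N")
proof -
  let ?P = "{v :: 'n uvar. 1 \<le> vdiag v}"
  \<comment> \<open>If two exponent vectors on diagonal 0 differ by a constant \<open>c\<close>, an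
    entry 0 of the first forces \<open>c \<le> 0\<close>. Used in both orders this gives
    \<open>c = 0\<close>.\<close>
  have le: "c \<le> 0" if "m \<in> ?M" "\<And>i. int (lookup m (dvar i 0)) - int (lookup m' (dvar i 0)) = c"
    for c m m'
  proof -
    obtain i where "lookup m (dvar i 0) = 0"
      using dmult_attained[of m 0] \<open>m \<in> ?M\<close> by auto
    then show ?thesis using that(2)[of i] by simp
  qed
  have "inj_on sl_split ?M"
  proof (rule inj_onI, rule poly_mapping_eqI)
    fix m m' v assume m: "m \<in> ?M" "m' \<in> ?M" and eq: "sl_split m = sl_split m'"
    then have "pdeg twist m = pdeg twist m'" and P: "prestrict ?P m = prestrict ?P m'"
      by (simp_all add: sl_split_def)
    then have "wbar (\<chi> i. int (lookup m (dvar i 0))) = wbar (\<chi> i. int (lookup m' (dvar i 0)))"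
      unfolding pdeg_twist_split[of m] pdeg_twist_split[of m'] P by simp
    then obtain c where "(\<chi> i. int (lookup m (dvar i 0))) - (\<chi> i. int (lookup m' (dvar i 0))) = c *s 1"
      unfolding wbar_eq_iff by blast
    then have c: "int (lookup m (dvar i 0)) - int (lookup m' (dvar i 0)) = c" for i
      by (simp add: vec_eq_iff)
    then have "int (lookup m' (dvar i 0)) - int (lookup m (dvar i 0)) = - c" for i
      by (metis minus_diff_eq)
    from le[OF m(1) c] le[OF m(2) this] have "c = 0" by simp
    show "lookup m v = lookup m' v"
    proof (cases "1 \<le> vdiag v")
      case True
      then have "lookup (prestrict ?P m) v = lookup m v" "lookup (prestrict ?P m') v = lookup m' v"
        by (simp_all add: lookup_prestrict)
      then show ?thesis using eq by (simp add: sl_split_def)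
    next
      case False
      then have "v = dvar (vrow v) 0" by (intro dvar_unique) simp
      then show ?thesis using c[of "vrow v"] \<open>c = 0\<close> by simp
    qed
  qed
  moreover have "sl_split ` ?M = ?N"
  proof (intro equalityI subsetI)
    fix p assume "p \<in> ?N"
    then obtain \<gamma> e where p: "p = (\<gamma>, e)" and e: "keys e \<subseteq> ?P" by auto
    \<comment> \<open>\<open>f\<close> lifts the weight that diagonal 0 has to supply besides the
      twist of \<open>e\<close>. Subtracting its minimum \<open>a\<close> does not change the class
      and gives nonnegative exponents with minimum 0.\<close>
    obtain f where f: "wbar f = \<gamma> - pdeg twist e" using wbar_surj by blast
    define a where "a = Min (range (($) f))"
    have a_le: "a \<le> f $ i" for i unfolding a_def by (rule Min_le) auto
    have "a \<in> range (($) f)" unfolding a_def by (rule Min_in) auto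
    then obtain i0 where i0: "a = f $ i0" by auto
    define m where "m = e + (\<Sum>i\<in>UNIV. single (dvar i 0) (nat (f $ i - a)))"
    have e0: "lookup e v = 0" if "vdiag v = 0" for v
      using e that by (auto simp: in_keys_iff)
    have look0: "lookup (\<Sum>i\<in>UNIV. single (dvar i 0) (nat (f $ i - a))) (dvar j 0) = nat (f $ j - a)" for j
      by (simp add: lookup_sum lookup_single when_def)
    have lookP: "lookup (\<Sum>i\<in>UNIV. single (dvar i 0) (nat (f $ i - a))) v = 0" if "1 \<le> vdiag v" for v
      using that by (auto simp: lookup_sum lookup_single when_def intro!: sum.neutral)
    have m0: "lookup m (dvar i 0) = nat (f $ i - a)" for i
      by (simp add: m_def lookup_add e0 look0)
    have "lookup (dmult m) 0 = 0"
      by (rule dmult_eqI[of _ _ _ i0]) (simp_all add: m0 i0)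
    moreover have mP: "prestrict ?P m = e"
    proof (rule poly_mapping_eqI)
      fix v show "lookup (prestrict ?P m) v = lookup e v"
        using lookP[of v] e0[of v] by (auto simp: lookup_prestrict m_def lookup_add)
    qed
    moreover have "pdeg twist m = \<gamma>"
    proof -
      have "(\<chi> i. int (lookup m (dvar i 0))) - f = (- a) *s 1"
        using a_le by (simp add: vec_eq_iff m0)
      then have "wbar (\<chi> i. int (lookup m (dvar i 0))) = wbar f" unfolding wbar_eq_iff by blast
      then show ?thesis using pdeg_twist_split[of m] unfolding mP f by simp
    qed
    ultimately show "p \<in> sl_split ` ?M"
      by (intro image_eqI[of _ _ m]) (simp_all add: sl_split_def p)
  qed (auto simp: sl_split_def keys_prestrict)
  ultimately show ?thesis by (simp add: bij_betw_def)
qed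

text \<open>Among all monomials an \<open>sl\<close>-degree can have infinitely many, as
  \<open>dmon 0\<close> has degree 0. Standard monomials have minimum 0 on that diagonal, so
  \<open>sl_split\<close> is injective on them, and \<open>slh\<close> bounds the part on the
  positive diagonals.\<close>

lemma finite_std_sl: "finite {m. std m \<and> pdeg slw m = d}"
proof -
  let ?P = "{v :: 'a uvar. 1 \<le> vdiag v}"
  let ?S = "{m :: 'a uvar \<Rightarrow>\<^sub>0 nat. std m \<and> pdeg slw m = d}"
  have sub: "?S \<subseteq> {m. lookup (dmult m) 0 = 0}" by (auto simp: std_def)
  have "inj_on sl_split ?S"
    using bij_sl_split sub by (auto simp: bij_betw_def intro: inj_on_subset)
  moreover have "sl_split ` ?S \<subseteq> {p \<in> UNIV \<times> {e. keys e \<subseteq> ?P}. diagw (fst p) + pdeg tw (snd p) + 0 = d}"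
    using pdeg_sl_split by (auto simp: sl_split_def keys_prestrict)
  moreover have "finite {p \<in> UNIV \<times> {e. keys e \<subseteq> ?P}. diagw (fst p) + pdeg tw (snd p) + 0 = d}"
    by (rule finite_pairs[OF proper_wt_tw[OF order_refl] _ finite_diagw]) simp
  ultimately show ?thesis by (rule inj_on_finite)
qed

text \<open>Multiplication by powers of \<open>dmon s\<close> with \<open>s > 0\<close> lifts the
  condition of being standard on the positive diagonals and keeps it on diagonal 0.\<close>

lemma bij_std_mult:
  "bij_betw (\<lambda>p. fst p + pdeg dmon (snd p)) ({m. std m} \<times> {a. keys a \<subseteq> {1..}}) {m. lookup (dmult m) 0 = 0}"
proof (rule bij_betw_byWitness[where f' = "\<lambda>m. (stdpart m, dmult m)"])
  have 0: "lookup a 0 = 0" if "keys a \<subseteq> {1..}" for a :: "nat \<Rightarrow>\<^sub>0 nat"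
    using that by (auto simp: in_keys_iff)
  show "(\<lambda>p. fst p + pdeg dmon (snd p)) ` ({m. std m} \<times> {a. keys a \<subseteq> {1..}}) \<subseteq> {m. lookup (dmult m) 0 = 0}"
    by (auto simp: dmult_add_pdeg_dmon std_def 0)
  show "(\<lambda>m. (stdpart m, dmult m)) ` {m. lookup (dmult m) 0 = 0} \<subseteq> {m. std m} \<times> {a. keys a \<subseteq> {1..}}"
    by (auto simp: in_keys_iff Suc_le_eq) (metis less_irrefl neq0_conv)
qed (auto simp: stdpart_decomp stdpart_add_pdeg_dmon dmult_add_pdeg_dmon stdpart_std std_def)

section \<open>The torus variables at the position of rank 0\<close>

definition torus_var :: "nat \<Rightarrow> 'n::{finite,linorder} uvar"
  where "torus_var k = Abs_uvar (unrk 0, unrk 0, k)"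

lemma torus_var_simps [simp]:
  "vrow (torus_var k) = unrk 0" "vcol (torus_var k) = unrk 0" "vlev (torus_var k) = k"
  by (simp_all add: torus_var_def)

lemma torus_var_eq_iff [simp]: "torus_var k = torus_var l \<longleftrightarrow> k = l"
  by (metis torus_var_simps(3))

lemma torus_var_cases: "vrow v = vcol v \<Longrightarrow> rk (vrow v) = 0 \<Longrightarrow> v = torus_var (vlev v)"
  by (intro uvar_eqI) (simp_all, metis unrk_rk, metis unrk_rk)

text \<open>For \<open>tw\<close> this has the degree that \<open>pdeg dmon a\<close> has for
  \<open>slw\<close>, so that the two can be exchanged.\<close>

definition torus_emb :: "(nat \<Rightarrow>\<^sub>0 nat) \<Rightarrow> 'n::{finite,linorder} uvar \<Rightarrow>\<^sub>0 nat"
  where "torus_emb a = pdeg (\<lambda>k. single (torus_var k) 1) a"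

lemma lookup_torus_emb [simp]: "lookup (torus_emb a) (torus_var k) = lookup a k"
proof -
  have "lookup (torus_emb a) (torus_var k) = (\<Sum>l\<in>keys a. if l = k then lookup a l else 0)"
    unfolding torus_emb_def pdeg_def lookup_sum
    by (rule sum.cong) (auto simp: lookup_nsmul lookup_single when_def)
  then show ?thesis by (cases "lookup a k = 0") (simp_all add: in_keys_iff)
qed

lemma lookup_torus_emb_other: "v \<notin> range torus_var \<Longrightarrow> lookup (torus_emb a) v = 0"
  unfolding torus_emb_def pdeg_def lookup_sum
  by (rule sum.neutral) (auto simp: lookup_nsmul lookup_single when_def)

lemma pdeg_tw_torus_emb:
  "pdeg tw (torus_emb a :: 'n::{finite,linorder} uvar \<Rightarrow>\<^sub>0 nat) = (0, 0, pdeg (\<lambda>k. k) a)"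
proof -
  have "(0, 0, pdeg (\<lambda>k. k) a) = pdeg (\<lambda>k. (0 :: 'n wlat, 0 :: 'n wlat, k)) a"
    by (rule additive_pdeg[of "\<lambda>k. (0, 0, k)"]) (simp_all add: zero_prod_def)
  moreover have "pdeg tw (torus_emb a :: 'n uvar \<Rightarrow>\<^sub>0 nat) =
      pdeg (\<lambda>k. pdeg tw (single (torus_var k :: 'n uvar) 1)) a"
    unfolding torus_emb_def by (rule additive_pdeg) (simp_all add: pdeg_add)
  ultimately show ?thesis by (simp add: tw_def)
qed

text \<open>The variables on the positive diagonals are those of \<open>sl_vars\<close> and the
  torus variables of positive level, and the second component splits accordingly.\<close>

lemma bij_torus_emb:
  "bij_betw (\<lambda>p. (fst (fst p), snd (fst p) + torus_emb (snd p)))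
    ((UNIV \<times> {e. keys e \<subseteq> (sl_vars :: 'n::{finite,linorder} uvar set)}) \<times> {a. keys a \<subseteq> {1..}})
    (UNIV \<times> {e. keys e \<subseteq> {v. 1 \<le> vdiag v}})" (is "bij_betw ?f ?A ?B")
proof (rule bij_betw_byWitness[where
      f' = "\<lambda>q. ((fst q, prestrict sl_vars (snd q)), Poly_Mapping.map_key torus_var (snd q))"])
  have inj: "inj (torus_var :: nat \<Rightarrow> 'n uvar)" by (simp add: inj_def)
  note look = map_key.rep_eq[OF inj]
  have notin: "(torus_var k :: 'n uvar) \<notin> sl_vars" for k by (simp add: sl_vars_def)
  have off: "lookup (torus_emb a) v = 0" if "v \<in> sl_vars" for a and v :: "'n uvar"
    using that notin by (intro lookup_torus_emb_other) auto
  show "\<forall>p\<in>?A. ((fst (?f p), prestrict sl_vars (snd (?f p))), Poly_Mapping.map_key torus_var (snd (?f p))) = p"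
  proof
    fix p assume p: "p \<in> ?A"
    have e0: "lookup (snd (fst p)) v = 0" if "v \<notin> sl_vars" for v
      using p that by (auto simp: in_keys_iff)
    have "prestrict sl_vars (snd (fst p) + torus_emb (snd p)) = snd (fst p)"
    proof (rule poly_mapping_eqI)
      fix v show "lookup (prestrict sl_vars (snd (fst p) + torus_emb (snd p))) v = lookup (snd (fst p)) v"
        using e0[of v] by (simp add: lookup_prestrict lookup_add off)
    qed
    moreover have "Poly_Mapping.map_key torus_var (snd (fst p) + torus_emb (snd p)) = snd p"
      by (rule poly_mapping_eqI) (simp add: look lookup_add e0[OF notin])
    ultimately show "((fst (?f p), prestrict sl_vars (snd (?f p))),
        Poly_Mapping.map_key torus_var (snd (?f p))) = p"
      by (simp add: prod_eq_iff)
  qed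
  show "\<forall>q\<in>?B. ?f ((fst q, prestrict sl_vars (snd q)), Poly_Mapping.map_key torus_var (snd q)) = q"
  proof
    fix q :: "'a \<times> ('n uvar \<Rightarrow>\<^sub>0 nat)" assume q: "q \<in> ?B"
    have "prestrict sl_vars (snd q) + torus_emb (Poly_Mapping.map_key torus_var (snd q)) = snd q"
    proof (rule poly_mapping_eqI)
      fix v :: "'n uvar"
      consider "v \<in> sl_vars" | "vdiag v = 0" | k where "v = torus_var k"
        using torus_var_cases[of v] by (auto simp: sl_vars_def Suc_le_eq)
      then show "lookup (prestrict sl_vars (snd q) + torus_emb (Poly_Mapping.map_key torus_var (snd q))) v =
          lookup (snd q) v"
      proof cases
        case 2
        then have "lookup (snd q) v = 0" using q by (auto simp: in_keys_iff)
        moreover have "lookup (torus_emb (Poly_Mapping.map_key torus_var (snd q))) v = 0"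
        proof (cases "v \<in> range torus_var")
          case True
          then show ?thesis using \<open>lookup (snd q) v = 0\<close> by (auto simp: look)
        qed (rule lookup_torus_emb_other)
        ultimately show ?thesis by (simp add: lookup_add lookup_prestrict)
      qed (simp_all add: lookup_add lookup_prestrict off look notin)
    qed
    then show "?f ((fst q, prestrict sl_vars (snd q)), Poly_Mapping.map_key torus_var (snd q)) = q"
      by (simp add: prod_eq_iff)
  qed
  show "?f ` ?A \<subseteq> ?B"
  proof (rule image_subsetI)
    fix p assume p: "p \<in> ?A"
    have "vdiag v \<noteq> 0" if "lookup (snd (fst p)) v + lookup (torus_emb (snd p)) v \<noteq> 0" for v :: "'n uvar"
    proof
      assume v: "vdiag v = 0"
      then have "v \<notin> sl_vars" by (simp add: sl_vars_def)
      then have "lookup (snd (fst p)) v = 0" using p by (auto simp: in_keys_iff)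
      moreover have "lookup (torus_emb (snd p)) v = 0"
      proof (cases "v \<in> range torus_var")
        case True
        then have "v = torus_var 0" using v by (auto simp: vdiag_eq_0_iff)
        moreover have "lookup (snd p) 0 = 0" using p by (auto simp: in_keys_iff)
        ultimately show ?thesis by simp
      qed (rule lookup_torus_emb_other)
      ultimately show False using that by simp
    qed
    then show "?f p \<in> ?B" by (auto simp: in_keys_iff lookup_add Suc_le_eq)
  qed
  show "(\<lambda>q. ((fst q, prestrict sl_vars (snd q)), Poly_Mapping.map_key torus_var (snd q))) ` ?B \<subseteq> ?A"
  proof (rule image_subsetI)
    fix q :: "'a \<times> ('n uvar \<Rightarrow>\<^sub>0 nat)" assume q: "q \<in> ?B"
    have "k \<noteq> 0" if "lookup (snd q) (torus_var k) \<noteq> 0" for k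
    proof -
      have "(torus_var k :: 'n uvar) \<in> keys (snd q)" using that by (simp add: in_keys_iff)
      then have "1 \<le> vdiag (torus_var k :: 'n uvar)" using q by auto
      then show ?thesis by (simp add: Suc_le_eq vdiag_pos_iff)
    qed
    then show "((fst q, prestrict sl_vars (snd q)), Poly_Mapping.map_key torus_var (snd q)) \<in> ?A"
      by (auto simp: keys_prestrict in_keys_iff look Suc_le_eq)
  qed
qed

text \<open>Both sides are multiplied by the inverse of \<open>(q;q)\<close> infinite, counted by
  \<open>?Q\<close>. On the left \<open>?Q\<close> supplies the powers of \<open>dmon s\<close> with
  \<open>s > 0\<close>, on the right the missing torus variables; both products count the monomials
  with minimum 0 on diagonal 0. Then \<open>count_cancel\<close> applies.\<close>

lemma std_count_sl: "int (card {m. std m \<and> pdeg slw m = d}) = sl_fraction d"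
proof -
  let ?A = "{m :: 'a uvar \<Rightarrow>\<^sub>0 nat. std m}" and ?B = "UNIV \<times> {e. keys e \<subseteq> (sl_vars :: 'a uvar set)}"
  let ?Q = "{a :: nat \<Rightarrow>\<^sub>0 nat. keys a \<subseteq> {1..}}"
  let ?dB = "\<lambda>p. diagw (fst p) + pdeg tw (snd p)" and ?dQ = "pdeg (\<lambda>k :: nat. k)"
  have finQ: "finite {a. keys a \<subseteq> {1..} \<and> ?dQ a \<le> k}" for k
  proof (rule finite_pdeg_le)
    show "finite {v \<in> {1..}. v \<le> B}" for B :: nat
      by (rule finite_subset[of _ "{..B}"]) auto
  qed simp
  have "card {m\<in>?A. pdeg slw m = d} = card {p\<in>?B. ?dB p = d}"
  proof (rule count_cancel[where Q = ?Q and dQ = ?dQ])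
    show "finite {m\<in>?A. pdeg slw m = d}" for d using finite_std_sl[of d] by simp
    have "finite {p\<in>?B. ?dB p + 0 = d}" for d
      by (rule finite_pairs[OF proper_wt_tw _ finite_diagw]) (auto simp: sl_vars_def)
    then show "finite {p\<in>?B. ?dB p = d}" for d by simp
    show "finite {a\<in>?Q. ?dQ a = k}" for k
      by (rule finite_subset[OF _ finQ[of k]]) auto
    have "a = 0" if "keys a \<subseteq> {1..}" "?dQ a = 0" for a
    proof (rule ccontr)
      assume "a \<noteq> 0"
      then obtain k where k: "k \<in> keys a" by (metis keys_eq_empty all_not_in_conv)
      then have "k \<in> {1..}" "lookup a k \<noteq> 0" using that(1) by (blast, simp add: in_keys_iff)
      then show False using lookup_le_pdeg[OF k, of "\<lambda>k. k"] that(2) by simp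
    qed
    then have "{a\<in>?Q. ?dQ a = 0} = {0}" by auto
    then show "card {a\<in>?Q. ?dQ a = 0} = 1" by simp
    fix d
    have "(0, 0, ?dQ a) = pdeg (\<lambda>k. (0 :: 'a wlat, 0 :: 'a wlat, k)) a" for a
      by (rule additive_pdeg[of "\<lambda>k. (0, 0, k)"]) (simp_all add: zero_prod_def)
    then have slw: "pdeg slw (pdeg dmon a :: 'a uvar \<Rightarrow>\<^sub>0 nat) = (0, 0, ?dQ a)" for a
      using additive_pdeg[of "pdeg slw :: ('a uvar \<Rightarrow>\<^sub>0 nat) \<Rightarrow> _" dmon a] by (simp add: pdeg_add pdeg_slw_dmon)
    have "card {p\<in>?A \<times> ?Q. pdeg slw (fst p) + (0, 0, ?dQ (snd p)) = d} =
        card {m \<in> {m. lookup (dmult m) 0 = 0}. pdeg slw m = d}"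
      by (rule card_fibre_reindex[OF bij_std_mult]) (simp add: pdeg_add slw)
    also have "\<dots> = card {p \<in> UNIV \<times> {e. keys e \<subseteq> {v :: 'a uvar. 1 \<le> vdiag v}}. ?dB p = d}"
      by (rule card_fibre_reindex[OF bij_sl_split]) (rule pdeg_sl_split)
    also have "\<dots> = card {p\<in>?B \<times> ?Q. ?dB (fst p) + (0, 0, ?dQ (snd p)) = d}"
      by (rule card_fibre_reindex[OF bij_torus_emb, symmetric])
        (simp add: pdeg_add pdeg_tw_torus_emb add.assoc)
    finally show "card {p\<in>?A \<times> ?Q. pdeg slw (fst p) + (0, 0, ?dQ (snd p)) = d} =
        card {p\<in>?B \<times> ?Q. ?dB (fst p) + (0, 0, ?dQ (snd p)) = d}" .
  qed
  then show ?thesis by (simp add: sl_fraction_count wcount_def)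
qed

subsection \<open>From \<open>gl\<close> to \<open>sl\<close>\<close>

lemma gl_fraction_card: "gl_fraction d = int (card {m. std m \<and> pdeg glw m = d})"
  by (simp add: gl_fraction_count wcount_def)

lemma gl_fraction_nonzero: "gl_fraction d \<noteq> 0 \<longleftrightarrow> (\<exists>m. std m \<and> pdeg glw m = d)"
proof -
  have "finite {m :: 'a uvar \<Rightarrow>\<^sub>0 nat. std m \<and> pdeg glw m = d}"
    by (rule finite_subset[OF _ finite_pdeg_eq[OF proper_wt_glw[of UNIV], of d]]) auto
  then show ?thesis by (auto simp: gl_fraction_card)
qed

text \<open>All the shifts have the same \<open>sl\<close>-degree, and only finitely many standard
  monomials have that degree.\<close>

lemma to_sl_defined_gl_fraction:
  "to_sl_defined (gl_fraction :: 'n::{finite,linorder} zvec \<times> 'n zvec \<times> nat \<Rightarrow> int)"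
  unfolding to_sl_defined_def
proof (intro conjI allI impI)
  fix l m :: "'n zvec" and k i assume "gl_fraction (l, m, k) \<noteq> 0"
  then obtain e :: "'n uvar \<Rightarrow>\<^sub>0 nat" where "pdeg glw e = (l, m, k)"
    unfolding gl_fraction_nonzero by blast
  then have "l = (\<Sum>v\<in>keys e. int (lookup e v) *s axis (vrow v) 1)"
    "m = (\<Sum>v\<in>keys e. int (lookup e v) *s axis (vcol v) 1)"
    by (simp_all add: pdeg_glw)
  then show "0 \<le> l $ i" "0 \<le> m $ i"
    by (auto simp: axis_def intro!: sum_nonneg)
next
  fix l m :: "'n zvec" and k
  let ?S = "{e :: 'n uvar \<Rightarrow>\<^sub>0 nat. std e \<and> pdeg slw e = (wbar l, wbar m, k)}"
  let ?f = "\<lambda>(a, b). (l + a *s 1, m + b *s 1, k)"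
  have "?f ` {(a, b). gl_fraction (l + a *s 1, m + b *s 1, k) \<noteq> 0} \<subseteq> pdeg glw ` ?S"
  proof (rule image_subsetI)
    fix p assume "p \<in> {(a, b). gl_fraction (l + a *s 1, m + b *s 1, k) \<noteq> 0}"
    then obtain a b where p: "p = (a, b)" "gl_fraction (l + a *s 1, m + b *s 1, k) \<noteq> 0" by auto
    then obtain e :: "'n uvar \<Rightarrow>\<^sub>0 nat" where e: "std e" "pdeg glw e = ?f p"
      unfolding gl_fraction_nonzero by auto
    have "wbar (x + c *s 1) = wbar x" for x :: "'n zvec" and c
      unfolding wbar_eq_iff by (rule exI[of _ c]) simp
    then have "pdeg slw e = (wbar l, wbar m, k)"
      by (simp add: sl_of_gl_pdeg[symmetric] e p(1) sl_of_gl_def)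
    then show "?f p \<in> pdeg glw ` ?S" using e by (intro image_eqI[of _ _ e]) auto
  qed
  moreover have "inj ?f" by (auto simp: inj_def vec_eq_iff)
  moreover have "finite (pdeg glw ` ?S)" using finite_std_sl by (rule finite_imageI)
  ultimately show "finite {(a, b). gl_fraction (l + a *s 1, m + b *s 1, k) \<noteq> 0}"
    by (meson inj_on_finite inj_on_subset top_greatest)
qed

text \<open>The standard monomials of one \<open>sl\<close>-degree are sorted by their
  \<open>gl\<close>-degree.\<close>

lemma to_sl_gl_fraction: "to_sl gl_fraction d = int (card {m. std m \<and> pdeg slw m = d})"
proof -
  obtain \<alpha> \<beta> k where d: "d = (\<alpha>, \<beta>, k)" by (cases d)
  let ?S = "{e :: 'a uvar \<Rightarrow>\<^sub>0 nat. std e \<and> pdeg slw e = d}"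
  let ?L = "{(l, m). wbar l = \<alpha> \<and> wbar m = \<beta> \<and> gl_fraction (l, m, k) \<noteq> 0}"
  let ?g = "\<lambda>e :: 'a uvar \<Rightarrow>\<^sub>0 nat. (fst (pdeg glw e), fst (snd (pdeg glw e)))"
  have S: "e \<in> ?S \<longleftrightarrow> std e \<and> (\<exists>l m. pdeg glw e = (l, m, k) \<and> wbar l = \<alpha> \<and> wbar m = \<beta>)" for e
    by (cases "pdeg glw e") (auto simp: sl_of_gl_pdeg[symmetric] d sl_of_gl_def)
  have L: "?L = ?g ` ?S"
  proof (intro equalityI subsetI)
    fix p assume "p \<in> ?L"
    then obtain l m where p: "p = (l, m)" "wbar l = \<alpha>" "wbar m = \<beta>" "gl_fraction (l, m, k) \<noteq> 0" by auto
    then obtain e :: "'a uvar \<Rightarrow>\<^sub>0 nat" where "std e" "pdeg glw e = (l, m, k)"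
      unfolding gl_fraction_nonzero by auto
    with p show "p \<in> ?g ` ?S" unfolding image_iff Bex_def S by (intro exI[of _ e]) auto
  next
    fix p assume "p \<in> ?g ` ?S"
    then obtain e where e: "e \<in> ?S" "p = ?g e" by blast
    then obtain l m where "std e" "pdeg glw e = (l, m, k)" "wbar l = \<alpha>" "wbar m = \<beta>"
      unfolding S by blast
    then show "p \<in> ?L" using e(2) by (auto simp: gl_fraction_nonzero)
  qed
  have fin: "finite ?S" by (rule finite_std_sl)
  have "int (card ?S) = (\<Sum>e\<in>?S. 1)" by simp
  also have "\<dots> = (\<Sum>p\<in>?L. \<Sum>e | e \<in> ?S \<and> ?g e = p. 1)"
    unfolding L by (rule sum.group[OF fin, symmetric]) (use fin in auto)
  also have "\<dots> = (\<Sum>p\<in>?L. gl_fraction (fst p, snd p, k))"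
  proof (rule sum.cong[OF refl])
    fix p assume "p \<in> ?L"
    then have "{e. e \<in> ?S \<and> ?g e = p} = {e. std e \<and> pdeg glw e = (fst p, snd p, k)}"
      unfolding S by (auto simp: prod_eq_iff)
    then show "(\<Sum>e | e \<in> ?S \<and> ?g e = p. 1) = gl_fraction (fst p, snd p, k)"
      by (simp add: gl_fraction_card)
  qed
  finally show ?thesis by (simp add: to_sl_def d split_def)
qed

section \<open>Leading terms\<close>

definition dwt :: "('n::{finite,linorder} uvar \<Rightarrow>\<^sub>0 nat) \<Rightarrow> nat"
  where "dwt = pdeg (\<lambda>v. (vdiag v)\<^sup>2)"

lemma dwt_add: "dwt (m + m') = dwt m + dwt m'"
  by (simp add: dwt_def pdeg_add)

text \<open>Leading monomials have minimal weight, so rewriting increases \<open>dwt\<close>.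
  Keeping the \<open>gl\<close>-degree fixed makes it end, since each \<open>gl\<close>-degree has
  finitely many monomials.\<close>

definition higher :: "('n::{finite,linorder} uvar \<Rightarrow>\<^sub>0 nat) \<Rightarrow> ('n, 'k::field) mpol \<Rightarrow> bool"
  where "higher M p \<longleftrightarrow> (\<forall>m\<in>keys p. pdeg glw m = pdeg glw M \<and> dwt M < dwt m)"

definition lead :: "('n, 'k::field) mpol \<Rightarrow> ('n::{finite,linorder} uvar \<Rightarrow>\<^sub>0 nat) \<Rightarrow> bool"
  where "lead p M \<longleftrightarrow> higher M (p - single M 1)"

lemma higher_add: "higher M p \<Longrightarrow> higher M q \<Longrightarrow> higher M (p + q)"
  using keys_add[of p q] unfolding higher_def by blast

lemma higher_mult_single: "higher M p \<Longrightarrow> higher (M + N) (p * single N 1)"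
  using keys_mult[of p "single N 1"] unfolding higher_def
  by (fastforce simp: pdeg_add dwt_add)

lemma higher_mult: "higher M p \<Longrightarrow> higher N q \<Longrightarrow> higher (M + N) (p * q)"
  using keys_mult[of p q] unfolding higher_def
  by (fastforce simp: pdeg_add dwt_add)

lemma lead_single: "lead (single M 1) M"
  by (simp add: lead_def higher_def)

lemma lead_mult:
  assumes "lead p M" "lead q N"
  shows "lead (p * q) (M + N)"
proof -
  let ?p = "p - single M 1" and ?q = "q - single N 1"
  have "single (M + N) 1 = (single M 1 * single N 1 :: ('a, 'b) mpol)"
    by (simp add: mult_single)
  then have "p * q - single (M + N) 1 = ?p * single N 1 + ?q * single M 1 + ?p * ?q"
    by (simp add: algebra_simps)
  then show ?thesis
    using assms higher_mult_single[of M ?p N] higher_mult_single[of N ?q M] higher_mult[of M ?p N ?q]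
    unfolding lead_def by (metis add.commute higher_add)
qed

lemma lead_power: "lead p M \<Longrightarrow> lead (p ^ r) (nsmul r M)"
proof (induction r)
  case 0
  then show ?case using lead_single[of 0] by simp
next
  case (Suc r)
  then show ?case using lead_mult[of "p ^ r" _ p M] by (simp add: nsmul_Suc mult.commute)
qed

lemma lead_prod: "(\<And>i. i \<in> I \<Longrightarrow> lead (f i) (m i)) \<Longrightarrow> lead (prod f I) (sum m I)"
proof (induction I rule: infinite_finite_induct)
  case (insert i I)
  then show ?case by (simp add: lead_mult)
qed (use lead_single[of 0] in simp_all)

subsection \<open>The coefficients of the determinant\<close>

text \<open>The values outside \<open>I\<close> are fixed to 0, so that a composition is determined
  by its values on \<open>I\<close> and the set is finite for finite \<open>I\<close>.\<close>

definition compositions :: "'i set \<Rightarrow> nat \<Rightarrow> ('i \<Rightarrow> nat) set"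
  where "compositions I N = {\<kappa>. (\<forall>i. i \<notin> I \<longrightarrow> \<kappa> i = 0) \<and> sum \<kappa> I = N}"

lemma finite_compositions:
  assumes "finite I"
  shows "finite (compositions I N)"
proof (rule finite_subset)
  show "compositions I N \<subseteq> {\<kappa>. \<forall>i. (i \<in> I \<longrightarrow> \<kappa> i \<in> {..N}) \<and> (i \<notin> I \<longrightarrow> \<kappa> i = 0)}"
    using assms member_le_sum[of _ I] by (fastforce simp: compositions_def)
  show "finite {\<kappa>. \<forall>i. (i \<in> I \<longrightarrow> \<kappa> i \<in> {..N}) \<and> (i \<notin> I \<longrightarrow> \<kappa> i = 0)}"
    by (rule finite_set_of_finite_funs) (simp_all add: assms)
qed

lemma fps_nth_prod:
  fixes F :: "'i \<Rightarrow> 'a::comm_ring_1 fps"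
  assumes "finite I"
  shows "fps_nth (prod F I) N = (\<Sum>\<kappa>\<in>compositions I N. \<Prod>i\<in>I. fps_nth (F i) (\<kappa> i))"
  using assms
proof (induction I arbitrary: N rule: finite_induct)
  case empty
  have "compositions ({} :: 'i set) N = (if N = 0 then {\<lambda>_. 0} else {})"
    by (auto simp: compositions_def)
  then show ?case by (simp add: fps_one_nth)
next
  case (insert i I)
  have "fps_nth (prod F (insert i I)) N =
      (\<Sum>j\<le>N. \<Sum>\<kappa>\<in>compositions I (N - j). fps_nth (F i) j * (\<Prod>l\<in>I. fps_nth (F l) (\<kappa> l)))"
    using insert by (simp add: fps_mult_nth sum_distrib_left atLeast0AtMost)
  also have "\<dots> = (\<Sum>(j, \<kappa>)\<in>Sigma {..N} (\<lambda>j. compositions I (N - j)).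
      fps_nth (F i) j * (\<Prod>l\<in>I. fps_nth (F l) (\<kappa> l)))"
    by (rule sum.Sigma) (simp_all add: finite_compositions insert)
  also have "\<dots> = (\<Sum>\<kappa>\<in>compositions (insert i I) N. \<Prod>l\<in>insert i I. fps_nth (F l) (\<kappa> l))"
  proof (rule sum.reindex_bij_witness[of _ "\<lambda>\<kappa>. (\<kappa> i, \<kappa>(i := 0))" "\<lambda>(j, \<kappa>). \<kappa>(i := j)"])
    fix p assume "p \<in> Sigma {..N} (\<lambda>j. compositions I (N - j))"
    then obtain j \<kappa> where p: "p = (j, \<kappa>)" "j \<le> N" "\<kappa> \<in> compositions I (N - j)" by auto
    then have "\<kappa> i = 0" using insert by (simp add: compositions_def)
    then show "(\<lambda>\<kappa>. (\<kappa> i, \<kappa>(i := 0))) ((\<lambda>(j, \<kappa>). \<kappa>(i := j)) p) = p" by (simp add: p(1) fun_upd_idem)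
    have "(\<Sum>l\<in>I. (\<kappa>(i := j)) l) = sum \<kappa> I" using insert by (intro sum.cong) auto
    then show "(\<lambda>(j, \<kappa>). \<kappa>(i := j)) p \<in> compositions (insert i I) N"
      using p insert by (simp add: compositions_def)
    have "(\<Prod>l\<in>I. fps_nth (F l) ((\<kappa>(i := j)) l)) = (\<Prod>l\<in>I. fps_nth (F l) (\<kappa> l))"
      using insert by (intro prod.cong) auto
    then show "(\<Prod>l\<in>insert i I. fps_nth (F l) ((\<lambda>(j, \<kappa>). \<kappa>(i := j)) p l)) =
        (case p of (j, \<kappa>) \<Rightarrow> fps_nth (F i) j * (\<Prod>l\<in>I. fps_nth (F l) (\<kappa> l)))"
      using insert by (simp add: p(1))
  next
    fix \<kappa> assume \<kappa>: "\<kappa> \<in> compositions (insert i I) N"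
    have "sum (\<kappa>(i := 0)) I = sum \<kappa> I" using insert by (intro sum.cong) auto
    then show "(\<kappa> i, \<kappa>(i := 0)) \<in> Sigma {..N} (\<lambda>j. compositions I (N - j))"
      using \<kappa> insert by (auto simp: compositions_def)
  qed auto
  finally show ?case .
qed

definition valid :: "('n::{finite,linorder} \<Rightarrow> 'n) \<Rightarrow> ('n \<Rightarrow> nat) \<Rightarrow> bool"
  where "valid p \<kappa> \<longleftrightarrow> (\<forall>i. i \<le> p i \<or> 1 \<le> \<kappa> i)"

text \<open>Meaningful for \<open>valid p \<kappa>\<close> only. For other pairs
  \<open>Abs_uvar\<close> is applied outside its domain; the corresponding term of the determinant
  is 0 by \<open>prod_mpol_u\<close>.\<close>

definition pmon :: "('n::{finite,linorder} \<Rightarrow> 'n) \<Rightarrow> ('n \<Rightarrow> nat) \<Rightarrow> 'n uvar \<Rightarrow>\<^sub>0 nat"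
  where "pmon p \<kappa> = (\<Sum>i\<in>UNIV. single (Abs_uvar (i, p i, \<kappa> i)) 1)"

lemma prod_single: "(\<Prod>i\<in>I. single (m i) (1 :: 'k::comm_semiring_1)) = single (\<Sum>i\<in>I. m i) 1"
  by (induction I rule: infinite_finite_induct) (simp_all add: mult_single)

lemma prod_mpol_u:
  "(\<Prod>i\<in>UNIV. mpol_u i (p i) (\<kappa> i) :: ('n::{finite,linorder}, 'k::field) mpol) =
    (if valid p \<kappa> then single (pmon p \<kappa>) 1 else 0)"
proof (cases "valid p \<kappa>")
  case True
  then have "(\<Prod>i\<in>UNIV. mpol_u i (p i) (\<kappa> i) :: ('n, 'k) mpol) =
      (\<Prod>i\<in>UNIV. single (single (Abs_uvar (i, p i, \<kappa> i)) 1) 1)"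
    by (intro prod.cong) (auto simp: mpol_u_def valid_def)
  then show ?thesis using True by (simp add: prod_single pmon_def)
next
  case False
  then obtain i where "\<not> (i \<le> p i \<or> 1 \<le> \<kappa> i)" unfolding valid_def by blast
  then have "mpol_u i (p i) (\<kappa> i) = (0 :: ('n, 'k) mpol)"
    by (simp add: mpol_u_def)
  then have "(\<Prod>i\<in>UNIV. mpol_u i (p i) (\<kappa> i) :: ('n, 'k) mpol) = 0"
    by (intro prod_zero) auto
  then show ?thesis using False by simp
qed

lemma fps_nth_det: "fps_nth (det u_matrix :: ('n::{finite,linorder}, 'k::field) mpol fps) N =
  (\<Sum>(p, \<kappa>)\<in>{p. p permutes UNIV} \<times> compositions UNIV N.
    of_int (sign p) * (if valid p \<kappa> then single (pmon p \<kappa>) 1 else 0))"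
proof -
  have "fps_nth (of_int c * F) N = of_int c * fps_nth F N" for c and F :: "('n, 'k) mpol fps"
    by (simp flip: fps_of_int)
  then have "fps_nth (det u_matrix :: ('n, 'k) mpol fps) N =
      (\<Sum>p | p permutes UNIV. of_int (sign p) *
        (\<Sum>\<kappa>\<in>compositions UNIV N. \<Prod>i\<in>UNIV. mpol_u i (p i) (\<kappa> i)))"
    by (simp add: det_def fps_sum_nth fps_nth_prod u_matrix_def)
  then show ?thesis
    by (simp add: prod_mpol_u sum_distrib_left sum.cartesian_product)
qed

lemma pdeg_pmon:
  assumes "valid p \<kappa>"
  shows "pdeg w (pmon p \<kappa>) = (\<Sum>i\<in>UNIV. w (Abs_uvar (i, p i, \<kappa> i)))"
  by (simp add: pmon_def pdeg_sum)

lemma pdeg_glw_pmon: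
  fixes p :: "'n::{finite,linorder} \<Rightarrow> 'n"
  assumes "valid p \<kappa>" "p permutes UNIV" "\<kappa> \<in> compositions UNIV N"
  shows "pdeg glw (pmon p \<kappa>) = pdeg glw (dmon N)"
proof -
  have "pdeg glw (pmon p \<kappa>) = (\<Sum>i\<in>UNIV. (axis i 1, axis (p i) 1, \<kappa> i))"
    unfolding pdeg_pmon[OF assms(1)]
    using assms(1) by (intro sum.cong) (auto simp: glw_def gl_xyq_def valid_def)
  also have "\<dots> = (\<Sum>i\<in>UNIV. axis i 1, \<Sum>i\<in>UNIV. axis (p i) 1, N)"
    using assms(3) by (simp add: sum_prod compositions_def)
  also have "(\<Sum>i\<in>UNIV. axis (p i) 1) = (\<Sum>i\<in>UNIV. axis i (1 :: int))"
    by (rule sum.reindex_bij_betw[OF permutes_bij[OF assms(2)]])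
  finally show ?thesis by (simp add: pdeg_glw_dmon)
qed

text \<open>The diagonals \<open>s\<^sub>i\<close> of a term sum to \<open>nN\<close>, so \<open>\<Sum> s\<^sub>i\<^sup>2 = nN\<^sup>2 + \<Sum> (s\<^sub>i - N)\<^sup>2\<close>.\<close>

lemma dwt_pmon:
  fixes p :: "'n::{finite,linorder} \<Rightarrow> 'n"
  assumes "valid p \<kappa>" "p permutes UNIV" "\<kappa> \<in> compositions UNIV N"
  shows "dwt (dmon N :: 'n uvar \<Rightarrow>\<^sub>0 nat) < dwt (pmon p \<kappa>) \<or>
    (\<forall>i. Abs_uvar (i, p i, \<kappa> i) = dvar i N)"
proof -
  let ?v = "\<lambda>i. Abs_uvar (i, p i, \<kappa> i)"
  let ?s = "\<lambda>i. int (vdiag (?v i))"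
  \<comment> \<open>The relation \<open>rk_row_plus_vdiag\<close> is summed over all rows. The ranks
    cancel because \<open>p\<close> is a permutation, so the diagonals sum to
    \<open>n * N\<close>.\<close>
  have "int (rk i) + ?s i = int CARD('n) * int (\<kappa> i) + int (rk (p i))" for i
    using arg_cong[OF rk_row_plus_vdiag[of "?v i"], of int] assms(1) by (simp add: valid_def)
  then have "(\<Sum>i\<in>UNIV. int (rk i) + ?s i) = (\<Sum>i\<in>UNIV. int CARD('n) * int (\<kappa> i) + int (rk (p i)))"
    by simp
  also have "\<dots> = int CARD('n) * int (\<Sum>i\<in>UNIV. \<kappa> i) + (\<Sum>i\<in>UNIV. int (rk (p i)))"
    by (simp add: sum.distrib sum_distrib_left)
  also have "(\<Sum>i\<in>UNIV. int (rk (p i))) = (\<Sum>i::'n\<in>UNIV. int (rk i))"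
    by (rule sum.reindex_bij_betw[OF permutes_bij[OF assms(2)], of "\<lambda>i. int (rk i)"])
  also have "(\<Sum>i\<in>UNIV. \<kappa> i) = N" using assms(3) by (simp add: compositions_def)
  finally have s: "(\<Sum>i\<in>UNIV. ?s i) = int CARD('n) * int N"
    by (simp add: sum.distrib)
  have "int (dwt (pmon p \<kappa>)) = (\<Sum>i\<in>UNIV. (?s i)\<^sup>2)"
    by (simp add: dwt_def pdeg_pmon[OF assms(1)])
  moreover have "int (dwt (dmon N :: 'n uvar \<Rightarrow>\<^sub>0 nat)) = int CARD('n) * (int N)\<^sup>2"
    by (simp add: dwt_def dmon_def pdeg_sum)
  moreover have "(\<Sum>i\<in>UNIV. (?s i - int N)\<^sup>2) =
      (\<Sum>i\<in>UNIV. (?s i)\<^sup>2) - 2 * int N * (\<Sum>i\<in>UNIV. ?s i) + int CARD('n) * (int N)\<^sup>2"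
    by (simp add: power2_diff sum.distrib sum_subtractf sum_distrib_left algebra_simps)
  ultimately have *: "int (dwt (pmon p \<kappa>)) =
      int (dwt (dmon N :: 'n uvar \<Rightarrow>\<^sub>0 nat)) + (\<Sum>i\<in>UNIV. (?s i - int N)\<^sup>2)"
    unfolding s by (simp add: power2_eq_square)
  show ?thesis
  proof (cases "\<forall>i. ?s i = int N")
    case True
    have "?v i = dvar i N" for i
    proof -
      have "vrow (?v i) = i" using assms(1) by (simp add: valid_def)
      moreover have "vdiag (?v i) = N" using True by simp
      ultimately show ?thesis using dvar_vrow_vdiag[of "?v i"] by simp
    qed
    then show ?thesis by blast
  next
    case False
    then obtain i where "?s i - int N \<noteq> 0" by auto
    then have "0 < (\<Sum>i\<in>UNIV. (?s i - int N)\<^sup>2)"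
      by (intro sum_pos2[of _ i]) auto
    then show ?thesis using * by simp
  qed
qed

text \<open>Together with \<open>shift_lev\<close> this is the term of the determinant whose entries
  all lie on the diagonal \<open>N\<close>; its monomial is \<open>dmon N\<close>.\<close>

definition shift_perm :: "nat \<Rightarrow> 'n::{finite,linorder} \<Rightarrow> 'n"
  where "shift_perm N i = vcol (dvar i N)"

definition shift_lev :: "nat \<Rightarrow> 'n::{finite,linorder} \<Rightarrow> nat"
  where "shift_lev N i = vlev (dvar i N)"

lemma shift_perm_permutes: "shift_perm N permutes UNIV"
proof (rule bij_imp_permutes)
  have "shift_perm N = (\<lambda>i :: 'a. unrk ((rk i + N) mod CARD('a)))"
    by (simp add: fun_eq_iff shift_perm_def)
  then show "bij (shift_perm N :: 'a \<Rightarrow> 'a)" using bij_shift[of N] by simp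
qed simp

lemma Abs_uvar_shift: "Abs_uvar (i, shift_perm N i, shift_lev N i) = dvar i N"
  using Rep_uvar_inverse[of "dvar i N"] unfolding Rep_uvar_eq shift_perm_def shift_lev_def dvar_simps(1) .

lemma valid_shift: "valid (shift_perm N) (shift_lev N)"
  unfolding valid_def shift_perm_def shift_lev_def using uvar_cases[of "dvar _ N"] by auto

lemma shift_lev_compositions: "shift_lev N \<in> compositions UNIV N"
proof -
  have "pdeg glw (dmon N :: 'a uvar \<Rightarrow>\<^sub>0 nat) = (\<Sum>i\<in>UNIV. glw (dvar i N))"
    by (simp add: dmon_def pdeg_sum)
  from arg_cong[OF this, of "\<lambda>d. snd (snd d)"] show ?thesis
    by (simp add: pdeg_glw_dmon compositions_def shift_lev_def glw_def gl_xyq_def sum_prod)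
qed

definition det_sign :: "'n::{finite,linorder} itself \<Rightarrow> nat \<Rightarrow> int"
  where "det_sign _ N = sign (shift_perm N :: 'n \<Rightarrow> 'n)"

text \<open>The sign of the shift normalizes the coefficient of \<open>dmon N\<close> to 1.\<close>

definition dlead :: "nat \<Rightarrow> ('n::{finite,linorder}, 'k::field) mpol"
  where "dlead N = of_int (det_sign TYPE('n) N) * fps_nth (det u_matrix) N"

lemma det_sign_square: "det_sign TYPE('n::{finite,linorder}) N * det_sign TYPE('n) N = 1"
  by (simp add: det_sign_def sign_def)

lemma det_sign_0: "det_sign TYPE('n::{finite,linorder}) 0 = 1"
proof -
  have "shift_perm 0 = (id :: 'n \<Rightarrow> 'n)" by (auto simp: shift_perm_def)
  then show ?thesis by (simp add: det_sign_def)
qed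

text \<open>All valid terms have the \<open>gl\<close>-degree of \<open>dmon N\<close>. By
  \<open>dwt_pmon\<close> such a term is heavier unless it belongs to the shift, since entries on
  the diagonal \<open>N\<close> determine both the permutation and the levels.\<close>

lemma lead_dlead: "lead (dlead N :: ('n::{finite,linorder}, 'k::field) mpol) (dmon N)"
proof -
  let ?t = "\<lambda>(p, \<kappa>). of_int (sign p) * (if valid p \<kappa> then single (pmon p \<kappa>) 1 else 0) :: ('n, 'k) mpol"
  let ?X = "{p :: 'n \<Rightarrow> 'n. p permutes UNIV} \<times> compositions (UNIV :: 'n set) N"
  let ?c = "of_int (det_sign TYPE('n) N) :: ('n, 'k) mpol"
  let ?x = "(shift_perm N :: 'n \<Rightarrow> 'n, shift_lev N)"
  have fin: "finite ?X" by (intro finite_cartesian_product finite_compositions finite_permutations) auto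
  have x: "?x \<in> ?X" by (simp add: shift_perm_permutes shift_lev_compositions)
  have "pmon (shift_perm N) (shift_lev N) = (dmon N :: 'n uvar \<Rightarrow>\<^sub>0 nat)"
    by (simp add: pmon_def dmon_def Abs_uvar_shift)
  then have "?t ?x = ?c * single (dmon N) 1"
    by (simp add: valid_shift det_sign_def)
  moreover have "?c * ?c = 1"
    by (simp add: det_sign_square flip: of_int_mult)
  ultimately have "?c * ?t ?x = single (dmon N) 1"
    by (simp only: mult.assoc[symmetric] mult_1_left)
  then have "dlead N - single (dmon N) 1 = ?c * (\<Sum>x\<in>?X - {?x}. ?t x)"
    by (simp only: dlead_def fps_nth_det sum.remove[OF fin x, of ?t] distrib_left add_diff_cancel_left')
  also have "\<dots> = (\<Sum>x\<in>?X - {?x}. ?c * ?t x)" by (rule sum_distrib_left)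
  finally have eq: "dlead N - single (dmon N) 1 = (\<Sum>x\<in>?X - {?x}. ?c * ?t x)" .
  have "higher (dmon N) (?c * ?t x)" if "x \<in> ?X - {?x}" for x
  proof -
    obtain p \<kappa> where "x = (p, \<kappa>)" by (cases x)
    then have x: "x = (p, \<kappa>)" "p permutes UNIV" "\<kappa> \<in> compositions UNIV N" "(p, \<kappa>) \<noteq> ?x"
      using that by auto
    show ?thesis
    proof (cases "valid p \<kappa>")
      case True
      have "\<not> (\<forall>i. Abs_uvar (i, p i, \<kappa> i) = dvar i N)"
      proof
        assume *: "\<forall>i. Abs_uvar (i, p i, \<kappa> i) = dvar i N"
        have "p i = shift_perm N i \<and> \<kappa> i = shift_lev N i" for i
          using *[rule_format, of i] True unfolding shift_perm_def shift_lev_def valid_def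
          by (metis Abs_uvar_simps(2,3))
        then show False using x(4) by auto
      qed
      then have "dwt (dmon N :: 'n uvar \<Rightarrow>\<^sub>0 nat) < dwt (pmon p \<kappa>)"
        using dwt_pmon[OF True x(2,3)] by blast
      moreover have "?c * ?t x = single (pmon p \<kappa>) (of_int (det_sign TYPE('n) N * sign p))"
        using True by (simp add: x(1) mult_single flip: single_of_int)
      ultimately show ?thesis
        using pdeg_glw_pmon[OF True x(2,3)] by (auto simp: higher_def)
    qed (simp add: x(1) higher_def)
  qed
  then have "higher (dmon N) (\<Sum>x\<in>Y. ?c * ?t x)" if "Y \<subseteq> ?X - {?x}" for Y
    using that by (induction Y rule: infinite_finite_induct) (auto simp: higher_add, auto simp: higher_def)
  then show ?thesis unfolding lead_def eq by blast
qed

lemma det_rel_eq: "det_rel N =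
  of_int (det_sign TYPE('n) N) * dlead N - (of_bool (N = 0) :: ('n::{finite,linorder}, 'k::field) mpol)"
proof -
  have "of_int (det_sign TYPE('n) N) * (of_int (det_sign TYPE('n) N) * x) = x" for x :: "('n, 'k) mpol"
    by (simp add: det_sign_square flip: mult.assoc of_int_mult)
  then show ?thesis by (simp add: det_rel_def dlead_def fps_one_nth)
qed

lemma dlead_eq: "dlead N =
  of_int (det_sign TYPE('n) N) * det_rel N + (of_bool (N = 0) :: ('n::{finite,linorder}, 'k::field) mpol)"
  by (cases "N = 0") (simp_all add: det_rel_def dlead_def fps_one_nth det_sign_0)

section \<open>The standard monomial basis\<close>

definition dprod :: "(nat \<Rightarrow>\<^sub>0 nat) \<Rightarrow> ('n::{finite,linorder}, 'k::field) mpol"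
  where "dprod a = (\<Prod>s\<in>keys a. dlead s ^ lookup a s)"

lemma dprod_superset:
  assumes "finite A" "keys a \<subseteq> A"
  shows "dprod a = (\<Prod>s\<in>A. dlead s ^ lookup a s)"
  unfolding dprod_def using assms
  by (intro prod.mono_neutral_left) (auto simp: in_keys_iff)

lemma dprod_0 [simp]: "dprod 0 = 1"
  by (simp add: dprod_def)

lemma dprod_single: "dprod (single s 1) = dlead s"
  by (simp add: dprod_def)

lemma dprod_add: "dprod (a + b) = dprod a * dprod b"
proof -
  let ?A = "keys a \<union> keys b"
  have "dprod (a + b) = (\<Prod>s\<in>?A. dlead s ^ lookup (a + b) s)"
    by (rule dprod_superset) (simp_all add: Poly_Mapping.keys_add)
  also have "\<dots> = dprod a * dprod b"
    by (simp add: lookup_add power_add prod.distrib dprod_superset[of ?A a] dprod_superset[of ?A b])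
  finally show ?thesis .
qed

lemma lead_dprod: "lead (dprod a) (pdeg dmon a)"
  unfolding dprod_def pdeg_def by (intro lead_prod lead_power lead_dlead)

text \<open>Each diagonal monomial contained in \<open>M\<close> is replaced by the corresponding
  \<open>dlead s\<close>. The leading monomial is still \<open>M\<close>, so these products are
  unitriangular with respect to the monomials.\<close>

definition dmonom :: "('n::{finite,linorder} uvar \<Rightarrow>\<^sub>0 nat) \<Rightarrow> ('n, 'k::field) mpol"
  where "dmonom M = single (stdpart M) 1 * dprod (dmult M)"

lemma lead_dmonom: "lead (dmonom M) M"
  using lead_mult[OF lead_single lead_dprod, of "stdpart M" "dmult M"]
  by (simp add: dmonom_def stdpart_decomp)

text \<open>Multiplying by \<open>dmon s\<close> changes \<open>dmult\<close> but not
  \<open>stdpart\<close>, so in the coordinates given by \<open>dmonom\<close> the determinant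
  coefficients act by shifting the index.\<close>

lemma dmonom_add_dmon: "dlead s * dmonom M = dmonom (M + dmon s)"
proof -
  have "M + dmon s = M + pdeg dmon (single s 1)" by simp
  then show ?thesis
    by (simp only: dmonom_def stdpart_add_pdeg_dmon dmult_add_pdeg_dmon dprod_add dprod_single)
      (simp add: mult_ac)
qed

lemma dmonom_std: "std m \<Longrightarrow> dmonom m = single m 1"
  by (simp add: dmonom_def stdpart_std) (simp add: std_def)

section \<open>Linear maps given on monomials\<close>

definition lin :: "('m \<Rightarrow> 'm::comm_monoid_add \<Rightarrow>\<^sub>0 'k::comm_ring_1) \<Rightarrow> ('m \<Rightarrow>\<^sub>0 'k) \<Rightarrow> ('m \<Rightarrow>\<^sub>0 'k)"
  where "lin f p = (\<Sum>M\<in>keys p. single 0 (lookup p M) * f M)"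

lemma lin_superset:
  assumes "finite A" "keys p \<subseteq> A"
  shows "lin f p = (\<Sum>M\<in>A. single 0 (lookup p M) * f M)"
  unfolding lin_def using assms
  by (intro sum.mono_neutral_left) (auto simp: in_keys_iff)

lemma lin_0 [simp]: "lin f 0 = 0"
  by (simp add: lin_def)

lemma lin_single: "lin f (single M c) = single 0 c * f M"
  by (simp add: lin_def)

lemma lin_add: "lin f (p + q) = lin f p + lin f q"
proof -
  let ?A = "keys p \<union> keys q"
  have "lin f (p + q) = (\<Sum>M\<in>?A. single 0 (lookup (p + q) M) * f M)"
    by (rule lin_superset) (simp_all add: Poly_Mapping.keys_add)
  also have "\<dots> = lin f p + lin f q"
    by (simp add: lookup_add single_add distrib_right sum.distrib
        lin_superset[of ?A p] lin_superset[of ?A q])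
  finally show ?thesis .
qed

lemma lin_sum: "lin f (\<Sum>x\<in>A. g x) = (\<Sum>x\<in>A. lin f (g x))"
  by (rule additive_sum) (simp_all add: lin_add)

lemma lin_diff: "lin f (p - q) = lin f p - lin f q"
  using lin_add[of f "p - q" q] by (simp add: algebra_simps)

lemma lookup_single_0_mult: "lookup (single 0 c * p) M = c * lookup p M"
  for p :: "'m::comm_monoid_add \<Rightarrow>\<^sub>0 'k::comm_ring_1"
proof -
  have "lookup (Poly_Mapping.map ((*) c) p) M = c * lookup p M"
    by (cases "lookup p M = 0") (simp_all add: map.rep_eq)
  then show ?thesis by (simp only: mult_map_scale_conv_mult)
qed

lemma lin_scale: "lin f (single 0 c * p) = single 0 c * lin f p"
proof -
  have "keys (single 0 c * p) \<subseteq> keys p"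
    by (auto simp: in_keys_iff lookup_single_0_mult)
  then have "lin f (single 0 c * p) = (\<Sum>M\<in>keys p. single 0 (lookup (single 0 c * p) M) * f M)"
    by (intro lin_superset) auto
  also have "\<dots> = (\<Sum>M\<in>keys p. single 0 c * (single 0 (lookup p M) * f M))"
    by (rule sum.cong) (simp_all add: lookup_single_0_mult mult_single flip: mult.assoc)
  finally show ?thesis by (simp add: lin_def sum_distrib_left)
qed

lemma mpol_expansion: "p = (\<Sum>M\<in>keys p. single M (lookup p M))"
proof (rule poly_mapping_eqI)
  fix M
  have "lookup (\<Sum>M'\<in>keys p. single M' (lookup p M')) M = (\<Sum>M'\<in>keys p. if M' = M then lookup p M else 0)"
    unfolding lookup_sum by (rule sum.cong) (auto simp: lookup_single when_def)
  then show "lookup p M = lookup (\<Sum>M'\<in>keys p. single M' (lookup p M')) M"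
    by (simp add: in_keys_iff)
qed

lemma lin_id: "(\<And>M. M \<in> keys p \<Longrightarrow> f M = single M 1) \<Longrightarrow> lin f p = p"
  by (subst (2) mpol_expansion) (simp add: lin_def mult_single)

text \<open>Multiplication by \<open>r\<close> after \<open>lin f\<close> is carried back to
  multiplication by \<open>r'\<close> before \<open>lin g\<close>. Scalars pass through, so it
  suffices to check monomials.\<close>

lemma lin_mult:
  assumes "\<And>M. f M * r = lin g (single M 1 * r')"
  shows "lin f p * r = lin g (p * r')"
proof -
  have "lin f p * r = (\<Sum>M\<in>keys p. single 0 (lookup p M) * (f M * r))"
    by (simp add: lin_def sum_distrib_right mult.assoc)
  also have "\<dots> = (\<Sum>M\<in>keys p. lin g (single M (lookup p M) * r'))"
  proof (rule sum.cong[OF refl])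
    fix M
    have "single M (lookup p M) * r' = single 0 (lookup p M) * (single M 1 * r')"
      by (simp add: mult_single flip: mult.assoc)
    then show "single 0 (lookup p M) * (f M * r) = lin g (single M (lookup p M) * r')"
      by (simp only: assms lin_scale)
  qed
  also have "\<dots> = lin g (p * r')"
    by (subst (3) mpol_expansion) (simp add: lin_sum sum_distrib_right)
  finally show ?thesis .
qed

section \<open>The products \<open>dmonom\<close> form a basis\<close>

lemma lead_lookup:
  assumes "lead p M"
  shows "lookup p M = 1" "m \<in> keys p \<Longrightarrow> m \<noteq> M \<Longrightarrow> dwt M < dwt m"
proof -
  have "M \<notin> keys (p - single M 1)" using assms by (auto simp: lead_def higher_def)
  then show "lookup p M = 1" by (simp add: in_keys_iff lookup_minus)
  show "dwt M < dwt m" if "m \<in> keys p" "m \<noteq> M"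
  proof -
    have "m \<in> keys (p - single M 1)" using that by (simp add: in_keys_iff lookup_minus lookup_single)
    then show ?thesis using assms by (simp add: lead_def higher_def)
  qed
qed

text \<open>In a nonzero combination choose \<open>M\<close> of least weight. The other products
  \<open>dmonom M'\<close> involve only \<open>M'\<close> and monomials heavier than
  \<open>M'\<close>, so \<open>M\<close> keeps its coefficient in the image.\<close>

lemma inj_lin_dmonom: "inj (lin dmonom :: ('n::{finite,linorder}, 'k::field) mpol \<Rightarrow> _)"
proof (rule injI)
  fix p q :: "('n, 'k) mpol" assume "lin dmonom p = lin dmonom q"
  then have 0: "lin dmonom (p - q) = 0" by (simp add: lin_diff)
  have "p - q = 0"
  proof (rule ccontr)
    let ?r = "p - q"
    assume "?r \<noteq> 0"
    then have "keys ?r \<noteq> {}" by simp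
    then obtain M where M: "M \<in> keys ?r" "\<And>M'. M' \<in> keys ?r \<Longrightarrow> dwt M \<le> dwt M'"
      using ex_min_if_finite[of "dwt ` keys ?r"]
      by (metis (no_types, lifting) arg_min_on_def arg_min_least arg_min_if_finite(1) finite_keys)
    have "lookup (lin dmonom ?r) M = (\<Sum>M'\<in>keys ?r. lookup ?r M' * lookup (dmonom M') M)"
      by (simp add: lin_def lookup_sum lookup_single_0_mult)
    also have "\<dots> = (\<Sum>M'\<in>keys ?r. if M' = M then lookup ?r M else 0)"
    proof (rule sum.cong[OF refl])
      fix M' assume "M' \<in> keys ?r"
      then have "M \<notin> keys (dmonom M' :: ('n, 'k) mpol)" if "M' \<noteq> M"
        using lead_lookup(2)[OF lead_dmonom, of M M'] M(2) that by fastforce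
      then show "lookup ?r M' * lookup (dmonom M') M = (if M' = M then lookup ?r M else 0)"
        using lead_lookup(1)[OF lead_dmonom, of M] by (auto simp: in_keys_iff)
    qed
    also have "\<dots> = lookup ?r M" using M(1) by simp
    finally have "lookup ?r M = 0" unfolding 0 by simp
    then show False using M(1) by (simp add: in_keys_iff)
  qed
  then show "p = q" by simp
qed

text \<open>\<open>dmonom M\<close> is the monomial \<open>M\<close> plus heavier monomials of the
  same \<open>gl\<close>-degree. These are reached by induction on the number of heavier monomials
  in that degree. Keeping track of the degree later gives spanning sets of the graded
  components.\<close>

lemma lin_dmonom_surj_monomial:
  "\<exists>p :: ('n::{finite,linorder}, 'k::field) mpol.
    lin dmonom p = single M 1 \<and> (\<forall>m\<in>keys p. pdeg glw m = pdeg glw M)"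
proof (induction "card {m. pdeg glw m = pdeg glw M \<and> dwt M < dwt m}" arbitrary: M rule: less_induct)
  case less
  let ?h = "dmonom M - single M 1 :: ('n, 'k) mpol"
  have h: "pdeg glw m = pdeg glw M \<and> dwt M < dwt m" if "m \<in> keys ?h" for m
    using lead_dmonom[of M] that by (auto simp: lead_def higher_def)
  have "\<exists>p :: ('n, 'k) mpol. lin dmonom p = single m 1 \<and> (\<forall>m'\<in>keys p. pdeg glw m' = pdeg glw M)"
    if "m \<in> keys ?h" for m
  proof -
    have "finite {m. pdeg glw m = pdeg glw M \<and> dwt M < dwt m}"
      by (rule finite_subset[OF _ finite_pdeg_eq[OF proper_wt_glw[of UNIV], of "pdeg glw M"]]) auto
    then have "card {m'. pdeg glw m' = pdeg glw m \<and> dwt m < dwt m'} <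
        card {m. pdeg glw m = pdeg glw M \<and> dwt M < dwt m}"
      using h[OF that] by (intro psubset_card_mono) auto
    from less[OF this] show ?thesis using h[OF that] by simp
  qed
  then obtain y :: "_ \<Rightarrow> ('n, 'k) mpol" where
    y: "\<And>m. m \<in> keys ?h \<Longrightarrow> lin dmonom (y m) = single m 1"
      "\<And>m m'. m \<in> keys ?h \<Longrightarrow> m' \<in> keys (y m) \<Longrightarrow> pdeg glw m' = pdeg glw M"
    by metis
  let ?p = "single M 1 - (\<Sum>m\<in>keys ?h. single 0 (lookup ?h m) * y m)"
  have "lin dmonom (\<Sum>m\<in>keys ?h. single 0 (lookup ?h m) * y m) = (\<Sum>m\<in>keys ?h. single m (lookup ?h m))"
    unfolding lin_sum by (rule sum.cong) (simp_all add: lin_scale y mult_single)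
  also have "\<dots> = ?h" by (rule mpol_expansion[symmetric])
  finally have "lin dmonom ?p = single M 1" by (simp add: lin_diff lin_single)
  moreover have "pdeg glw m = pdeg glw M" if "m \<in> keys ?p" for m
  proof (rule ccontr)
    assume ne: "pdeg glw m \<noteq> pdeg glw M"
    then have "lookup (y m') m = 0" if "m' \<in> keys ?h" for m'
      using y(2)[OF that, of m] by (auto simp: in_keys_iff)
    then have "lookup ?p m = 0"
      using ne by (auto simp: lookup_minus lookup_single when_def lookup_sum lookup_single_0_mult)
    then show False using that by (simp add: in_keys_iff)
  qed
  ultimately show ?case by blast
qed

lemma lin_dmonom_surj:
  fixes p :: "('n::{finite,linorder}, 'k::field) mpol"
  assumes "\<forall>m\<in>keys p. P (pdeg glw m)"
  obtains q where "lin dmonom q = p" "\<forall>m\<in>keys q. P (pdeg glw m)"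
proof -
  obtain y :: "_ \<Rightarrow> ('n, 'k) mpol" where
    y: "\<And>M. lin dmonom (y M) = single M 1" "\<And>M m. m \<in> keys (y M) \<Longrightarrow> pdeg glw m = pdeg glw M"
    using lin_dmonom_surj_monomial by metis
  let ?q = "\<Sum>M\<in>keys p. single 0 (lookup p M) * y M"
  have "lin dmonom ?q = (\<Sum>M\<in>keys p. single M (lookup p M))"
    unfolding lin_sum by (rule sum.cong) (simp_all add: lin_scale y mult_single)
  also have "\<dots> = p" by (rule mpol_expansion[symmetric])
  finally have "lin dmonom ?q = p" .
  moreover have "P (pdeg glw m)" if "m \<in> keys ?q" for m
  proof (rule ccontr)
    assume "\<not> P (pdeg glw m)"
    then have "lookup (y M) m = 0" if "M \<in> keys p" for M
      using y(2)[of m M] assms that by (metis in_keys_iff)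
    then have "lookup ?q m = 0" by (simp add: lookup_sum lookup_single_0_mult)
    then show False using that by (simp add: in_keys_iff)
  qed
  ultimately show ?thesis using that by blast
qed

lemma bij_lin_dmonom: "bij (lin dmonom :: ('n::{finite,linorder}, 'k::field) mpol \<Rightarrow> _)"
proof -
  have "\<exists>q. lin dmonom q = p" for p :: "('n, 'k) mpol"
    using lin_dmonom_surj[of p "\<lambda>_. True"] by blast
  then show ?thesis using inj_lin_dmonom by (metis bij_def surj_def)
qed

text \<open>The value of \<open>dmonom M\<close> where the determinant is 1, i.e. \<open>dlead 0 = 1\<close> and \<open>dlead s = 0\<close> for \<open>s > 0\<close>\<close>

definition dspec :: "('n::{finite,linorder} uvar \<Rightarrow>\<^sub>0 nat) \<Rightarrow> ('n, 'k::field) mpol"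
  where "dspec M = (if keys (dmult M) \<subseteq> {0} then single (stdpart M) 1 else 0)"

section \<open>Normal forms modulo the determinant relations\<close>

definition normal_form :: "('n::{finite,linorder}, 'k::field) mpol \<Rightarrow> ('n, 'k) mpol"
  where "normal_form p = lin dspec (inv (lin dmonom) p)"

lemma normal_form_lin_dmonom: "normal_form (lin dmonom q) = lin dspec q"
  by (simp add: normal_form_def inv_f_f inj_lin_dmonom)

lemma normal_form_std:
  assumes "\<forall>m\<in>keys p. std m"
  shows "normal_form p = p"
proof -
  have "lin dmonom p = p" using assms by (intro lin_id) (simp add: dmonom_std)
  moreover have "lin dspec p = p"
    using assms by (intro lin_id) (auto simp: dspec_def stdpart_std std_def)
  ultimately show ?thesis using normal_form_lin_dmonom[of p] by simp
qed

lemma normal_form_add: "normal_form (p + q) = normal_form p + normal_form q"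
proof -
  obtain p' q' where "p = lin dmonom p'" "q = lin dmonom q'"
    using bij_lin_dmonom by (metis bij_pointE)
  then show ?thesis by (simp add: normal_form_lin_dmonom lin_add flip: lin_add)
qed

lemma dspec_add_dmon: "dspec (M + dmon s) = (if s = 0 then dspec M else 0)"
proof -
  have *: "M + dmon s = M + pdeg dmon (single s 1)" by simp
  have "keys (dmult M + single s 1) = insert s (keys (dmult M))"
    by (auto simp: in_keys_iff lookup_add lookup_single when_def split: if_splits)
  then show ?thesis unfolding dspec_def * stdpart_add_pdeg_dmon dmult_add_pdeg_dmon by auto
qed

text \<open>In the coordinates given by \<open>dmonom\<close>, multiplication by
  \<open>det_rel N\<close> becomes multiplication by \<open>?r\<close>, the signed monomial
  \<open>dmon N\<close> minus 1 if \<open>N = 0\<close>. This is annihilated by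
  \<open>dspec\<close>, for which a factor \<open>dmon 0\<close> makes no difference and a factor
  \<open>dmon N\<close> with \<open>N > 0\<close> gives 0.\<close>

lemma normal_form_mult_det_rel: "normal_form (x * det_rel N) = 0"
proof -
  obtain q where x: "x = lin dmonom q" using bij_lin_dmonom by (metis bij_pointE)
  let ?c = "of_int (det_sign TYPE('a) N) :: ('a, 'b) mpol" and ?b = "of_bool (N = 0) :: ('a, 'b) mpol"
  let ?r = "?c * single (dmon N) 1 - ?b"
  have c: "?c = single 0 (of_int (det_sign TYPE('a) N))" and b: "?b = single 0 (of_bool (N = 0))"
    by (simp_all)
  have gen: "lin f (single M 1 * ?r) =
      single 0 (of_int (det_sign TYPE('a) N)) * f (M + dmon N) - single 0 (of_bool (N = 0)) * f M"
    for f :: "_ \<Rightarrow> ('a, 'b) mpol" and M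
  proof -
    have "single M 1 * ?r = single (M + dmon N) (of_int (det_sign TYPE('a) N)) - single M (of_bool (N = 0))"
      unfolding b c by (simp add: right_diff_distrib mult_single del: single_of_int)
    then show ?thesis by (simp only: lin_diff lin_single)
  qed
  have "x * det_rel N = lin dmonom (q * ?r)"
    unfolding x
  proof (rule lin_mult)
    fix M
    have "dmonom M * det_rel N = ?c * (dlead N * dmonom M) - ?b * dmonom M"
      by (simp add: det_rel_eq algebra_simps)
    then show "dmonom M * det_rel N = lin dmonom (single M 1 * ?r)"
      unfolding dmonom_add_dmon gen unfolding b c .
  qed
  then have "normal_form (x * det_rel N) = lin dspec (q * ?r)"
    by (simp add: normal_form_lin_dmonom)
  also have "\<dots> = lin (\<lambda>_. 0) q * 1"
  proof (rule lin_mult[symmetric])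
    fix M show "0 * 1 = lin dspec (single M 1 * ?r)"
      unfolding gen by (simp add: dspec_add_dmon det_sign_0)
  qed
  finally show ?thesis by (simp add: lin_def)
qed

lemma normal_form_ideal:
  assumes "p \<in> iw_ideal"
  shows "normal_form p = 0"
proof -
  \<comment> \<open>Quantifying over all multiples makes the claim stable under scaling by ring
    elements, as induction over the span requires.\<close>
  have "\<forall>r. normal_form (r * p) = 0"
    using assms unfolding iw_ideal_def ideal_gen_def
  proof (induction rule: module.span_induct[OF module_mult, consumes 1])
    case 1
    show ?case
      unfolding module.subspace_def[OF module_mult]
    proof (intro conjI allI ballI CollectI)
      show "normal_form (r * 0) = 0" for r :: "('a, 'b) mpol" using normal_form_std[of 0] by simp
      show "normal_form (r * (p + q)) = 0"
        if "p \<in> {p. \<forall>r. normal_form (r * p) = 0}" "q \<in> {p. \<forall>r. normal_form (r * p) = 0}"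
        for p q r :: "('a, 'b) mpol"
        using that by (simp add: distrib_left normal_form_add)
      show "normal_form (r * (c * p)) = 0" if "p \<in> {p. \<forall>r. normal_form (r * p) = 0}"
        for c p r :: "('a, 'b) mpol"
        using that by (simp flip: mult.assoc)
    qed
  next
    case (2 p)
    then show ?case using normal_form_mult_det_rel by blast
  qed
  then show ?thesis by (metis mult_1)
qed

text \<open>A combination of standard monomials is its own normal form, and normal forms vanish on
  the ideal. This yields the linear independence of the standard classes.\<close>

lemma std_ideal_eq_0: "p \<in> iw_ideal \<Longrightarrow> \<forall>m\<in>keys p. std m \<Longrightarrow> p = 0"
  using normal_form_ideal normal_form_std by metis

lemma det_rel_iw_ideal: "det_rel N \<in> iw_ideal"
  unfolding iw_ideal_def ideal_gen_def by (rule module.span_base[OF module_mult]) simp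

lemma iw_ideal_mult: "p \<in> iw_ideal \<Longrightarrow> r * p \<in> iw_ideal"
  unfolding iw_ideal_def by (rule ideal_gen_mult)

lemma iw_ideal_mult_right: "p \<in> iw_ideal \<Longrightarrow> p * r \<in> iw_ideal"
  by (metis iw_ideal_mult mult.commute)

lemma iw_ideal_sum: "(\<And>x. x \<in> A \<Longrightarrow> f x \<in> iw_ideal) \<Longrightarrow> sum f A \<in> iw_ideal"
  by (induction A rule: infinite_finite_induct) (auto simp: iw_ideal_def ideal_gen_0 ideal_gen_add)

lemma dlead_iw_ideal: "dlead s - of_bool (s = 0) \<in> iw_ideal"
  by (simp add: dlead_eq iw_ideal_mult det_rel_iw_ideal)

text \<open>Modulo the ideal \<open>dlead 0\<close> is 1 and every other \<open>dlead s\<close> is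
  0.\<close>

lemma dmonom_dspec: "dmonom M - dspec M \<in> iw_ideal"
proof (cases "keys (dmult M) \<subseteq> {0}")
  case True
  let ?r = "lookup (dmult M) 0"
  have "dprod (dmult M) = (dlead 0 ^ ?r :: ('a, 'b) mpol)"
    using dprod_superset[OF _ True] by simp
  then have "dmonom M - dspec M = single (stdpart M) 1 * (dlead 0 ^ ?r - 1 :: ('a, 'b) mpol)"
    using True by (simp add: dmonom_def dspec_def algebra_simps)
  also have "dlead 0 ^ ?r - 1 = (dlead 0 - 1) * (\<Sum>i<?r. dlead 0 ^ i :: ('a, 'b) mpol)"
    by (rule power_diff_1_eq)
  finally have "dmonom M - dspec M =
      single (stdpart M) 1 * ((dlead 0 - 1) * (\<Sum>i<?r. dlead 0 ^ i) :: ('a, 'b) mpol)" .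
  moreover have "dlead 0 - 1 \<in> (iw_ideal :: ('a, 'b) mpol set)"
    using dlead_iw_ideal[of 0, where 'a = 'a and 'b = 'b] by simp
  ultimately show ?thesis by (simp only: iw_ideal_mult iw_ideal_mult_right)
next
  case False
  then obtain s where s: "s \<in> keys (dmult M)" "s \<noteq> 0" by auto
  then obtain r where r: "lookup (dmult M) s = Suc r" by (metis in_keys_iff not0_implies_Suc)
  have "dprod (dmult M) = (dlead s :: ('a, 'b) mpol) *
      (dlead s ^ r * (\<Prod>t\<in>keys (dmult M) - {s}. dlead t ^ lookup (dmult M) t))"
    unfolding dprod_def by (subst prod.remove[OF finite_keys s(1)]) (simp add: r mult.assoc)
  moreover have "(dlead s :: ('a, 'b) mpol) \<in> iw_ideal" using dlead_iw_ideal[of s, where 'a = 'a and 'b = 'b] s(2) by simp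
  ultimately show ?thesis
    using False by (simp add: dmonom_def dspec_def iw_ideal_mult iw_ideal_mult_right)
qed

lemma lin_dmonom_dspec: "lin dmonom q - lin dspec q \<in> iw_ideal"
proof -
  have "lin dmonom q - lin dspec q = (\<Sum>M\<in>keys q. single 0 (lookup q M) * (dmonom M - dspec M))"
    by (simp add: lin_def right_diff_distrib sum_subtractf)
  then show ?thesis by (simp add: iw_ideal_sum iw_ideal_mult dmonom_dspec)
qed

section \<open>A basis of each graded component of the quotient\<close>

lemma iw_class_eq_iff: "iw_class p = iw_class q \<longleftrightarrow> p - q \<in> iw_ideal"
  by (rule iwahori_fun.abs_eq_iff)

lemma iw_class_0: "iw_class 0 = 0"
  by (simp add: zero_iwahori_fun_def)

lemma iw_class_sum: "iw_class (sum f A) = (\<Sum>x\<in>A. iw_class (f x))"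
  by (rule additive_sum) (simp_all add: iw_class_0 plus_iwahori_fun.abs_eq)

lemma iw_class_single: "iw_class (single M c) = iw_scale c (iw_class (single M 1))"
  by (simp add: iw_scale_def times_iwahori_fun.abs_eq mult_single)

definition std_class :: "('n::{finite,linorder} uvar \<Rightarrow>\<^sub>0 nat) \<Rightarrow> ('n, 'k::field) iwahori_fun"
  where "std_class m = iw_class (single m 1)"

text \<open>A representative is expanded in \<open>dmonom\<close> within its degree, and each
  \<open>dmonom M\<close> is replaced by \<open>dspec M\<close>. A nonzero \<open>dspec M\<close>
  arises from \<open>M\<close> by removing powers of \<open>dmon 0\<close>, which has
  \<open>sl\<close>-degree 0, so the degree persists.\<close>

lemma iw_component_subset_span:
  "(iw_component d :: ('n::{finite,linorder}, 'k::field) iwahori_fun set) \<subseteq>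
    iw.span (std_class ` {m. std m \<and> pdeg slw m = d})"
proof
  fix x :: "('n, 'k) iwahori_fun" assume "x \<in> iw_component d"
  then obtain p :: "('n, 'k) mpol" where p: "x = iw_class p" "\<forall>m\<in>keys p. sl_of_gl (pdeg glw m) = d"
    by (auto simp: iw_component_def mpol_component_def mono_degree_pdeg sl_of_gl_pdeg)
  from lin_dmonom_surj[OF p(2)] obtain q where
    q: "lin dmonom q = p" "\<forall>m\<in>keys q. sl_of_gl (pdeg glw m) = d" .
  have "x = iw_class (lin dspec q)"
    unfolding p(1) iw_class_eq_iff using lin_dmonom_dspec[of q] q(1) by simp
  also have "\<dots> = (\<Sum>M\<in>keys q. iw_scale (lookup q M) (iw_class (dspec M)))"
    by (simp add: lin_def iw_class_sum iw_scale_def times_iwahori_fun.abs_eq)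
  also have "\<dots> \<in> iw.span (std_class ` {m. std m \<and> pdeg slw m = d})"
  proof (intro iw.span_sum iw.span_scale)
    fix M assume M: "M \<in> keys q"
    show "iw_class (dspec M) \<in> iw.span (std_class ` {m. std m \<and> pdeg slw m = d})"
    proof (cases "keys (dmult M) \<subseteq> {0}")
      case True
      have "pdeg slw (pdeg dmon (dmult M) :: 'n uvar \<Rightarrow>\<^sub>0 nat) = pdeg (\<lambda>s. pdeg slw (dmon s :: 'n uvar \<Rightarrow>\<^sub>0 nat)) (dmult M)"
        by (rule additive_pdeg) (simp_all add: pdeg_add)
      also have "\<dots> = 0"
        using True by (simp add: pdeg_superset[of "{0}"] pdeg_slw_dmon nsmul_def zero_prod_def[symmetric])
      finally have "pdeg slw (stdpart M) = pdeg slw M"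
        using arg_cong[OF stdpart_decomp[of M], of "pdeg slw"] by (simp add: pdeg_add)
      then have "pdeg slw (stdpart M) = d" using q(2) M by (simp add: sl_of_gl_pdeg)
      then show ?thesis
        using True by (intro iw.span_base) (auto simp: dspec_def std_class_def)
    qed (simp add: dspec_def iw_class_0 iw.span_zero)
  qed
  finally show "x \<in> iw.span (std_class ` {m. std m \<and> pdeg slw m = d})" .
qed

lemma std_class_lin_indep:
  fixes c :: "('n::{finite,linorder} uvar \<Rightarrow>\<^sub>0 nat) \<Rightarrow> 'k::field"
  assumes "finite S" "\<forall>m\<in>S. std m" "(\<Sum>m\<in>S. iw_scale (c m) (std_class m)) = 0" "m \<in> S"
  shows "c m = 0"
proof -
  let ?p = "(\<Sum>m\<in>S. single m (c m)) :: ('n, 'k) mpol"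
  have look: "lookup ?p m = (if m \<in> S then c m else 0)" for m
    using assms(1) by (simp add: lookup_sum lookup_single when_def)
  have "iw_class ?p = iw_class 0"
    unfolding iw_class_0 assms(3)[symmetric] iw_class_sum std_class_def
    by (rule sum.cong[OF refl], rule iw_class_single)
  then have "?p \<in> iw_ideal" by (simp add: iw_class_eq_iff)
  moreover have "\<forall>m\<in>keys ?p. std m"
    using assms(2) by (auto simp: in_keys_iff look split: if_splits)
  ultimately have "?p = 0" by (rule std_ideal_eq_0)
  then have "lookup ?p m = 0" by (simp only: lookup_zero)
  then show ?thesis using assms(4) by (simp add: look)
qed

lemma inj_on_std_class:
  "inj_on (std_class :: _ \<Rightarrow> ('n, 'k::field) iwahori_fun) {m :: 'n::{finite,linorder} uvar \<Rightarrow>\<^sub>0 nat. std m}"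
proof (rule inj_onI, rule ccontr)
  fix m m' :: "'n uvar \<Rightarrow>\<^sub>0 nat"
  \<comment> \<open>Two distinct standard monomials with equal classes would give a linear relation
    with the coefficients 1 and -1.\<close>
  let ?c = "\<lambda>x. if x = m then 1 else - 1 :: 'k"
  assume m: "m \<in> {m. std m}" "m' \<in> {m. std m}" "m \<noteq> m'"
    and eq: "std_class m = (std_class m' :: ('n, 'k) iwahori_fun)"
  then have "(\<Sum>x\<in>{m, m'}. iw_scale (?c x) (std_class x :: ('n, 'k) iwahori_fun)) = 0"
    by simp
  from std_class_lin_indep[OF _ _ this, of m] show False using m by simp
qed

lemma dim_iw_component:
  "iw.dim (iw_component d :: ('n::{finite,linorder}, 'k::field) iwahori_fun set) =
    card {m :: 'n uvar \<Rightarrow>\<^sub>0 nat. std m \<and> pdeg slw m = d}"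
proof (rule iw.dim_unique)
  let ?S = "{m :: 'n uvar \<Rightarrow>\<^sub>0 nat. std m \<and> pdeg slw m = d}"
  let ?B = "std_class ` ?S :: ('n, 'k) iwahori_fun set"
  have fin: "finite ?S" by (rule finite_std_sl)
  have inj: "inj_on (std_class :: _ \<Rightarrow> ('n, 'k) iwahori_fun) ?S"
    by (rule inj_on_subset[OF inj_on_std_class]) auto
  show "?B \<subseteq> iw_component d"
    by (auto simp: iw_component_def std_class_def mpol_component_def mono_degree_pdeg)
  show "(iw_component d :: ('n, 'k) iwahori_fun set) \<subseteq> iw.span ?B"
    by (rule iw_component_subset_span)
  show "iw.independent ?B"
    unfolding iw.dependent_finite[OF finite_imageI[OF fin]]
  proof
    assume "\<exists>u. (\<exists>v\<in>?B. u v \<noteq> 0) \<and> (\<Sum>v\<in>?B. iw_scale (u v) v) = 0"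
    then obtain u m where u: "(\<Sum>x\<in>?B. iw_scale (u x) x) = 0" and m: "m \<in> ?S" "u (std_class m) \<noteq> 0"
      by blast
    have "(\<Sum>m\<in>?S. iw_scale (u (std_class m)) (std_class m)) = 0"
      using u by (simp add: sum.reindex[OF inj])
    from std_class_lin_indep[OF fin _ this, of m] show False using m by simp
  qed
  show "card ?B = card ?S" by (rule card_image[OF inj])
qed

theorem proposition6p2:
  assumes "CARD('n::{finite,linorder}) \<ge> 2"
  shows "iw_components_fin_dim TYPE('n) TYPE('k::{alg_closed_field,field_char_0})
    \<and> to_sl_defined (gl_fraction :: 'n zvec \<times> 'n zvec \<times> nat \<Rightarrow> int)
    \<and> iw_character TYPE('k) = to_sl (gl_fraction :: 'n zvec \<times> 'n zvec \<times> nat \<Rightarrow> int)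
    \<and> to_sl (gl_fraction :: 'n zvec \<times> 'n zvec \<times> nat \<Rightarrow> int) = sl_fraction"
proof (intro conjI ext)
  show "iw_components_fin_dim TYPE('n) TYPE('k)"
    unfolding iw_components_fin_dim_def
    by (meson finite_imageI finite_std_sl iw_component_subset_span)
  show "to_sl_defined (gl_fraction :: 'n zvec \<times> 'n zvec \<times> nat \<Rightarrow> int)"
    by (rule to_sl_defined_gl_fraction)
  fix d :: "'n wlat \<times> 'n wlat \<times> nat"
  show "iw_character TYPE('k) d = to_sl gl_fraction d"
    by (simp add: iw_character_def dim_iw_component to_sl_gl_fraction)
  show "to_sl gl_fraction d = sl_fraction d"
    by (simp add: to_sl_gl_fraction std_count_sl)
qed

end
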